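(* For every $N \in \{3,4\}$ there exists a finite-dimensional orthogonal representation $\pi_N$ of $\mathrm{SL}_N(\mathbb{Z})$, all of whose invariant vectors are trivial, such that $$H^{N-1}(\mathrm{SL}_N(\mathbb{Z});\pi_N)\neq 0 .$$ Since $\pi_N$ is finite-dimensional, the reduced and non-reduced cohomologies with coefficients in $\pi_N$ are equal, and therefore $\mathrm{SL}_N(\mathbb{Z})$ does not have property $(T_{N-1})$.
   Context: An orthogonal representation of a group $G$ is a homomorphism from $G$ to the orthogonal group of a real Hilbert space (here finite-dimensional). "All invariant vectors are trivial" means that the only vector fixed by every element of $G$ is $0$. $H^{n}(G;\pi)$ denotes group cohomology with coefficients in the $G$-module given by the representation $\pi$. Reduced cohomology is the quotient of the space of cocycles by the closure of the space of coboundaries (with the topology of pointwise convergence on cochains with values in the Hilbert space). Property $(T_n)$ (Bader--Sauer), for a group $G$: the $n$th reduced cohomology of $G$ vanishes with coefficients in every unitary representation of $G$ all of whose invariant vectors are trivial. (An orthogonal representation is regarded as unitary via complexification.) *)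

theory Defs
  imports
    "HOL-Analysis.Abstract_Metric_Spaces"
    "HOL-Analysis.Function_Topology"
    "HOL-Algebra.Bij"
    "HOL-Algebra.Coset"
    "HOL-Algebra.Product_Groups"
    "Jordan_Normal_Form.Conjugate"
    "Jordan_Normal_Form.Determinant"
    "Jordan_Normal_Form.VS_Connect"
begin

section \<open>Hilbert spaces and unitary representations\<close>

text \<open>
  Hilbert spaces are records with an explicit carrier, so that one can quantify over all of
  them inside a formula. The scalar type \<open>'k\<close> is used only at \<open>real\<close>, where \<open>conjugate\<close> is the
  identity, and at \<open>complex\<close>, where \<open>conjugate\<close> is \<open>cnj\<close> and \<open>0 \<le> z\<close> means that \<open>z\<close> is real and
  nonnegative. The multiplicative fields that the record inherits from \<open>ring\<close> play no role.
\<close>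

record ('k, 'v) inner_space = "('k, 'v) module" +
  ip :: "'v \<Rightarrow> 'v \<Rightarrow> 'k"

text \<open>
  The distance is set to 0 off the carrier because the locale \<open>Metric_space\<close> requires symmetry
  of the distance on the whole type.
\<close>

definition hdist :: "('k::real_normed_field, 'v) inner_space \<Rightarrow> 'v \<Rightarrow> 'v \<Rightarrow> real" where
  "hdist H x y =
     (if x \<in> carrier H \<and> y \<in> carrier H
      then sqrt (norm (ip H (x \<ominus>\<^bsub>H\<^esub> y) (x \<ominus>\<^bsub>H\<^esub> y))) else 0)"

definition htopology :: "('k::real_normed_field, 'v) inner_space \<Rightarrow> 'v topology" where
  "htopology H = Metric_space.mtopology (carrier H) (hdist H)"

locale hilbert_space =
  vectorspace "class_ring :: 'k ring" H
  for H :: "('k::{conjugatable_ordered_field, real_normed_field}, 'v) inner_space" +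
  assumes ip_add: "\<lbrakk>x \<in> carrier H; y \<in> carrier H; z \<in> carrier H\<rbrakk> \<Longrightarrow>
      ip H (x \<oplus>\<^bsub>H\<^esub> y) z = ip H x z + ip H y z"
    and ip_smult: "\<lbrakk>x \<in> carrier H; y \<in> carrier H\<rbrakk> \<Longrightarrow> ip H (a \<odot>\<^bsub>H\<^esub> x) y = a * ip H x y"
    and ip_conjugate: "\<lbrakk>x \<in> carrier H; y \<in> carrier H\<rbrakk> \<Longrightarrow> ip H y x = conjugate (ip H x y)"
    and ip_nonneg: "x \<in> carrier H \<Longrightarrow> 0 \<le> ip H x x"
    and ip_definite: "\<lbrakk>x \<in> carrier H; ip H x x = 0\<rbrakk> \<Longrightarrow> x = \<zero>\<^bsub>H\<^esub>"
    and complete: "Metric_space.mcomplete (carrier H) (hdist H)"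

text \<open>For real scalars this is the orthogonal group of \<open>H\<close>, for complex scalars the unitary group.\<close>

definition unitary_group :: "('k, 'v) inner_space \<Rightarrow> ('v \<Rightarrow> 'v) monoid" where
  "unitary_group H = (BijGroup (carrier H))\<lparr>carrier :=
     {T \<in> Bij (carrier H).
        (\<forall>x\<in>carrier H. \<forall>y\<in>carrier H. T (x \<oplus>\<^bsub>H\<^esub> y) = T x \<oplus>\<^bsub>H\<^esub> T y) \<and>
        (\<forall>a. \<forall>x\<in>carrier H. T (a \<odot>\<^bsub>H\<^esub> x) = a \<odot>\<^bsub>H\<^esub> T x) \<and>
        (\<forall>x\<in>carrier H. \<forall>y\<in>carrier H. ip H (T x) (T y) = ip H x y)}\<rparr>"

locale unitary_representation = group G + hilbert_space H
  for G :: "('g, 'm) monoid_scheme"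
    and H :: "('k::{conjugatable_ordered_field, real_normed_field}, 'v) inner_space"
    and \<pi> :: "'g \<Rightarrow> 'v \<Rightarrow> 'v" +
  assumes hom: "\<pi> \<in> hom G (unitary_group H)"

abbreviation orthogonal_representation ::
    "('g, 'm) monoid_scheme \<Rightarrow> (real, 'v) inner_space \<Rightarrow> ('g \<Rightarrow> 'v \<Rightarrow> 'v) \<Rightarrow> bool" where
  "orthogonal_representation \<equiv> unitary_representation"

definition finite_dimensional :: "('k::field, 'v) inner_space \<Rightarrow> bool" where
  "finite_dimensional H \<longleftrightarrow> vectorspace.fin_dim class_ring H"

definition invariant_vectors ::
    "('g, 'm) monoid_scheme \<Rightarrow> ('v, 'n) ring_scheme \<Rightarrow> ('g \<Rightarrow> 'v \<Rightarrow> 'v) \<Rightarrow> 'v set" where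
  "invariant_vectors G V \<pi> = {v \<in> carrier V. \<forall>g\<in>carrier G. \<pi> g v = v}"


section \<open>Group cohomology by inhomogeneous cochains\<close>

text \<open>
  An \<open>n\<close>-cochain is a function from \<open>G\<^sup>n\<close> to the coefficient module \<open>V\<close>, of which only the
  additive group is used; \<open>G\<^sup>n\<close> consists of the lists of length \<open>n\<close> over the carrier of \<open>G\<close>.
\<close>

definition tuples :: "('g, 'm) monoid_scheme \<Rightarrow> nat \<Rightarrow> 'g list set" where
  "tuples G n = {gs. set gs \<subseteq> carrier G \<and> length gs = n}"

definition cochain_group ::
    "('g, 'm) monoid_scheme \<Rightarrow> ('v, 'n) ring_scheme \<Rightarrow> nat \<Rightarrow> ('g list \<Rightarrow> 'v) monoid" where
  "cochain_group G V n = product_group (tuples G n) (\<lambda>_. add_monoid V)"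

text \<open>
  For \<open>gs = [g\<^sub>0, \<dots>, g\<^sub>n]\<close> the value of the coboundary of an \<open>n\<close>-cochain \<open>f\<close> is
  \<open>g\<^sub>0 f(g\<^sub>1, \<dots>, g\<^sub>n) + (\<Sum>i<n. (-1)\<^sup>i\<^sup>+\<^sup>1 f(g\<^sub>0, \<dots>, g\<^sub>i g\<^sub>i\<^sub>+\<^sub>1, \<dots>, g\<^sub>n)) + (-1)\<^sup>n\<^sup>+\<^sup>1 f(g\<^sub>0, \<dots>, g\<^sub>n\<^sub>-\<^sub>1)\<close>.
\<close>

definition coboundary ::
    "('g, 'm) monoid_scheme \<Rightarrow> ('v, 'n) ring_scheme \<Rightarrow> ('g \<Rightarrow> 'v \<Rightarrow> 'v) \<Rightarrow> nat
     \<Rightarrow> ('g list \<Rightarrow> 'v) \<Rightarrow> 'g list \<Rightarrow> 'v" where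
  "coboundary G V \<pi> n f = (\<lambda>gs\<in>tuples G (Suc n).
     \<pi> (hd gs) (f (tl gs)) \<oplus>\<^bsub>V\<^esub>
     (\<Oplus>\<^bsub>V\<^esub>i\<in>{..<n}. add_pow V ((-1::int) ^ (i + 1))
        (f (take i gs @ (gs ! i \<otimes>\<^bsub>G\<^esub> gs ! (i + 1)) # drop (i + 2) gs))) \<oplus>\<^bsub>V\<^esub>
     add_pow V ((-1::int) ^ (n + 1)) (f (butlast gs)))"

definition cocycles ::
    "('g, 'm) monoid_scheme \<Rightarrow> ('v, 'n) ring_scheme \<Rightarrow> ('g \<Rightarrow> 'v \<Rightarrow> 'v) \<Rightarrow> nat
     \<Rightarrow> ('g list \<Rightarrow> 'v) set" where
  "cocycles G V \<pi> n =
     kernel (cochain_group G V n) (cochain_group G V (Suc n)) (coboundary G V \<pi> n)"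

primrec coboundaries ::
    "('g, 'm) monoid_scheme \<Rightarrow> ('v, 'n) ring_scheme \<Rightarrow> ('g \<Rightarrow> 'v \<Rightarrow> 'v) \<Rightarrow> nat
     \<Rightarrow> ('g list \<Rightarrow> 'v) set" where
  "coboundaries G V \<pi> 0 = {\<one>\<^bsub>cochain_group G V 0\<^esub>}"
| "coboundaries G V \<pi> (Suc n) = coboundary G V \<pi> n ` carrier (cochain_group G V n)"

definition cohomology ::
    "('g, 'm) monoid_scheme \<Rightarrow> ('v, 'n) ring_scheme \<Rightarrow> ('g \<Rightarrow> 'v \<Rightarrow> 'v) \<Rightarrow> nat
     \<Rightarrow> ('g list \<Rightarrow> 'v) set monoid" where
  "cohomology G V \<pi> n =
     (cochain_group G V n)\<lparr>carrier := cocycles G V \<pi> n\<rparr> Mod coboundaries G V \<pi> n"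

text \<open>
  Reduced cohomology: cocycles modulo the closure of the coboundaries in the space of cocycles.
  The product topology on functions is the topology of pointwise convergence.
\<close>

definition reduced_cohomology ::
    "('g, 'm) monoid_scheme \<Rightarrow> ('k::real_normed_field, 'v) inner_space \<Rightarrow> ('g \<Rightarrow> 'v \<Rightarrow> 'v) \<Rightarrow> nat
     \<Rightarrow> ('g list \<Rightarrow> 'v) set monoid" where
  "reduced_cohomology G H \<pi> n =
     (cochain_group G H n)\<lparr>carrier := cocycles G H \<pi> n\<rparr> Mod
     (subtopology (product_topology (\<lambda>_. htopology H) (tuples G n)) (cocycles G H \<pi> n)
        closure_of coboundaries G H \<pi> n)"


section \<open>Property \<open>(T\<^sub>n)\<close> and special linear groups\<close>

text \<open>
  A formula cannot quantify over all types, so the type \<open>'v\<close> from which the carriers of the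
  complex Hilbert spaces are drawn is a parameter. The property becomes stronger as \<open>'v\<close> grows;
  its negation for one \<open>'v\<close> therefore implies its negation for every larger type.
  For a countable group, \<open>nat \<Rightarrow> complex\<close> is large enough to give the unrestricted
  property: it carries a copy of every separable Hilbert space, and a cocycle on a countable
  group takes its values in a separable invariant closed subspace.
\<close>

definition property_T :: "'v itself \<Rightarrow> ('g, 'm) monoid_scheme \<Rightarrow> nat \<Rightarrow> bool" where
  "property_T (ty :: 'v itself) G n \<longleftrightarrow>
     (\<forall>(H :: (complex, 'v) inner_space) \<pi>.
        unitary_representation G H \<pi> \<and> invariant_vectors G H \<pi> = {\<zero>\<^bsub>H\<^esub>} \<longrightarrow>
        carrier (reduced_cohomology G H \<pi> n) = {\<one>\<^bsub>reduced_cohomology G H \<pi> n\<^esub>})"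

definition special_linear_group :: "'a::comm_ring_1 itself \<Rightarrow> nat \<Rightarrow> 'a mat monoid" where
  "special_linear_group (ty :: 'a itself) n =
     \<lparr>carrier = {A \<in> carrier_mat n n. det A = 1}, mult = (*), one = 1\<^sub>m n\<rparr>"

abbreviation SL_int :: "nat \<Rightarrow> int mat monoid" where
  "SL_int \<equiv> special_linear_group TYPE(int)"

end

theory Submission
  imports Defs "HOL-Library.Function_Algebras" "HOL-Computational_Algebra.Polynomial"
begin

text \<open>
  Let \<open>n = N\<close> and consider pairs of an integral covector \<open>v\<close> and an integral vector \<open>w\<close> with
  \<open>v w = 1\<close>. A positive definite form \<open>q\<close> turns \<open>v\<close> into the vector \<open>q(v, \<cdot>)\<close>, and the forms for which
  it is proportional to \<open>w\<close> make up a submanifold of codimension \<open>n - 1\<close> of the symmetric space. Counting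
  the pairs with \<open>w\<close> in a given class modulo 4 whose submanifold meets a simplex, that is, for which \<open>w\<close>
  lies in the cone spanned by the vectors \<open>q\<^sub>i(v, \<cdot>)\<close> of the vertices \<open>q\<^sub>i\<close>, gives an
  \<open>(n - 1)\<close>-cocycle with values in the permutation module of the classes modulo 4. General position of all
  translates of a single form is impossible, so the \<open>k\<close>-th vertex of a simplex is a translate of a generic
  form \<open>q\<^sub>k\<close> of its own.

  The cocycle is evaluated on the fundamental cycle of the abelian group of unipotent matrices that differ
  from the identity in the first column only, at two classes whose difference kills the constant functions.
  At one class no pair contributes; at the other the simplices triangulate a torus, and exactly one of them
  contains exactly one admissible \<open>w\<close>. Coboundaries evaluate to 0.
\<close>

section \<open>Sum-zero permutation representations\<close>

text \<open>A single form \<open>q\<close> fails for a concrete reason: \<open>tr (U \<tau>)\<close>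
  fixes the covector \<open>e0\<close>, so the translates of \<open>q\<close> by
  \<open>U \<tau>\<close> turn it into \<open>q(e0, .) + q(e0, e0) \<tau>\<close>, and three
  collinear \<tau> give linearly dependent vectors whatever \<open>q\<close> is. Labelling the slots
  removes this, but deleting a vertex now moves later vertices to other slots, so the count
  \<open>F\<close> itself is not a homogeneous cocycle. \<open>Delta\<close> restores the relation
  formally: the first slot is frozen and each other slot takes two consecutive vertices.

  The modulus 4 leaves room for \<open>n - 1\<close> distinct nonzero classes, which single out one
  simplex of a cube of side 4; it separates 1 from -1 in the entry \<open>w $ 0\<close>, and it has
  a class, that of 2, without units.

  In positive degree the cochain spaces are infinite-dimensional although the representation is not.
  Closedness of the coboundaries therefore rests on infinite linear systems in which every equation
  is finite.\<close>

locale transitive_action = group G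
  for G :: "('g, 'm) monoid_scheme" (structure) +
  fixes S :: "'s set" and act :: "'g \<Rightarrow> 's \<Rightarrow> 's"
  assumes finite_S: "finite S" and S_nonempty: "S \<noteq> {}"
    and act_closed: "\<lbrakk>g \<in> carrier G; s \<in> S\<rbrakk> \<Longrightarrow> act g s \<in> S"
    and act_one: "s \<in> S \<Longrightarrow> act \<one> s = s"
    and act_mult: "\<lbrakk>g \<in> carrier G; h \<in> carrier G; s \<in> S\<rbrakk> \<Longrightarrow> act (g \<otimes> h) s = act g (act h s)"
    and transitive: "\<lbrakk>s \<in> S; t \<in> S\<rbrakk> \<Longrightarrow> \<exists>g\<in>carrier G. act g s = t"
begin

lemma act_inv_act: "\<lbrakk>g \<in> carrier G; s \<in> S\<rbrakk> \<Longrightarrow> act (inv g) (act g s) = s"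
  by (metis act_mult act_one inv_closed l_inv)

lemma act_act_inv: "\<lbrakk>g \<in> carrier G; s \<in> S\<rbrakk> \<Longrightarrow> act g (act (inv g) s) = s"
  by (metis act_mult act_one inv_closed r_inv)

lemma bij_betw_act: "g \<in> carrier G \<Longrightarrow> bij_betw (act g) S S"
  by (rule bij_betw_byWitness[where f' = "act (inv g)"])
     (auto simp: act_inv_act act_act_inv act_closed)

lemma sum_act_inv: "g \<in> carrier G \<Longrightarrow> (\<Sum>s\<in>S. f (act (inv g) s)) = (\<Sum>s\<in>S. f s)"
  by (rule sum.reindex_bij_betw) (simp add: bij_betw_act)

end

text \<open>The space is needed over two fields and with two carrier types, \<open>real vec\<close>
  and \<open>nat \<Rightarrow> complex\<close>. The maps \<open>enc\<close> and \<open>dec\<close>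
  hide the carrier type, and \<open>norm_ip\<close> ties the norm of the field to
  \<open>conjugate\<close>.\<close>

locale sum_zero_space = transitive_action G S act
  for G :: "('g, 'm) monoid_scheme" (structure) and S :: "'s set" and act +
  fixes enc :: "('s \<Rightarrow> 'k::{conjugatable_ordered_field, real_normed_field, banach}) \<Rightarrow> 'v"
    and dec :: "'v \<Rightarrow> 's \<Rightarrow> 'k"
  assumes dec_enc: "(\<And>s. s \<notin> S \<Longrightarrow> x s = 0) \<Longrightarrow> dec (enc x) = x"
    and norm_ip: "norm (\<Sum>s\<in>S. x s * conjugate (x s)) = (\<Sum>s\<in>S. (norm (x s))\<^sup>2)"
begin

definition sum_zero :: "('s \<Rightarrow> 'k) set" where
  "sum_zero = {x. (\<forall>s. s \<notin> S \<longrightarrow> x s = 0) \<and> sum x S = 0}"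

definition H :: "('k, 'v) inner_space" where
  "H = \<lparr>carrier = enc ` sum_zero, mult = undefined, one = undefined,
        zero = enc (\<lambda>_. 0), add = \<lambda>u v. enc (\<lambda>s. dec u s + dec v s),
        smult = \<lambda>a u. enc (\<lambda>s. a * dec u s),
        ip = \<lambda>u v. \<Sum>s\<in>S. dec u s * conjugate (dec v s)\<rparr>"

definition rep :: "'g \<Rightarrow> 'v \<Rightarrow> 'v" where
  "rep g = (\<lambda>u\<in>carrier H. enc (\<lambda>s. if s \<in> S then dec u (act (inv g) s) else 0))"

lemma H_simps: "carrier H = enc ` sum_zero" "\<zero>\<^bsub>H\<^esub> = enc (\<lambda>_. 0)"
  "u \<oplus>\<^bsub>H\<^esub> v = enc (\<lambda>s. dec u s + dec v s)" "a \<odot>\<^bsub>H\<^esub> u = enc (\<lambda>s. a * dec u s)"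
  "ip H u v = (\<Sum>s\<in>S. dec u s * conjugate (dec v s))"
  by (simp_all add: H_def)

lemma sum_zeroI: "\<lbrakk>\<And>s. s \<notin> S \<Longrightarrow> x s = 0; sum x S = 0\<rbrakk> \<Longrightarrow> x \<in> sum_zero"
  by (auto simp: sum_zero_def)

lemma dec_enc_sum_zero: "x \<in> sum_zero \<Longrightarrow> dec (enc x) = x"
  by (rule dec_enc) (auto simp: sum_zero_def)

lemma enc_closed: "x \<in> sum_zero \<Longrightarrow> enc x \<in> carrier H"
  by (auto simp: H_simps)

lemma dec_closed: "u \<in> carrier H \<Longrightarrow> dec u \<in> sum_zero"
  by (auto simp: H_simps dec_enc_sum_zero)

lemma enc_dec: "u \<in> carrier H \<Longrightarrow> enc (dec u) = u"
  by (auto simp: H_simps dec_enc_sum_zero)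

lemma dec_eqI: "\<lbrakk>u \<in> carrier H; v \<in> carrier H; \<And>s. s \<in> S \<Longrightarrow> dec u s = dec v s\<rbrakk> \<Longrightarrow> u = v"
proof -
  assume uv: "u \<in> carrier H" "v \<in> carrier H" "\<And>s. s \<in> S \<Longrightarrow> dec u s = dec v s"
  then have "dec u = dec v" using dec_closed[of u] dec_closed[of v] by (force simp: sum_zero_def)
  then show "u = v" using enc_dec uv by metis
qed

lemma dec_outside: "\<lbrakk>u \<in> carrier H; s \<notin> S\<rbrakk> \<Longrightarrow> dec u s = 0"
  using dec_closed by (auto simp: sum_zero_def)

lemma sum_dec: "u \<in> carrier H \<Longrightarrow> (\<Sum>s\<in>S. dec u s) = 0"
  using dec_closed by (auto simp: sum_zero_def)

lemma sum_zero_closed: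
  "(\<lambda>_. 0) \<in> sum_zero"
  "\<lbrakk>x \<in> sum_zero; y \<in> sum_zero\<rbrakk> \<Longrightarrow> (\<lambda>s. x s + y s) \<in> sum_zero"
  "x \<in> sum_zero \<Longrightarrow> (\<lambda>s. a * x s) \<in> sum_zero"
  "\<lbrakk>x \<in> sum_zero; g \<in> carrier G\<rbrakk> \<Longrightarrow> (\<lambda>s. if s \<in> S then x (act (inv g) s) else 0) \<in> sum_zero"
  by (auto simp: sum_zero_def sum.distrib sum_distrib_left[symmetric] sum_act_inv)

lemma H_closed:
  "\<zero>\<^bsub>H\<^esub> \<in> carrier H"
  "\<lbrakk>u \<in> carrier H; v \<in> carrier H\<rbrakk> \<Longrightarrow> u \<oplus>\<^bsub>H\<^esub> v \<in> carrier H"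
  "u \<in> carrier H \<Longrightarrow> a \<odot>\<^bsub>H\<^esub> u \<in> carrier H"
  "\<lbrakk>u \<in> carrier H; g \<in> carrier G\<rbrakk> \<Longrightarrow> rep g u \<in> carrier H"
  unfolding H_simps(2-4) rep_def by (auto intro!: enc_closed sum_zero_closed dec_closed)

lemma dec_simps:
  "dec \<zero>\<^bsub>H\<^esub> s = 0"
  "\<lbrakk>u \<in> carrier H; v \<in> carrier H\<rbrakk> \<Longrightarrow> dec (u \<oplus>\<^bsub>H\<^esub> v) s = dec u s + dec v s"
  "u \<in> carrier H \<Longrightarrow> dec (a \<odot>\<^bsub>H\<^esub> u) s = a * dec u s"
  "\<lbrakk>u \<in> carrier H; g \<in> carrier G; s \<in> S\<rbrakk> \<Longrightarrow> dec (rep g u) s = dec u (act (inv g) s)"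
  unfolding H_simps(2-4) rep_def
  by (simp_all add: dec_enc_sum_zero sum_zero_closed dec_closed)

lemma abelian_group_H: "abelian_group H"
proof (rule abelian_groupI)
  fix x assume x: "x \<in> carrier H"
  have "(-1) \<odot>\<^bsub>H\<^esub> x \<oplus>\<^bsub>H\<^esub> x = \<zero>\<^bsub>H\<^esub>"
    by (rule dec_eqI) (auto simp: H_closed dec_simps x)
  then show "\<exists>y\<in>carrier H. y \<oplus>\<^bsub>H\<^esub> x = \<zero>\<^bsub>H\<^esub>"
    using x H_closed by blast
qed (rule dec_eqI | auto simp: H_closed dec_simps algebra_simps)+

sublocale Hgrp: abelian_group H by (rule abelian_group_H)

lemma dec_minus: "u \<in> carrier H \<Longrightarrow> dec (\<ominus>\<^bsub>H\<^esub> u) s = - dec u s"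
  by (metis Hgrp.a_inv_closed Hgrp.l_neg add_eq_0_iff2 dec_simps(1,2))

lemma dec_diff: "\<lbrakk>u \<in> carrier H; v \<in> carrier H\<rbrakk> \<Longrightarrow> dec (u \<ominus>\<^bsub>H\<^esub> v) s = dec u s - dec v s"
  by (simp add: Hgrp.minus_eq dec_simps dec_minus)

lemma dec_finsum:
  assumes "f \<in> A \<rightarrow> carrier H"
  shows "dec (\<Oplus>\<^bsub>H\<^esub>i\<in>A. f i) s = (\<Sum>i\<in>A. dec (f i) s)"
  using assms by (induction A rule: infinite_finite_induct) (auto simp: dec_simps)

lemma dec_add_pow: "u \<in> carrier H \<Longrightarrow> dec (add_pow H (k::int) u) s = of_int k * dec u s"
proof -
  assume u: "u \<in> carrier H"
  have n: "dec (add_pow H n u) s = of_nat n * dec u s" for n :: nat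
    using u by (induction n) (auto simp: dec_simps Hgrp.add.nat_pow_closed algebra_simps)
  show ?thesis
  proof (cases k)
    case (nonneg m)
    then show ?thesis using n[of m] by (simp add: add_pow_def int_pow_int)
  next
    case (neg m)
    have c: "add_pow H (Suc m) u \<in> carrier H" using u by (rule Hgrp.add.nat_pow_closed)
    have "add_pow H k u = \<ominus>\<^bsub>H\<^esub> add_pow H (Suc m) u"
      using u by (simp add: neg Hgrp.add.int_pow_neg_int del: of_nat_Suc)
    then show ?thesis using n[of "Suc m"] c by (simp add: dec_minus neg del: of_nat_Suc Hgrp.add.nat_pow_Suc)
  qed
qed

lemma vectorspace_H: "vectorspace (class_ring :: 'k ring) H"
proof (intro vectorspace.intro module.intro)
  show "module_axioms (class_ring :: 'k ring) H"
    by unfold_locales ((rule dec_eqI)?, auto simp: H_closed dec_simps algebra_simps class_ring_simps)+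
qed (unfold_locales, auto)

sublocale Hvs: vectorspace "class_ring :: 'k ring" H by (rule vectorspace_H)

lemma fin_dim_H: "Hvs.fin_dim"
proof -
  obtain o' where o: "o' \<in> S" using S_nonempty by auto
  \<comment> \<open>The differences between the indicator functions of \<open>s\<close> and of a
    base point \<open>o'\<close> span the sum-zero functions; the coefficient of \<open>b s\<close>
    is the value at \<open>s\<close>.\<close>
  define b where "b s = enc (\<lambda>t. (if t = s then 1 else 0) - (if t = o' then 1 else 0))" for s
  have b: "b s \<in> carrier H" "\<And>t. dec (b s) t = (if t = s then 1 else 0) - (if t = o' then 1 else 0)"
    if "s \<in> S" for s
  proof -
    have "(\<lambda>t. (if t = s then 1 else 0) - (if t = o' then 1 else 0)) \<in> sum_zero"
      using that o finite_S by (intro sum_zeroI) (auto simp: sum_subtractf)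
    then show "b s \<in> carrier H" "\<And>t. dec (b s) t = (if t = s then 1 else 0) - (if t = o' then 1 else 0)"
      by (auto simp: b_def enc_closed dec_enc_sum_zero)
  qed
  have "carrier H \<subseteq> Hvs.span (b ` S)"
  proof
    fix u assume u: "u \<in> carrier H"
    have fin: "finite (b ` (S - {o'}))" and sub: "b ` (S - {o'}) \<subseteq> b ` S" using finite_S by auto
    have inj: "inj_on b (S - {o'})"
    proof (rule inj_onI)
      fix s t assume st: "s \<in> S - {o'}" "t \<in> S - {o'}" and "b s = b t"
      then have "dec (b s) s = dec (b t) s" by simp
      moreover have "dec (b s) s = 1" "dec (b t) s = (if s = t then 1 else 0)"
        using st by (auto simp: b)
      ultimately show "s = t" by (auto split: if_splits)
    qed
    define a where "a v = dec u (the_inv_into (S - {o'}) b v)" for v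
    have a: "a (b s) = dec u s" if "s \<in> S - {o'}" for s
      using that inj by (simp add: a_def the_inv_into_f_f)
    have "Hvs.lincomb a (b ` (S - {o'})) = u"
    proof (rule dec_eqI)
      show "Hvs.lincomb a (b ` (S - {o'})) \<in> carrier H"
        using b by (intro Hvs.lincomb_closed) auto
      show "u \<in> carrier H" by (rule u)
      fix t assume t: "t \<in> S"
      have "dec (Hvs.lincomb a (b ` (S - {o'}))) t = (\<Sum>v\<in>b ` (S - {o'}). a v * dec v t)"
        unfolding Hvs.lincomb_def
        by (subst dec_finsum) (auto simp: b(1) H_closed dec_simps intro!: sum.cong)
      also have "\<dots> = (\<Sum>s\<in>S - {o'}. dec u s * dec (b s) t)"
        by (subst sum.reindex[OF inj]) (simp add: a)
      also have "\<dots> = (\<Sum>s\<in>S. dec u s * dec (b s) t)"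
        using finite_S o by (subst sum.remove[of S o']) (auto simp: b)
      \<comment> \<open>At \<open>t = o'\<close> the result is right because the values of
        \<open>u\<close> sum to 0.\<close>
      also have "\<dots> = (\<Sum>s\<in>S. (if t = s then dec u s else 0)) - (\<Sum>s\<in>S. dec u s) * (if t = o' then 1 else 0)"
        unfolding sum_distrib_right sum_subtractf[symmetric]
        by (rule sum.cong) (auto simp: b(2))
      also have "\<dots> = dec u t" using t u finite_S by (simp add: sum_dec)
      finally show "dec (Hvs.lincomb a (b ` (S - {o'}))) t = dec u t" .
    qed
    then show "u \<in> Hvs.span (b ` S)"
      unfolding Hvs.span_def using fin sub by (auto intro!: exI[of _ a] exI[of _ "b ` (S - {o'})"])
  qed
  moreover have "Hvs.span (b ` S) \<subseteq> carrier H"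
    using b by (intro Hvs.span_is_subset2) auto
  ultimately show ?thesis
    unfolding Hvs.fin_dim_def using finite_S b by (intro exI[of _ "b ` S"]) auto
qed

section \<open>The metric and the Hilbert space axioms\<close>

lemma hdist_H:
  "\<lbrakk>u \<in> carrier H; v \<in> carrier H\<rbrakk> \<Longrightarrow> hdist H u v = L2_set (\<lambda>s. norm (dec u s - dec v s)) S"
  by (simp add: hdist_def L2_set_def H_simps(5) dec_diff norm_ip del: of_real_sum)

lemma Metric_space_H: "Metric_space (carrier H) (hdist H)"
proof
  show "0 \<le> hdist H x y" for x y by (simp add: hdist_def)
  show "hdist H x y = hdist H y x" for x y
    by (cases "x \<in> carrier H \<and> y \<in> carrier H")
       (auto simp: hdist_H norm_minus_commute, auto simp: hdist_def)
  show "hdist H x y = 0 \<longleftrightarrow> x = y" if "x \<in> carrier H" "y \<in> carrier H" for x y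
    using that finite_S by (auto simp: hdist_H L2_set_eq_0_iff intro: dec_eqI)
  show "hdist H x z \<le> hdist H x y + hdist H y z"
    if "x \<in> carrier H" "y \<in> carrier H" "z \<in> carrier H" for x y z
  proof -
    have "L2_set (\<lambda>s. norm (dec x s - dec z s)) S
        \<le> L2_set (\<lambda>s. norm (dec x s - dec y s) + norm (dec y s - dec z s)) S"
      using norm_triangle_ineq[of "dec x s - dec y s" "dec y s - dec z s" for s]
      by (intro L2_set_mono) simp_all
    also have "\<dots> \<le> L2_set (\<lambda>s. norm (dec x s - dec y s)) S + L2_set (\<lambda>s. norm (dec y s - dec z s)) S"
      by (rule L2_set_triangle_ineq)
    finally show ?thesis using that by (simp add: hdist_H)
  qed
qed

sublocale Hms: Metric_space "carrier H" "hdist H" by (rule Metric_space_H)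

lemma norm_dec_diff_le:
  "\<lbrakk>u \<in> carrier H; v \<in> carrier H\<rbrakk> \<Longrightarrow> norm (dec u s - dec v s) \<le> hdist H u v"
proof (cases "s \<in> S")
  case True
  assume "u \<in> carrier H" "v \<in> carrier H"
  then show ?thesis
    using member_le_L2_set[OF finite_S True, of "\<lambda>s. norm (dec u s - dec v s)"] by (simp add: hdist_H)
qed (auto simp: dec_outside)

lemma mcomplete_H: "Hms.mcomplete"
  unfolding Hms.mcomplete_def
proof (intro allI impI)
  fix \<sigma> assume C: "Hms.MCauchy \<sigma>"
  then have \<sigma>: "\<sigma> n \<in> carrier H" for n by (auto simp: Hms.MCauchy_def)
  have "Cauchy (\<lambda>n. dec (\<sigma> n) s)" for s
    unfolding Cauchy_def
  proof (intro allI impI)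
    fix e :: real assume "e > 0"
    from C have "\<forall>e>0. \<exists>N. \<forall>n n'. N \<le> n \<longrightarrow> N \<le> n' \<longrightarrow> hdist H (\<sigma> n) (\<sigma> n') < e"
      unfolding Hms.MCauchy_def by (rule conjunct2)
    from this[THEN spec, THEN mp, OF \<open>e > 0\<close>] obtain N
      where "\<forall>n n'. N \<le> n \<longrightarrow> N \<le> n' \<longrightarrow> hdist H (\<sigma> n) (\<sigma> n') < e" by (rule exE)
    then show "\<exists>M. \<forall>m\<ge>M. \<forall>n\<ge>M. dist (dec (\<sigma> m) s) (dec (\<sigma> n) s) < e"
      unfolding dist_norm using norm_dec_diff_le[OF \<sigma> \<sigma>] order.strict_trans1 by blast
  qed
  then have "\<forall>s. \<exists>l. (\<lambda>n. dec (\<sigma> n) s) \<longlonglongrightarrow> l"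
    by (meson Cauchy_convergent convergent_def)
  then obtain l where l: "\<And>s. (\<lambda>n. dec (\<sigma> n) s) \<longlonglongrightarrow> l s" by metis
  have "l \<in> sum_zero"
  proof (rule sum_zeroI)
    fix s assume "s \<notin> S"
    with l[of s] have "(\<lambda>n. 0) \<longlonglongrightarrow> l s" by (simp add: dec_outside \<sigma>)
    then show "l s = 0" using LIMSEQ_unique tendsto_const by blast
  next
    have "(\<lambda>n. \<Sum>s\<in>S. dec (\<sigma> n) s) \<longlonglongrightarrow> sum l S" by (intro tendsto_sum l)
    then have "(\<lambda>n. 0) \<longlonglongrightarrow> sum l S" by (simp add: sum_dec \<sigma>)
    then show "sum l S = 0" using LIMSEQ_unique tendsto_const by blast
  qed
  then have L: "enc l \<in> carrier H" "dec (enc l) = l" by (auto simp: enc_closed dec_enc_sum_zero)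
  have "(\<lambda>n. L2_set (\<lambda>s. norm (dec (\<sigma> n) s - l s)) S) \<longlonglongrightarrow> L2_set (\<lambda>s. norm (l s - l s)) S"
    unfolding L2_set_def by (intro tendsto_intros l)
  then have "(\<lambda>n. hdist H (\<sigma> n) (enc l)) \<longlonglongrightarrow> 0"
    by (simp add: hdist_H \<sigma> L L2_set_def)
  then have "limitin Hms.mtopology \<sigma> (enc l) sequentially"
    using L \<sigma> by (simp add: Hms.limitin_metric_dist_null)
  then show "\<exists>x. limitin Hms.mtopology \<sigma> x sequentially" by blast
qed

lemma hilbert_space_H: "hilbert_space H"
proof -
  interpret HS: vectorspace "class_ring :: 'k ring" H by (rule vectorspace_H)
  show ?thesis
  proof
    fix x y z a
    assume x: "x \<in> carrier H"
    show "0 \<le> ip H x x"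
      unfolding H_simps(5) by (intro sum_nonneg conjugate_square_positive)
    show "x = \<zero>\<^bsub>H\<^esub>" if "ip H x x = 0"
    proof -
      have "(\<Sum>s\<in>S. (norm (dec x s))\<^sup>2) = 0"
        using that norm_ip[of "dec x"] by (simp add: H_simps(5))
      then show ?thesis
        using finite_S x by (intro dec_eqI) (auto simp: H_closed dec_simps sum_nonneg_eq_0_iff)
    qed
    assume y: "y \<in> carrier H"
    show "ip H (a \<odot>\<^bsub>H\<^esub> x) y = a * ip H x y"
      by (simp add: H_simps(5) dec_simps x sum_distrib_left mult.assoc)
    show "ip H y x = conjugate (ip H x y)"
      by (simp add: H_simps(5) sum_conjugate finite_S conjugate_dist_mul mult.commute)
    assume z: "z \<in> carrier H"
    show "ip H (x \<oplus>\<^bsub>H\<^esub> y) z = ip H x z + ip H y z"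
      by (simp add: H_simps(5) dec_simps x y sum.distrib distrib_right)
  qed (rule mcomplete_H)
qed

section \<open>The permutation representation is unitary without invariant vectors\<close>

lemma rep_one: "u \<in> carrier H \<Longrightarrow> rep \<one> u = u"
  by (rule dec_eqI) (auto simp: H_closed dec_simps act_one)

lemma rep_mult:
  "\<lbrakk>g \<in> carrier G; h \<in> carrier G; u \<in> carrier H\<rbrakk> \<Longrightarrow> rep (g \<otimes> h) u = rep g (rep h u)"
  by (rule dec_eqI) (auto simp: H_closed dec_simps inv_mult_group act_mult act_closed)

lemma rep_add: "\<lbrakk>g \<in> carrier G; u \<in> carrier H; v \<in> carrier H\<rbrakk> \<Longrightarrow> rep g (u \<oplus>\<^bsub>H\<^esub> v) = rep g u \<oplus>\<^bsub>H\<^esub> rep g v"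
  by (rule dec_eqI) (auto simp: H_closed dec_simps act_closed)

lemma rep_smult: "\<lbrakk>g \<in> carrier G; u \<in> carrier H\<rbrakk> \<Longrightarrow> rep g (a \<odot>\<^bsub>H\<^esub> u) = a \<odot>\<^bsub>H\<^esub> rep g u"
  by (rule dec_eqI) (auto simp: H_closed dec_simps act_closed)

lemma rep_ip:
  assumes "g \<in> carrier G" "u \<in> carrier H" "v \<in> carrier H"
  shows "ip H (rep g u) (rep g v) = ip H u v"
  using assms sum_act_inv[of g "\<lambda>s. dec u s * conjugate (dec v s)"]
  by (simp add: H_simps(5) dec_simps cong: sum.cong)

lemma rep_unitary:
  assumes g: "g \<in> carrier G"
  shows "rep g \<in> carrier (unitary_group H)"
proof -
  have "bij_betw (rep g) (carrier H) (carrier H)"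
    by (rule bij_betw_byWitness[where f' = "rep (inv g)"])
       (use g in \<open>auto simp: rep_mult[symmetric] H_closed rep_one\<close>)
  then have "rep g \<in> Bij (carrier H)" by (simp add: Bij_def rep_def)
  then show ?thesis
    using g by (simp add: unitary_group_def rep_add rep_smult rep_ip)
qed

lemma unitary_representation_rep: "unitary_representation G H rep"
proof -
  interpret hilbert_space H by (rule hilbert_space_H)
  show ?thesis
  proof
    show "rep \<in> hom G (unitary_group H)"
    proof (rule homI)
      fix g h assume gh: "g \<in> carrier G" "h \<in> carrier G"
      then have B: "rep g \<in> Bij (carrier H)" "rep h \<in> Bij (carrier H)"
        using rep_unitary[OF gh(1)] rep_unitary[OF gh(2)] by (simp_all add: unitary_group_def)
      have "rep (g \<otimes> h) = compose (carrier H) (rep g) (rep h)"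
      proof (rule extensionalityI[of _ "carrier H"])
        show "rep (g \<otimes> h) \<in> extensional (carrier H)" by (simp add: rep_def)
      qed (auto simp: compose_def rep_mult gh)
      then show "rep (g \<otimes> h) = rep g \<otimes>\<^bsub>unitary_group H\<^esub> rep h"
        using B by (simp add: unitary_group_def BijGroup_def)
    qed (rule rep_unitary)
  qed
qed

text \<open>Transitivity makes an invariant vector constant on \<open>S\<close>, and a constant
  function with sum 0 over a nonempty finite set vanishes.\<close>

lemma invariant_vectors_rep: "invariant_vectors G H rep = {\<zero>\<^bsub>H\<^esub>}"
proof
  show "{\<zero>\<^bsub>H\<^esub>} \<subseteq> invariant_vectors G H rep"
    by (auto simp: invariant_vectors_def H_closed intro!: dec_eqI simp: dec_simps)
  show "invariant_vectors G H rep \<subseteq> {\<zero>\<^bsub>H\<^esub>}"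
  proof
    fix u assume "u \<in> invariant_vectors G H rep"
    then have u: "u \<in> carrier H" and inv: "\<And>g. g \<in> carrier G \<Longrightarrow> rep g u = u"
      by (auto simp: invariant_vectors_def)
    have const: "dec u s = dec u t" if st: "s \<in> S" "t \<in> S" for s t
    proof -
      obtain g where g: "g \<in> carrier G" "act g s = t" using transitive st by blast
      have "dec (rep g u) t = dec u s" using g u st act_inv_act by (auto simp: dec_simps)
      then show ?thesis using inv g by simp
    qed
    obtain o' where o: "o' \<in> S" using S_nonempty by auto
    have "(\<Sum>s\<in>S. dec u s) = (\<Sum>s\<in>S. dec u o')"
      by (intro sum.cong refl const o)
    then have "dec u o' = 0" using sum_dec[OF u] finite_S S_nonempty by auto
    then have "u = \<zero>\<^bsub>H\<^esub>"
      using const[OF _ o] u by (intro dec_eqI) (auto simp: H_closed dec_simps)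
    then show "u \<in> {\<zero>\<^bsub>H\<^esub>}" by simp
  qed
qed

end

section \<open>The bar complex of a permutation module\<close>

text \<open>The terms with \<open>j < i\<close> correspond bijectively to the remaining ones through
  \<open>(i, j) \<mapsto> (j, i - 1)\<close>, which reverses the sign.\<close>

lemma alternating_double_sum:
  fixes A :: "nat \<Rightarrow> nat \<Rightarrow> 'a::comm_ring_1"
  assumes "\<And>i j. \<lbrakk>j < i; i \<le> Suc n\<rbrakk> \<Longrightarrow> A i j = A j (i - 1)"
  shows "(\<Sum>i\<le>Suc n. \<Sum>j\<le>n. (-1) ^ (i + j) * A i j) = 0"
proof -
  let ?f = "\<lambda>(i, j). (-1) ^ (i + j) * A i j"
  let ?L = "{(i, j). j < i \<and> i \<le> Suc n}" and ?U = "{(i, j). i \<le> j \<and> j \<le> n}"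
  have fin: "finite ?L" "finite ?U"
    by (rule finite_subset[of _ "{..Suc n} \<times> {..Suc n}"]; auto)+
  have "(\<Sum>i\<le>Suc n. \<Sum>j\<le>n. (-1) ^ (i + j) * A i j) = sum ?f ({..Suc n} \<times> {..n})"
    by (simp add: sum.cartesian_product)
  also have "{..Suc n} \<times> {..n} = ?L \<union> ?U" by auto
  also have "sum ?f (?L \<union> ?U) = sum ?f ?L + sum ?f ?U"
    by (rule sum.union_disjoint) (use fin in auto)
  also have "sum ?f ?L = sum (\<lambda>p. - ?f p) ?U"
  proof (rule sum.reindex_bij_witness[where j = "\<lambda>(i, j). (j, i - 1)" and i = "\<lambda>(i, j). (Suc j, i)"])
    show "- ?f (case p of (i, j) \<Rightarrow> (j, i - 1)) = ?f p" if pL: "p \<in> ?L" for p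
    proof -
      obtain i' j where p': "p = (i', j)" "j < i'" "i' \<le> Suc n" using pL by auto
      then obtain i where p: "p = (Suc i, j)" "j < Suc i" "i \<le> n" by (cases i') auto
      have "A (Suc i) j = A j i" using assms[of j "Suc i"] p by simp
      then show ?thesis by (simp add: p add.commute)
    qed
  qed auto
  finally show ?thesis by (simp add: sum_negf)
qed

text \<open>The last face of the bar complex, which drops the last entry, is included as the last merge.\<close>

fun merge :: "('g, 'm) monoid_scheme \<Rightarrow> nat \<Rightarrow> 'g list \<Rightarrow> 'g list" where
  "merge G i [] = []"
| "merge G 0 [g] = []"
| "merge G 0 (g # h # gs) = (g \<otimes>\<^bsub>G\<^esub> h) # gs"
| "merge G (Suc i) (g # gs) = g # merge G i gs"

lemma length_merge: "i < length gs \<Longrightarrow> length (merge G i gs) = length gs - 1"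
  by (induction G i gs rule: merge.induct) auto

lemma merge_closed:
  "\<lbrakk>group G; set gs \<subseteq> carrier G\<rbrakk> \<Longrightarrow> set (merge G i gs) \<subseteq> carrier G"
  by (induction G i gs rule: merge.induct) (auto simp: group.is_monoid monoid.m_closed)

lemma merge_last: "length gs = Suc n \<Longrightarrow> merge G n gs = butlast gs"
proof (induction n arbitrary: gs)
  case 0
  then show ?case by (auto simp: length_Suc_conv)
next
  case (Suc n)
  then show ?case by (auto simp: length_Suc_conv)
qed

lemma merge_inner:
  "Suc i < length gs \<Longrightarrow> merge G i gs = take i gs @ (gs ! i \<otimes>\<^bsub>G\<^esub> gs ! (i + 1)) # drop (i + 2) gs"
  by (induction G i gs rule: merge.induct) auto

text \<open>The simplicial identity of the faces. It is formal unless the two merges touch, where it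
  is associativity.\<close>

lemma merge_merge:
  assumes "group G"
  shows "\<lbrakk>j < i; i < length gs; set gs \<subseteq> carrier G\<rbrakk> \<Longrightarrow>
    merge G j (merge G i gs) = merge G (i - 1) (merge G j gs)"
proof (induction j arbitrary: i gs)
  case 0
  then obtain i' g h gs' where i: "i = Suc i'" and gs: "gs = g # h # gs'"
    by (metis gr0_implies_Suc length_Suc_conv less_nat_zero_code neq_Nil_conv list.size(3) not_less_eq)
  interpret group G by fact
  show ?case
  proof (cases i')
    case 0
    then show ?thesis using "0.prems" by (cases gs') (auto simp: i gs m_assoc)
  next
    case (Suc k)
    then show ?thesis by (simp add: i gs)
  qed
next
  case (Suc j)
  then obtain i' g gs' where i: "i = Suc i'" and gs: "gs = g # gs'"
    by (metis gr0_implies_Suc less_nat_zero_code neq_Nil_conv list.size(3) bot_nat_0.not_eq_extremum)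
  then obtain i'' where "i' = Suc i''" using Suc.prems by (cases i') auto
  then show ?case using Suc i gs by simp
qed

context transitive_action
begin

text \<open>The differential at a single point of \<open>S\<close> and for arbitrary functions on
  \<open>S\<close>, so that it also applies to cochains that are not sum-zero valued. As the last
  face is an ordinary merge, its sign follows the pattern of the others.\<close>

definition d :: "('g list \<Rightarrow> 's \<Rightarrow> 'k::comm_ring_1) \<Rightarrow> 'g list \<Rightarrow> 's \<Rightarrow> 'k" where
  "d f gs s = f (tl gs) (act (inv (hd gs)) s) - (\<Sum>i<length gs. (-1) ^ i * f (merge G i gs) s)"

lemma d_d:
  assumes gs: "gs \<in> tuples G (Suc (Suc n))" and s: "s \<in> S"
  shows "d (d f) gs s = 0"
proof -
  obtain g h gs' where gs_eq: "gs = g # h # gs'" and len: "length gs' = n"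
    and c: "g \<in> carrier G" "h \<in> carrier G" "set gs' \<subseteq> carrier G"
    using gs by (auto simp: tuples_def length_Suc_conv)
  have gc: "set gs \<subseteq> carrier G" using gs by (simp add: tuples_def)
  let ?s = "act (inv g) s"
  have A: "(\<Sum>i\<le>Suc n. \<Sum>j\<le>n. (-1) ^ (i + j) * f (merge G j (merge G i gs)) s) = 0"
    by (rule alternating_double_sum) (use gc len in \<open>simp add: merge_merge is_group gs_eq\<close>)
  have hd_merge: "d f (merge G i gs) s =
      f (tl (merge G i gs)) (act (inv (hd (merge G i gs))) s)
      - (\<Sum>j\<le>n. (-1) ^ j * f (merge G j (merge G i gs)) s)" if "i \<le> Suc n" for i
    using that by (simp add: d_def length_merge gs_eq len lessThan_Suc_atMost)
  have first: "(\<Sum>i\<le>Suc n. (-1) ^ i * f (tl (merge G i gs)) (act (inv (hd (merge G i gs))) s)) =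
      f gs' (act (inv h) ?s) - (\<Sum>j\<le>n. (-1) ^ j * f (merge G j (h # gs')) ?s)"
    unfolding sum.atMost_Suc_shift
    using c s by (simp add: gs_eq inv_mult_group act_mult sum_negf)
  have "d (d f) gs s = d f (h # gs') ?s - (\<Sum>i\<le>Suc n. (-1) ^ i * d f (merge G i gs) s)"
    unfolding d_def[of "d f"] by (simp add: gs_eq len lessThan_Suc_atMost del: sum.atMost_Suc)
  also have "(\<Sum>i\<le>Suc n. (-1) ^ i * d f (merge G i gs) s) =
     (\<Sum>i\<le>Suc n. (-1) ^ i * f (tl (merge G i gs)) (act (inv (hd (merge G i gs))) s))
      - (\<Sum>i\<le>Suc n. \<Sum>j\<le>n. (-1) ^ (i + j) * f (merge G j (merge G i gs)) s)"
    unfolding sum_subtractf[symmetric]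
    by (rule sum.cong) (auto simp: hd_merge right_diff_distrib sum_distrib_left power_add mult.assoc simp del: sum.atMost_Suc)
  finally show ?thesis
    unfolding A first by (simp add: d_def len lessThan_Suc_atMost)
qed

lemma tuples_simps:
  "gs \<in> tuples G (Suc n) \<Longrightarrow> hd gs \<in> carrier G"
  "gs \<in> tuples G (Suc n) \<Longrightarrow> tl gs \<in> tuples G n"
  "\<lbrakk>gs \<in> tuples G (Suc n); i \<le> n\<rbrakk> \<Longrightarrow> merge G i gs \<in> tuples G n"
  using merge_closed[OF is_group]
  by (auto simp: tuples_def length_Suc_conv length_merge)

end

section \<open>Cochains with values in the sum-zero representation\<close>

context sum_zero_space
begin

abbreviation "Coch \<equiv> cochain_group G H"
abbreviation "delta \<equiv> coboundary G H rep"
abbreviation "Cocyc \<equiv> cocycles G H rep"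
abbreviation "Cobd \<equiv> coboundaries G H rep"

lemma cochain_carrier: "carrier (Coch n) = (\<Pi>\<^sub>E gs\<in>tuples G n. carrier H)"
  by (simp add: cochain_group_def)

lemma cochain_group: "group (Coch n)"
  by (simp add: cochain_group_def Hgrp.a_group)

lemma cochain_one: "\<one>\<^bsub>Coch n\<^esub> = (\<lambda>gs\<in>tuples G n. \<zero>\<^bsub>H\<^esub>)"
  by (simp add: cochain_group_def)

lemma coboundary_H:
  assumes f: "f \<in> carrier (Coch n)" and gs: "gs \<in> tuples G (Suc n)"
  shows "delta n f gs \<in> carrier H"
    and "s \<in> S \<Longrightarrow> dec (delta n f gs) s = d (\<lambda>gs. dec (f gs)) gs s"
proof -
  have fc: "f ls \<in> carrier H" if "ls \<in> tuples G n" for ls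
    using f that by (auto simp: cochain_carrier)
  have len: "length gs = Suc n" using gs by (simp add: tuples_def)
  let ?m = "\<lambda>i. take i gs @ (gs ! i \<otimes> gs ! (i + 1)) # drop (i + 2) gs"
  have m: "?m i = merge G i gs" if "i < n" for i using that merge_inner[of i gs G] len by simp
  have c: "rep (hd gs) (f (tl gs)) \<in> carrier H" "f (butlast gs) \<in> carrier H"
    "\<And>i. i < n \<Longrightarrow> f (?m i) \<in> carrier H"
    using gs tuples_simps[OF gs] m merge_last[OF len, of G]
    by (metis H_closed(4) fc le_refl less_imp_le)+
  have p: "add_pow H (k::int) u \<in> carrier H" if "u \<in> carrier H" for k u
    using that by (rule Hgrp.add.int_pow_closed)
  have fs: "(\<lambda>i. add_pow H ((-1::int) ^ (i + 1)) (f (?m i))) \<in> {..<n} \<rightarrow> carrier H"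
    using c p by blast
  have eq: "delta n f gs = rep (hd gs) (f (tl gs)) \<oplus>\<^bsub>H\<^esub>
     (\<Oplus>\<^bsub>H\<^esub>i\<in>{..<n}. add_pow H ((-1::int) ^ (i + 1)) (f (?m i))) \<oplus>\<^bsub>H\<^esub>
     add_pow H ((-1::int) ^ (n + 1)) (f (butlast gs))"
    using gs by (simp add: coboundary_def)
  show "delta n f gs \<in> carrier H"
    unfolding eq by (intro H_closed c p Hgrp.finsum_closed fs)
  assume s: "s \<in> S"
  have "dec (delta n f gs) s = dec (rep (hd gs) (f (tl gs))) s
     + (\<Sum>i<n. dec (add_pow H ((-1::int) ^ (i + 1)) (f (?m i))) s)
     + dec (add_pow H ((-1::int) ^ (n + 1)) (f (butlast gs))) s"
    unfolding eq by (subst dec_simps(2) dec_finsum, (intro H_closed c p Hgrp.finsum_closed fs)+)+ simp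
  also have "(\<Sum>i<n. dec (add_pow H ((-1::int) ^ (i + 1)) (f (?m i))) s) =
      - (\<Sum>i<n. (-1) ^ i * dec (f (merge G i gs)) s)"
    unfolding sum_negf[symmetric]
  proof (rule sum.cong)
    fix i assume "i \<in> {..<n}"
    then show "dec (add_pow H ((-1::int) ^ (i + 1)) (f (?m i))) s = - ((-1) ^ i * dec (f (merge G i gs)) s)"
      by (subst dec_add_pow[OF c(3)]) (auto simp flip: m)
  qed simp
  also have "dec (rep (hd gs) (f (tl gs))) s = dec (f (tl gs)) (act (inv (hd gs)) s)"
    using s tuples_simps[OF gs] fc by (simp add: dec_simps)
  finally show "dec (delta n f gs) s = d (\<lambda>gs. dec (f gs)) gs s"
    using merge_last[OF len, of G] by (simp add: d_def len dec_add_pow c)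
qed

lemma coboundary_closed:
  "f \<in> carrier (Coch n) \<Longrightarrow> delta n f \<in> carrier (Coch (Suc n))"
  unfolding cochain_carrier[of "Suc n"]
  by (rule PiE_I) (simp_all add: coboundary_H(1), simp add: coboundary_def)

lemma cochain_eqI:
  assumes "f \<in> carrier (Coch n)" "g \<in> carrier (Coch n)"
    and "\<And>gs s. \<lbrakk>gs \<in> tuples G n; s \<in> S\<rbrakk> \<Longrightarrow> dec (f gs) s = dec (g gs) s"
  shows "f = g"
  using assms unfolding cochain_carrier by (intro PiE_ext[of f _ _ g] dec_eqI) (auto dest: PiE_mem)

lemma cochain_one_closed: "\<one>\<^bsub>Coch n\<^esub> \<in> carrier (Coch n)"
  by (auto simp: cochain_one cochain_carrier H_closed)

lemma cocycles_iff:
  "z \<in> Cocyc n \<longleftrightarrow> z \<in> carrier (Coch n) \<and>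
     (\<forall>gs\<in>tuples G (Suc n). \<forall>s\<in>S. d (\<lambda>gs. dec (z gs)) gs s = 0)"
  (is "_ \<longleftrightarrow> _ \<and> ?D")
proof -
  have "delta n z = \<one>\<^bsub>Coch (Suc n)\<^esub> \<longleftrightarrow> ?D"
    if z: "z \<in> carrier (Coch n)"
  proof
    assume e: "delta n z = \<one>\<^bsub>Coch (Suc n)\<^esub>"
    show ?D
    proof (intro ballI)
      fix gs s assume "gs \<in> tuples G (Suc n)" "s \<in> S"
      then show "d (\<lambda>gs. dec (z gs)) gs s = 0"
        using coboundary_H(2)[OF z] by (simp flip: coboundary_H(2)[OF z] add: e cochain_one dec_simps)
    qed
  next
    assume ?D
    then show "delta n z = \<one>\<^bsub>Coch (Suc n)\<^esub>"
      by (intro cochain_eqI[of _ "Suc n"] coboundary_closed z cochain_one_closed)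
         (simp add: coboundary_H(2)[OF z] cochain_one dec_simps)
  qed
  then show ?thesis by (auto simp: cocycles_def kernel_def)
qed

lemma d_cong:
  assumes "gs \<in> tuples G (Suc n)" "s \<in> S" "\<And>ls t. \<lbrakk>ls \<in> tuples G n; t \<in> S\<rbrakk> \<Longrightarrow> f ls t = f' ls t"
  shows "d f gs s = d f' gs s"
  using tuples_simps[OF assms(1)] assms
  by (auto simp: d_def tuples_def act_closed intro!: arg_cong2[where f = "(-)"] sum.cong)

lemma one_mem_coboundaries: "\<one>\<^bsub>Coch n\<^esub> \<in> Cobd n"
proof (cases n)
  case (Suc m)
  have "delta m \<one>\<^bsub>Coch m\<^esub> = \<one>\<^bsub>Coch (Suc m)\<^esub>"
  proof (intro cochain_eqI[of _ "Suc m"] coboundary_closed cochain_one_closed)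
    fix gs s assume gs: "gs \<in> tuples G (Suc m)" and s: "s \<in> S"
    have "d (\<lambda>gs. dec (\<one>\<^bsub>Coch m\<^esub> gs)) gs s = d (\<lambda>gs s. 0) gs s"
      by (rule d_cong[OF gs s]) (simp add: cochain_one dec_simps)
    then show "dec (delta m \<one>\<^bsub>Coch m\<^esub> gs) s
        = dec (\<one>\<^bsub>Coch (Suc m)\<^esub> gs) s"
      unfolding coboundary_H(2)[OF cochain_one_closed gs s] cochain_one[of "Suc m"] using gs
      by (simp add: dec_simps) (simp add: d_def)
  qed
  then show ?thesis using Suc cochain_one_closed[of m] by (auto intro: rev_image_eqI)
qed simp

lemma coboundaries_subset_cocycles: "Cobd n \<subseteq> Cocyc n"
proof (cases n)
  case 0
  have "d (\<lambda>gs. dec (\<one>\<^bsub>Coch 0\<^esub> gs)) gs s = 0" if "gs \<in> tuples G (Suc 0)" "s \<in> S" for gs s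
  proof -
    have "d (\<lambda>gs. dec (\<one>\<^bsub>Coch 0\<^esub> gs)) gs s = d (\<lambda>gs s. 0) gs s"
      by (rule d_cong[OF that]) (simp add: cochain_one dec_simps)
    then show ?thesis by (simp add: d_def)
  qed
  then show ?thesis using cochain_one_closed 0 by (auto simp: cocycles_iff simp del: One_nat_def)
next
  case (Suc m)
  show ?thesis
  proof
    fix z assume "z \<in> Cobd n"
    then obtain f where f: "f \<in> carrier (Coch m)" and z: "z = delta m f"
      using Suc by auto
    have "d (\<lambda>gs. dec (z gs)) gs s = 0" if gs: "gs \<in> tuples G (Suc n)" and s: "s \<in> S" for gs s
    proof -
      have "d (\<lambda>gs. dec (z gs)) gs s = d (d (\<lambda>gs. dec (f gs))) gs s"
        by (rule d_cong[OF gs s]) (simp add: z coboundary_H(2)[OF f] Suc)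
      also have "\<dots> = 0" using d_d gs s Suc by blast
      finally show ?thesis .
    qed
    then show "z \<in> Cocyc n"
      using coboundary_closed[OF f] by (auto simp: cocycles_iff z Suc)
  qed
qed

end

section \<open>Coboundaries are closed\<close>

lemma sum_fun_app: "(\<Sum>i\<in>I. f i) x = (\<Sum>i\<in>I. f i x)"
  for f :: "'i \<Rightarrow> 'x \<Rightarrow> 'k::comm_monoid_add"
  by (induction I rule: infinite_finite_induct) auto

text \<open>The values \<open>b\<close> are prescribed on a maximal independent subset of the
  functions \<open>\<phi> j\<close> and extended linearly; consistency forces the extension to agree
  with \<open>b\<close> at the remaining indices.\<close>

lemma consistent_linear_functional:
  fixes \<phi> :: "'j \<Rightarrow> 'x \<Rightarrow> 'k::field" and b :: "'j \<Rightarrow> 'k"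
  assumes consistent: "\<And>F c. \<lbrakk>finite F; F \<subseteq> J; \<And>x. (\<Sum>j\<in>F. c j * \<phi> j x) = 0\<rbrakk> \<Longrightarrow> (\<Sum>j\<in>F. c j * b j) = 0"
  obtains L :: "('x \<Rightarrow> 'k) \<Rightarrow> 'k"
  where "\<And>I a f. finite (I::nat set) \<Longrightarrow> L (\<lambda>x. \<Sum>i\<in>I. a i * f i x) = (\<Sum>i\<in>I. a i * L (f i))"
    and "\<And>j. j \<in> J \<Longrightarrow> L (\<phi> j) = b j"
proof -
  interpret V: vector_space "\<lambda>(a::'k) (f::'x \<Rightarrow> 'k) x. a * f x"
    by unfold_locales (auto simp: fun_eq_iff algebra_simps)
  interpret W: vector_space "(*) :: 'k \<Rightarrow> 'k \<Rightarrow> 'k"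
    by unfold_locales (auto simp: algebra_simps)
  interpret VW: vector_space_pair "\<lambda>(a::'k) (f::'x \<Rightarrow> 'k) x. a * f x" "(*) :: 'k \<Rightarrow> 'k \<Rightarrow> 'k" ..
  obtain B where B: "B \<subseteq> \<phi> ` J" "V.independent B" "\<phi> ` J \<subseteq> V.span B"
    using V.maximal_independent_subset by blast
  define k where "k v = (SOME j. j \<in> J \<and> \<phi> j = v)" for v
  have k: "k v \<in> J" "\<phi> (k v) = v" if "v \<in> B" for v
    using someI_ex[of "\<lambda>j. j \<in> J \<and> \<phi> j = v"] B(1) that by (auto simp: k_def)
  define L where "L = VW.construct B (\<lambda>v. b (k v))"
  have lin: "Vector_Spaces.linear (\<lambda>(a::'k) (f::'x \<Rightarrow> 'k) x. a * f x) (*) L"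
    unfolding L_def by (rule VW.linear_construct[OF B(2)])
  then interpret L: Vector_Spaces.linear "\<lambda>(a::'k) (f::'x \<Rightarrow> 'k) x. a * f x" "(*)" L .
  have LB: "L v = b (k v)" if "v \<in> B" for v
    using VW.construct_basis[OF B(2) that] by (simp add: L_def)
  show thesis
  proof (rule that)
    fix I :: "nat set" and a :: "nat \<Rightarrow> 'k" and f :: "nat \<Rightarrow> 'x \<Rightarrow> 'k"
    assume "finite I"
    have "(\<lambda>x. \<Sum>i\<in>I. a i * f i x) = (\<Sum>i\<in>I. (\<lambda>x. a i * f i x))"
      by (rule ext) (simp only: sum_fun_app)
    then show "L (\<lambda>x. \<Sum>i\<in>I. a i * f i x) = (\<Sum>i\<in>I. a i * L (f i))"
      by (simp add: L.sum L.scale)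
  next
    fix j assume j: "j \<in> J"
    then have "\<phi> j \<in> V.span B" using B(3) by auto
    then obtain t r where t: "finite t" "t \<subseteq> B" and sum: "\<phi> j = (\<Sum>v\<in>t. (\<lambda>x. r v * v x))"
      unfolding V.span_explicit by blast
    have inj: "inj_on k t" using k t(2) by (metis inj_onI subsetD)
    \<comment> \<open>The relation that expresses \<open>\<phi> j\<close> by the basis. Its two
      parts are kept as separate summands because \<open>j\<close> may itself be one of the chosen
      indices \<open>k v\<close>.\<close>
    define c where "c i = (if i = j then 1 else 0) - (if i \<in> k ` t then r (\<phi> i) else 0)" for i
    have c_sum: "(\<Sum>i\<in>insert j (k ` t). c i * h i) = h j - (\<Sum>v\<in>t. r v * h (k v))" for h
    proof -
      have fin: "finite (insert j (k ` t))" using t by simp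
      have "(\<Sum>i\<in>insert j (k ` t). c i * h i) =
        (\<Sum>i\<in>insert j (k ` t). if i = j then h i else 0) - (\<Sum>i\<in>insert j (k ` t). if i \<in> k ` t then r (\<phi> i) * h i else 0)"
        unfolding sum_subtractf[symmetric] by (rule sum.cong) (auto simp: c_def algebra_simps)
      also have "(\<Sum>i\<in>insert j (k ` t). if i = j then h i else 0) = h j"
        using fin by (subst sum.delta) auto
      also have "(\<Sum>i\<in>insert j (k ` t). if i \<in> k ` t then r (\<phi> i) * h i else 0) = (\<Sum>i\<in>k ` t. r (\<phi> i) * h i)"
        using fin by (subst sum.inter_restrict[symmetric]) (auto intro!: sum.cong)
      also have "\<dots> = (\<Sum>v\<in>t. r v * h (k v))"
        using t k by (subst sum.reindex[OF inj]) (auto intro!: sum.cong)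
      finally show ?thesis .
    qed
    have "(\<Sum>i\<in>insert j (k ` t). c i * b i) = 0"
    proof (rule consistent)
      show "insert j (k ` t) \<subseteq> J" using j k t by auto
      show "(\<Sum>i\<in>insert j (k ` t). c i * \<phi> i x) = 0" for x
        using k t(2) unfolding c_sum[of "\<lambda>i. \<phi> i x"] sum by (auto simp: sum_fun_app intro!: sum.cong)
    qed (use t in simp)
    then have "b j = (\<Sum>v\<in>t. r v * b (k v))" by (simp add: c_sum)
    also have "\<dots> = (\<Sum>v\<in>t. r v * L v)" using LB t by (intro sum.cong) auto
    also have "\<dots> = L (\<phi> j)" unfolding sum by (simp add: L.sum L.scale)
    finally show "L (\<phi> j) = b j" ..
  qed
qed

text \<open>Each left-hand side is regarded as a function of the whole vector \<open>x\<close>. A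
  functional \<open>L\<close> with prescribed values on these functions yields a solution: unknown
  \<open>i\<close> is the value of \<open>L\<close> on the evaluation at \<open>i\<close>, and
  \<open>L\<close> passes through each left-hand side because that is a finite sum.\<close>

lemma linear_system_solvable:
  fixes a :: "'j \<Rightarrow> nat \<Rightarrow> 'k::field" and e :: "'j \<Rightarrow> nat \<Rightarrow> 'i" and T :: "'j \<Rightarrow> nat set"
  assumes fin: "\<And>j. j \<in> J \<Longrightarrow> finite (T j)"
    and consistent: "\<And>F c. \<lbrakk>finite F; F \<subseteq> J; \<And>x. (\<Sum>j\<in>F. c j * (\<Sum>m\<in>T j. a j m * x (e j m))) = 0\<rbrakk>
       \<Longrightarrow> (\<Sum>j\<in>F. c j * b j) = 0"
  shows "\<exists>x. \<forall>j\<in>J. (\<Sum>m\<in>T j. a j m * x (e j m)) = b j"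
proof -
  define \<phi> where "\<phi> j x = (\<Sum>m\<in>T j. a j m * x (e j m))" for j and x :: "'i \<Rightarrow> 'k"
  have "(\<Sum>j\<in>F. c j * b j) = 0"
    if "finite F" "F \<subseteq> J" "\<And>x. (\<Sum>j\<in>F. c j * \<phi> j x) = 0" for F c
    using consistent[OF that(1,2)] that(3) unfolding \<phi>_def by blast
  then obtain L where L: "\<And>I a f. finite (I::nat set) \<Longrightarrow> L (\<lambda>x. \<Sum>i\<in>I. a i * f i x) = (\<Sum>i\<in>I. a i * L (f i))"
    and Lb: "\<And>j. j \<in> J \<Longrightarrow> L (\<phi> j) = b j"
    using consistent_linear_functional[of J \<phi> b] by blast
  have "(\<Sum>m\<in>T j. a j m * L (\<lambda>x. x (e j m))) = b j" if "j \<in> J" for j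
    using L[OF fin[OF that], of "a j" "\<lambda>m x. x (e j m)"] Lb[OF that] by (simp add: \<phi>_def[abs_def])
  then show ?thesis by (intro exI[of _ "\<lambda>i. L (\<lambda>x. x i)"]) blast
qed

context sum_zero_space
begin

lemma continuous_map_dec: "continuous_map (htopology H) euclidean (\<lambda>u. dec u s)"
  unfolding continuous_map_def htopology_def
proof (intro conjI allI impI)
  fix U :: "'k set" assume "openin euclidean U"
  then have U: "open U" by simp
  show "openin Hms.mtopology {u \<in> topspace Hms.mtopology. dec u s \<in> U}"
    unfolding Hms.openin_mtopology
  proof (intro conjI allI impI)
    fix u assume u: "u \<in> {u \<in> topspace Hms.mtopology. dec u s \<in> U}"
    then obtain r where r: "r > 0" "ball (dec u s) r \<subseteq> U"
      using U unfolding open_contains_ball by blast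
    have "Hms.mball u r \<subseteq> {u \<in> topspace Hms.mtopology. dec u s \<in> U}"
    proof
      fix v assume v: "v \<in> Hms.mball u r"
      then have "norm (dec u s - dec v s) < r"
        using norm_dec_diff_le[of u v s] by (auto simp: Hms.in_mball)
      then show "v \<in> {u \<in> topspace Hms.mtopology. dec u s \<in> U}"
        using r v by (auto simp: Hms.in_mball subset_iff dist_norm)
    qed
    then show "\<exists>r>0. Hms.mball u r \<subseteq> {u \<in> topspace Hms.mtopology. dec u s \<in> U}" using r by blast
  qed auto
qed auto

definition cochain_topology :: "nat \<Rightarrow> ('g list \<Rightarrow> 'v) topology" where
  "cochain_topology n = product_topology (\<lambda>_. htopology H) (tuples G n)"

definition pairing :: "('g list \<times> 's) set \<Rightarrow> ('g list \<times> 's \<Rightarrow> 'k) \<Rightarrow> ('g list \<Rightarrow> 'v) \<Rightarrow> 'k" where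
  "pairing F c z = (\<Sum>(gs, s)\<in>F. c (gs, s) * dec (z gs) s)"

lemma continuous_map_functional:
  assumes "finite F" "F \<subseteq> tuples G n \<times> S"
  shows "continuous_map (cochain_topology n) euclidean (pairing F c)"
  unfolding pairing_def[abs_def]
proof (intro continuous_map_sum assms(1))
  fix p assume "p \<in> F"
  then obtain gs s where p: "p = (gs, s)" "gs \<in> tuples G n" using assms(2) by auto
  have "continuous_map (cochain_topology n) euclidean (\<lambda>z. dec (z gs) s)"
    unfolding cochain_topology_def
    by (rule continuous_map_compose[OF continuous_map_product_projection[OF p(2)] continuous_map_dec, unfolded o_def])
  moreover have "continuous_map euclidean euclidean ((*) (c p))"
    by (simp add: continuous_map_iff_continuous2 continuous_on_mult_left)
  ultimately show "continuous_map (cochain_topology n) euclidean (\<lambda>z. case p of (gs, s) \<Rightarrow> c (gs, s) * dec (z gs) s)"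
    using continuous_map_compose[of "cochain_topology n" euclidean "\<lambda>z. dec (z gs) s" euclidean "(*) (c p)"]
    by (simp add: p o_def)
qed

text \<open>A linear system whose equations involve finitely many unknowns each is solvable as soon as
  every linear relation between its left-hand sides also holds between its right-hand sides.
  Hence a cochain that is not a coboundary is separated from the coboundaries by a functional that
  depends on finitely many values.\<close>

lemma separating_functional:
  assumes z: "z \<in> carrier (Coch (Suc n))" and "z \<notin> Cobd (Suc n)"
  obtains F c where "finite F" "F \<subseteq> tuples G (Suc n) \<times> S"
    and "pairing F c z \<noteq> 0"
    and "\<And>f. f \<in> Cobd (Suc n) \<Longrightarrow> pairing F c f = 0"
proof (rule ccontr)
  note separated = that
  assume no: "\<not> thesis"
  \<comment> \<open>The unknowns are the values of an \<open>n\<close>-cochain on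
    \<open>tuples G n \<times> S\<close>. The \<open>Inl\<close> rows say that its coboundary is
    \<open>z\<close>, the \<open>Inr\<close> rows that its values are sum-zero.\<close>
  define J where "J = Inl ` (tuples G (Suc n) \<times> S) \<union> Inr ` (tuples G n)"
  obtain en :: "nat \<Rightarrow> 's" where en: "bij_betw en {..<card S} S"
    using ex_bij_betw_nat_finite[OF finite_S] by (auto simp: atLeast0LessThan)
  define T :: "('g list \<times> 's) + 'g list \<Rightarrow> nat set" where
    "T j = (case j of Inl _ \<Rightarrow> {..Suc n} | Inr _ \<Rightarrow> {..<card S})" for j
  define a :: "('g list \<times> 's) + 'g list \<Rightarrow> nat \<Rightarrow> 'k" where
    "a j m = (case j of Inl _ \<Rightarrow> (-1) ^ m | Inr _ \<Rightarrow> 1)" for j m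
  define e :: "('g list \<times> 's) + 'g list \<Rightarrow> nat \<Rightarrow> 'g list \<times> 's" where
    "e j m = (case j of Inl (gs, s) \<Rightarrow>
      (case m of 0 \<Rightarrow> (tl gs, act (inv (hd gs)) s) | Suc i \<Rightarrow> (merge G i gs, s))
    | Inr gs \<Rightarrow> (gs, en m))" for j m
  define b :: "('g list \<times> 's) + 'g list \<Rightarrow> 'k" where "b j = (case j of Inl (gs, s) \<Rightarrow> dec (z gs) s | Inr _ \<Rightarrow> 0)" for j
  have rowl: "(\<Sum>m\<in>T (Inl (gs, s)). a (Inl (gs, s)) m * x (e (Inl (gs, s)) m)) = d (curry x) gs s"
    if "gs \<in> tuples G (Suc n)" for gs s x
    using that unfolding T_def sum.case sum.atMost_Suc_shift
    by (simp add: a_def e_def d_def tuples_def lessThan_Suc_atMost sum_negf)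
  have rowr: "(\<Sum>m\<in>T (Inr gs). a (Inr gs) m * x (e (Inr gs) m)) = (\<Sum>s\<in>S. x (gs, s))" for gs x
    using sum.reindex_bij_betw[OF en, of "\<lambda>s. x (gs, s)"] by (simp add: T_def a_def e_def)
  have "\<exists>x. \<forall>j\<in>J. (\<Sum>m\<in>T j. a j m * x (e j m)) = b j"
  proof (rule linear_system_solvable)
    show "finite (T j)" for j by (simp add: T_def split: sum.split)
    fix F c assume F: "finite F" "F \<subseteq> J"
      and rel: "\<And>x. (\<Sum>j\<in>F. c j * (\<Sum>m\<in>T j. a j m * x (e j m))) = 0"
    define F' where "F' = {p. Inl p \<in> F}"
    have F': "finite F'" "F' \<subseteq> tuples G (Suc n) \<times> S"
      using finite_vimageI[OF F(1), of Inl] F(2) by (auto simp: F'_def J_def vimage_def)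
    have split: "(\<Sum>j\<in>F. h j) = (\<Sum>p\<in>F'. h (Inl p))" if "\<And>r. Inr r \<in> F \<Longrightarrow> h (Inr r) = 0" for h :: "_ \<Rightarrow> 'k"
    proof -
      have "(\<Sum>j\<in>F. h j) = (\<Sum>j\<in>Inl ` F'. h j)"
      proof (rule sum.mono_neutral_right[OF F(1)])
        show "\<forall>i\<in>F - Inl ` F'. h i = 0"
        proof
          fix i assume "i \<in> F - Inl ` F'"
          then show "h i = 0" using that by (cases i) (auto simp: F'_def)
        qed
      qed (auto simp: F'_def)
      then show ?thesis by (simp add: sum.reindex)
    qed
    have fb: "(\<Sum>j\<in>F. c j * b j) = pairing F' (\<lambda>p. c (Inl p)) z"
      by (subst split) (auto simp: b_def pairing_def intro!: sum.cong)
    show "(\<Sum>j\<in>F. c j * b j) = 0"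
    proof (rule ccontr)
      assume "(\<Sum>j\<in>F. c j * b j) \<noteq> 0"
      then have "pairing F' (\<lambda>p. c (Inl p)) z \<noteq> 0" unfolding fb .
      then have "\<not> (\<forall>f\<in>Cobd (Suc n). pairing F' (\<lambda>p. c (Inl p)) f = 0)"
        using no separated[OF F', of "\<lambda>p. c (Inl p)"] by blast
      then obtain f where f: "f \<in> Cobd (Suc n)"
        and ne: "pairing F' (\<lambda>p. c (Inl p)) f \<noteq> 0"
        by blast
      obtain u where u: "u \<in> carrier (Coch n)" and fu: "f = delta n u"
        using f by auto
      \<comment> \<open>The relation is evaluated at an actual cochain \<open>u\<close>: the
        sum-zero rows vanish there, and the other rows are values of its coboundary.\<close>
      have "0 = (\<Sum>j\<in>F. c j * (\<Sum>m\<in>T j. a j m * (\<lambda>(gs, s). dec (u gs) s) (e j m)))"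
        by (rule rel[symmetric])
      also have "\<dots> = (\<Sum>p\<in>F'. c (Inl p) * (\<Sum>m\<in>T (Inl p). a (Inl p) m * (\<lambda>(gs, s). dec (u gs) s) (e (Inl p) m)))"
      proof (rule split)
        fix gs assume "Inr gs \<in> F"
        then have "gs \<in> tuples G n" using F(2) by (auto simp: J_def)
        then have "u gs \<in> carrier H" using u by (auto simp: cochain_carrier)
        then show "c (Inr gs) * (\<Sum>m\<in>T (Inr gs). a (Inr gs) m * (\<lambda>(gs, s). dec (u gs) s) (e (Inr gs) m)) = 0"
          by (simp add: rowr sum_dec)
      qed
      also have "\<dots> = pairing F' (\<lambda>p. c (Inl p)) f"
        unfolding pairing_def
      proof (rule sum.cong)
        fix p assume p: "p \<in> F'"
        obtain gs s where [simp]: "p = (gs, s)" by (cases p)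
        have "gs \<in> tuples G (Suc n)" "s \<in> S" using F' p by auto
        then show "c (Inl p) * (\<Sum>m\<in>T (Inl p). a (Inl p) m * (\<lambda>(gs, s). dec (u gs) s) (e (Inl p) m))
           = (case p of (gs, s) \<Rightarrow> c (Inl (gs, s)) * dec (f gs) s)"
          using coboundary_H(2)[OF u] by (simp add: rowl fu curry_def)
      qed simp
      finally show False using ne by simp
    qed
  qed
  then obtain x where x: "\<And>j. j \<in> J \<Longrightarrow> (\<Sum>m\<in>T j. a j m * x (e j m)) = b j" by blast
  have xl: "d (curry x) gs s = dec (z gs) s" if "gs \<in> tuples G (Suc n)" "s \<in> S" for gs s
    using x[of "Inl (gs, s)"] that by (simp add: rowl J_def b_def)
  have xr: "(\<Sum>s\<in>S. x (gs, s)) = 0" if "gs \<in> tuples G n" for gs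
    using x[of "Inr gs"] that by (simp add: rowr J_def b_def)
  define u where "u = (\<lambda>gs\<in>tuples G n. enc (\<lambda>s. if s \<in> S then x (gs, s) else 0))"
  have sz: "(\<lambda>s. if s \<in> S then x (gs, s) else 0) \<in> sum_zero" if "gs \<in> tuples G n" for gs
    using xr[OF that] by (auto simp: sum_zero_def)
  have u: "u \<in> carrier (Coch n)"
    using enc_closed[OF sz] by (auto simp: u_def cochain_carrier)
  have "delta n u = z"
  proof (rule cochain_eqI[OF coboundary_closed[OF u] z])
    fix gs s assume gs: "gs \<in> tuples G (Suc n)" and s: "s \<in> S"
    have "d (\<lambda>gs. dec (u gs)) gs s = d (curry x) gs s"
      by (rule d_cong[OF gs s]) (simp add: u_def dec_enc_sum_zero[OF sz])
    then show "dec (delta n u gs) s = dec (z gs) s"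
      using coboundary_H(2)[OF u gs s] xl[OF gs s] by simp
  qed
  then show False using u assms(2) by auto
qed

text \<open>Around a cocycle that is not a coboundary, the set where a separating functional is
  nonzero is open and free of coboundaries. In degree 0 the only coboundary is the zero cochain, a
  closed point.\<close>

lemma closure_of_coboundaries:
  "subtopology (cochain_topology n) (Cocyc n) closure_of Cobd n
     = Cobd n"
proof (cases n)
  case 0
  have "Hausdorff_space (cochain_topology n)"
    unfolding cochain_topology_def Hausdorff_space_product_topology
    by (simp add: htopology_def Hms.Hausdorff_space_mtopology)
  then have "Hausdorff_space (subtopology (cochain_topology n) (Cocyc n))"
    by (rule Hausdorff_space_subtopology)
  moreover have "\<one>\<^bsub>Coch 0\<^esub> \<in> topspace (subtopology (cochain_topology n) (Cocyc n))"
    using coboundaries_subset_cocycles[of 0] cochain_one_closed[of 0] 0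
    by (auto simp: cochain_topology_def htopology_def cochain_carrier)
  ultimately show ?thesis
    using 0 by (auto intro!: closure_of_closedin closedin_Hausdorff_singleton)
next
  case (Suc m)
  let ?X = "subtopology (cochain_topology n) (Cocyc n)"
  have top: "topspace (cochain_topology n) = carrier (Coch n)"
    by (simp add: cochain_topology_def htopology_def cochain_carrier)
  show ?thesis
  proof (rule antisym)
    show "Cobd n \<subseteq> ?X closure_of Cobd n"
      using coboundaries_subset_cocycles[of n] by (intro closure_of_subset) (auto simp: top cocycles_iff)
    show "?X closure_of Cobd n \<subseteq> Cobd n"
    proof
      fix z assume z: "z \<in> ?X closure_of Cobd n"
      then have zc: "z \<in> carrier (Coch (Suc m))"
        using closure_of_subset_topspace[of ?X] top Suc by auto
      show "z \<in> Cobd n"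
      proof (rule ccontr)
        assume "z \<notin> Cobd n"
        then have "z \<notin> Cobd (Suc m)" unfolding Suc .
        with zc obtain F c where F: "finite F" "F \<subseteq> tuples G (Suc m) \<times> S"
          and ne: "pairing F c z \<noteq> 0"
          and eq: "\<And>f. f \<in> Cobd (Suc m) \<Longrightarrow> pairing F c f = 0"
          using separating_functional[of z m] by blast
        let ?l = "pairing F c"
        have "continuous_map ?X euclidean ?l"
          using F unfolding Suc by (intro continuous_map_from_subtopology continuous_map_functional)
        then have "openin ?X {z \<in> topspace ?X. ?l z \<in> - {0}}"
          by (rule openin_continuous_map_preimage) auto
        then obtain U where U: "openin ?X U" "U = {z \<in> topspace ?X. ?l z \<in> - {0}}" by blast
        have "z \<in> topspace ?X" using z closure_of_subset_topspace[of ?X] by (rule rev_subsetD)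
        then have zU: "z \<in> U" using ne by (simp add: U(2))
        have "\<forall>U. z \<in> U \<and> openin ?X U \<longrightarrow> (\<exists>f. f \<in> Cobd n \<and> f \<in> U)"
          using z unfolding in_closure_of by (rule conjunct2)
        from this[THEN spec, THEN mp, OF conjI, OF zU U(1)]
        obtain f where f: "f \<in> Cobd n" "f \<in> U" by (elim exE conjE)
        from f(2) have "?l f \<noteq> 0" unfolding U(2) by simp
        moreover from f(1) have "f \<in> Cobd (Suc m)" unfolding Suc .
        ultimately show False using eq[of f] by blast
      qed
    qed
  qed
qed

theorem reduced_cohomology_eq: "reduced_cohomology G H rep n = cohomology G H rep n"
  using closure_of_coboundaries by (simp add: reduced_cohomology_def cohomology_def cochain_topology_def)

lemma cohomology_nontrivial:
  assumes z: "z \<in> Cocyc n" "z \<notin> Cobd n"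
  shows "carrier (cohomology G H rep n) \<noteq> {\<one>\<^bsub>cohomology G H rep n\<^esub>}"
proof
  assume e: "carrier (cohomology G H rep n) = {\<one>\<^bsub>cohomology G H rep n\<^esub>}"
  let ?C = "(Coch n)\<lparr>carrier := Cocyc n\<rparr>"
  interpret C: group "Coch n" by (rule cochain_group)
  have "Cobd n #>\<^bsub>?C\<^esub> z \<in> carrier (cohomology G H rep n)"
    using z by (auto simp: cohomology_def FactGroup_def RCOSETS_def)
  then have "Cobd n #>\<^bsub>?C\<^esub> z = Cobd n"
    unfolding e by (simp add: cohomology_def FactGroup_def)
  moreover have "z \<in> Cobd n #>\<^bsub>?C\<^esub> z"
    using one_mem_coboundaries[of n] z(1) unfolding r_coset_def cocycles_iff
    by (auto intro!: bexI[of _ "\<one>\<^bsub>Coch n\<^esub>"] simp del: C.one_closed)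
  ultimately show False using z(2) by simp
qed

text \<open>Subtracting its mean over \<open>S\<close> makes a cocycle sum-zero valued and changes no difference of
  values at two points of \<open>S\<close>.\<close>

lemma nontrivial_cocycle:
  fixes c :: "'g list \<Rightarrow> 's \<Rightarrow> real"
  assumes cocycle: "\<And>gs s. \<lbrakk>gs \<in> tuples G (Suc (Suc n)); s \<in> S\<rbrakk> \<Longrightarrow> d c gs s = 0"
    and T: "finite T" "\<And>m. m \<in> T \<Longrightarrow> e m \<in> tuples G (Suc n)"
    and s: "s0 \<in> S" "s1 \<in> S"
    and ne: "(\<Sum>m\<in>T. a m * (c (e m) s0 - c (e m) s1)) \<noteq> (0::real)"
    and van: "\<And>f :: 'g list \<Rightarrow> 's \<Rightarrow> 'k. \<And>s. s \<in> {s0, s1} \<Longrightarrow> (\<Sum>m\<in>T. of_real (a m) * d f (e m) s) = 0"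
  shows "\<exists>z. z \<in> Cocyc (Suc n) \<and> z \<notin> Cobd (Suc n)"
proof -
  define mean where "mean gs = (\<Sum>s\<in>S. c gs s) / real (card S)" for gs
  have cS: "card S \<noteq> 0" using finite_S S_nonempty by simp
  define x :: "'g list \<Rightarrow> 's \<Rightarrow> 'k" where "x gs s = (if s \<in> S then of_real (c gs s - mean gs) else 0)" for gs s
  have z0: "(\<Sum>s\<in>S. c gs s - mean gs) = 0" for gs using cS by (simp add: sum_subtractf mean_def)
  have sz: "x gs \<in> sum_zero" for gs
  proof (rule sum_zeroI)
    have "(\<Sum>s\<in>S. x gs s) = of_real (\<Sum>s\<in>S. c gs s - mean gs)" by (simp add: x_def)
    then show "sum (x gs) S = 0" by (simp only: z0 of_real_0)
  qed (simp add: x_def)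
  define z where "z = (\<lambda>gs\<in>tuples G (Suc n). enc (x gs))"
  have dz: "dec (z gs) = x gs" if "gs \<in> tuples G (Suc n)" for gs
    using that sz by (simp add: z_def dec_enc_sum_zero)
  have zc: "z \<in> carrier (Coch (Suc n))"
    using enc_closed[OF sz] by (auto simp: z_def cochain_carrier)
  have "z \<in> Cocyc (Suc n)"
    unfolding cocycles_iff
  proof (intro conjI zc ballI)
    fix gs s assume gs: "gs \<in> tuples G (Suc (Suc n))" and s: "s \<in> S"
    have hd: "hd gs \<in> carrier G" using gs tuples_simps by blast
    \<comment> \<open>The differential of the mean for the trivial action. Summing \<open>dm\<close>
      over \<open>S\<close> leaves \<open>card S\<close> times this number, so it vanishes.\<close>
    let ?m = "mean (tl gs) - (\<Sum>i<length gs. (-1) ^ i * mean (merge G i gs))"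
    have dm: "d c gs t = d (\<lambda>gs s. c gs s - mean gs) gs t + ?m" for t
      by (simp add: d_def right_diff_distrib sum_subtractf)
    have "(\<Sum>t\<in>S. d (\<lambda>gs s. c gs s - mean gs) gs t) = 0"
    proof -
      have "(\<Sum>t\<in>S. \<Sum>i<length gs. (-1) ^ i * (c (merge G i gs) t - mean (merge G i gs))) = 0"
        by (subst sum.swap) (simp add: z0 flip: sum_distrib_left)
      then show ?thesis
        using sum_act_inv[OF hd, of "\<lambda>t. c (tl gs) t - mean (tl gs)"] z0
        unfolding d_def by (subst sum_subtractf) (simp only: diff_self)
    qed
    moreover have "(\<Sum>t\<in>S. d (\<lambda>gs s. c gs s - mean gs) gs t) = (\<Sum>t\<in>S. - ?m)"
      using cocycle[OF gs] dm by (intro sum.cong) (auto simp: add_eq_0_iff2)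
    ultimately have "?m = 0" using cS by simp
    then have 0: "d (\<lambda>gs s. c gs s - mean gs) gs s = 0" using dm[of s] cocycle[OF gs s] by simp
    have "d (\<lambda>gs. dec (z gs)) gs s = d (\<lambda>gs s. of_real (c gs s - mean gs)) gs s"
      by (rule d_cong[OF gs s]) (simp add: dz x_def)
    also have "\<dots> = of_real (d (\<lambda>gs s. c gs s - mean gs) gs s)" by (simp add: d_def)
    finally show "d (\<lambda>gs. dec (z gs)) gs s = 0" using 0 by simp
  qed
  moreover have "z \<notin> Cobd (Suc n)"
  proof
    assume "z \<in> Cobd (Suc n)"
    then obtain f where f: "f \<in> carrier (Coch n)" "z = delta n f" by auto
    have "x (e m) s = d (\<lambda>gs. dec (f gs)) (e m) s" if "m \<in> T" "s \<in> S" for m s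
      using coboundary_H(2)[OF f(1) T(2)[OF that(1)] that(2)] dz[OF T(2)[OF that(1)]] f(2) by simp
    then have "(\<Sum>m\<in>T. of_real (a m) * x (e m) s) = 0" if "s \<in> {s0, s1}" for s
      using van[OF that, of "\<lambda>gs. dec (f gs)"] s that by auto
    from this[of s0] this[of s1]
    have "(\<Sum>m\<in>T. of_real (a m) * (x (e m) s0 - x (e m) s1)) = 0"
      by (simp add: right_diff_distrib sum_subtractf)
    also have "(\<Sum>m\<in>T. of_real (a m) * (x (e m) s0 - x (e m) s1)) =
        of_real (\<Sum>m\<in>T. a m * (c (e m) s0 - c (e m) s1))"
      using s by (simp add: x_def)
    finally show False using ne by (simp only: of_real_eq_0_iff)
  qed
  ultimately show ?thesis by blast
qed

end

context transitive_action
begin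

text \<open>The chain with coefficients \<open>a m\<close> on the tuples \<open>e m\<close>,
  evaluated at \<open>s0\<close> minus \<open>s1\<close>, kills all coboundaries but not
  \<open>c\<close>. Vanishing is assumed separately for real and complex functions because the type
  of \<open>f\<close> cannot vary within one assumption.\<close>

theorem cohomology_of_cocycle:
  fixes c :: "'g list \<Rightarrow> 's \<Rightarrow> real"
  assumes cocycle: "\<And>gs s. \<lbrakk>gs \<in> tuples G (Suc (Suc n)); s \<in> S\<rbrakk> \<Longrightarrow> d c gs s = 0"
    and T: "finite T" "\<And>m. m \<in> T \<Longrightarrow> e m \<in> tuples G (Suc n)"
    and s: "s0 \<in> S" "s1 \<in> S"
    and ne: "(\<Sum>m\<in>T. a m * (c (e m) s0 - c (e m) s1)) \<noteq> (0::real)"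
    and van_real: "\<And>f :: 'g list \<Rightarrow> 's \<Rightarrow> real. \<And>s. s \<in> {s0, s1} \<Longrightarrow> (\<Sum>m\<in>T. a m * d f (e m) s) = 0"
    and van_complex: "\<And>f :: 'g list \<Rightarrow> 's \<Rightarrow> complex. \<And>s. s \<in> {s0, s1} \<Longrightarrow>
      (\<Sum>m\<in>T. of_real (a m) * d f (e m) s) = 0"
  shows "\<exists>(H :: (real, real vec) inner_space) \<pi>.
      orthogonal_representation G H \<pi> \<and> finite_dimensional H \<and>
      invariant_vectors G H \<pi> = {\<zero>\<^bsub>H\<^esub>} \<and>
      carrier (cohomology G H \<pi> (Suc n)) \<noteq> {\<one>\<^bsub>cohomology G H \<pi> (Suc n)\<^esub>} \<and>
      (\<forall>n. reduced_cohomology G H \<pi> n = cohomology G H \<pi> n)"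
    and "\<not> property_T TYPE(nat \<Rightarrow> complex) G (Suc n)"
proof -
  obtain en :: "nat \<Rightarrow> 's" where en: "bij_betw en {..<card S} S"
    using ex_bij_betw_nat_finite[OF finite_S] by (auto simp: atLeast0LessThan)
  define idx where "idx = the_inv_into {..<card S} en"
  have idx: "idx s < card S" "en (idx s) = s" if "s \<in> S" for s
    using bij_betw_the_inv_into[OF en] that f_the_inv_into_f_bij_betw[OF en]
    by (auto simp: idx_def bij_betw_def)
  define encr :: "('s \<Rightarrow> real) \<Rightarrow> real vec" where "encr x = vec (card S) (\<lambda>i. x (en i))" for x
  define decr :: "real vec \<Rightarrow> 's \<Rightarrow> real" where "decr v s = (if s \<in> S then v $ idx s else 0)" for v s
  define encc :: "('s \<Rightarrow> complex) \<Rightarrow> nat \<Rightarrow> complex" where "encc x i = (if i < card S then x (en i) else 0)" for x i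
  define decc :: "(nat \<Rightarrow> complex) \<Rightarrow> 's \<Rightarrow> complex" where "decc v s = (if s \<in> S then v (idx s) else 0)" for v s
  interpret R: sum_zero_space G S act encr decr
    by unfold_locales (auto simp: encr_def decr_def idx fun_eq_iff power2_eq_square sum_nonneg)
  interpret C: sum_zero_space G S act encc decc
  proof
    show "norm (\<Sum>s\<in>S. x s * conjugate (x s)) = (\<Sum>s\<in>S. (norm (x s))\<^sup>2)" for x :: "'s \<Rightarrow> complex"
    proof -
      have "(\<Sum>s\<in>S. x s * conjugate (x s)) = of_real (\<Sum>s\<in>S. (norm (x s))\<^sup>2)"
        by (simp only: conjugate_complex_def complex_norm_square[symmetric] of_real_sum)
      then show ?thesis by (simp only: norm_of_real) (simp add: sum_nonneg)
    qed
  qed (auto simp: encc_def decc_def idx fun_eq_iff)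
  obtain z where z: "z \<in> cocycles G R.H R.rep (Suc n)" "z \<notin> coboundaries G R.H R.rep (Suc n)"
    using R.nontrivial_cocycle[OF cocycle T s ne] van_real by auto
  show "\<exists>(H :: (real, real vec) inner_space) \<pi>.
      orthogonal_representation G H \<pi> \<and> finite_dimensional H \<and>
      invariant_vectors G H \<pi> = {\<zero>\<^bsub>H\<^esub>} \<and>
      carrier (cohomology G H \<pi> (Suc n)) \<noteq> {\<one>\<^bsub>cohomology G H \<pi> (Suc n)\<^esub>} \<and>
      (\<forall>n. reduced_cohomology G H \<pi> n = cohomology G H \<pi> n)"
    using R.unitary_representation_rep R.fin_dim_H R.invariant_vectors_rep
      R.cohomology_nontrivial[OF z] R.reduced_cohomology_eq
    unfolding finite_dimensional_def by blast
  obtain z where z: "z \<in> cocycles G C.H C.rep (Suc n)" "z \<notin> coboundaries G C.H C.rep (Suc n)"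
    using C.nontrivial_cocycle[OF cocycle T s ne] van_complex by auto
  show "\<not> property_T TYPE(nat \<Rightarrow> complex) G (Suc n)"
    using C.unitary_representation_rep C.invariant_vectors_rep C.cohomology_nontrivial[OF z]
    unfolding property_T_def C.reduced_cohomology_eq[symmetric] by blast
qed

end

unbundle no vec_syntax
unbundle no inner_syntax

section \<open>Counting a vector in signed simplicial cones\<close>

lemma sum_unique_indicator:
  assumes "finite P" "k \<in> P" "\<And>i. i \<in> P \<Longrightarrow> Q i \<longleftrightarrow> i = k \<and> c"
  shows "(\<Sum>i\<in>P. if Q i then 1 else 0) = (if c then 1 else 0 :: real)"
proof -
  have "(\<Sum>i\<in>P. if Q i then 1 else 0) = (\<Sum>i\<in>P. if i = k then (if c then 1 else 0 :: real) else 0)"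
    using assms(3) by (intro sum.cong) auto
  then show ?thesis using assms by simp
qed

text \<open>Follow the point \<open>\<alpha> + t \<beta>\<close> for \<open>t\<close> from 0 to
  infinity: the left side adds 1 when it enters the positive orthant and -1 when it leaves, the
  right side compares the two ends of the ray. The hypothesis \<open>distinct\<close> makes it cross
  one wall at a time.\<close>

lemma orthant_jump_sum:
  fixes \<alpha> \<beta> :: "'i \<Rightarrow> real"
  assumes fin: "finite I" and ne: "I \<noteq> {}"
    and \<alpha>: "\<And>i. i \<in> I \<Longrightarrow> \<alpha> i \<noteq> 0" and \<beta>: "\<And>i. i \<in> I \<Longrightarrow> \<beta> i \<noteq> 0"
    and distinct: "\<And>i j. \<lbrakk>i \<in> I; j \<in> I; i \<noteq> j\<rbrakk> \<Longrightarrow> \<alpha> i * \<beta> j \<noteq> \<alpha> j * \<beta> i"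
  shows "(\<Sum>k\<in>I. if - \<alpha> k / \<beta> k > 0 \<and> (\<forall>i\<in>I. i \<noteq> k \<longrightarrow> \<alpha> i + (- \<alpha> k / \<beta> k) * \<beta> i > 0)
                   then sgn (\<beta> k) else 0)
       = (if \<forall>i\<in>I. \<beta> i > 0 then 1 else 0) - (if \<forall>i\<in>I. \<alpha> i > 0 then 1 else 0)"
proof -
  \<comment> \<open>The time at which coordinate \<open>k\<close> changes sign.\<close>
  define s where "s k = - \<alpha> k / \<beta> k" for k
  define P where "P = {i \<in> I. \<beta> i > 0}"
  define M where "M = {i \<in> I. \<beta> i < 0}"
  have I: "I = P \<union> M" "P \<inter> M = {}" and PM: "finite P" "finite M"
    using \<beta> fin by (auto simp: P_def M_def) (metis linorder_neqE_linordered_idom)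
  have s0: "s i \<noteq> 0" if "i \<in> I" for i using that \<alpha> \<beta> by (simp add: s_def)
  have inj: "inj_on s I"
  proof (rule inj_onI)
    fix i j assume "i \<in> I" "j \<in> I" "s i = s j"
    then show "i = j" using \<beta>[of i] \<beta>[of j] distinct[of i j] by (auto simp: s_def field_simps)
  qed
  have posP: "\<alpha> i + t * \<beta> i > 0 \<longleftrightarrow> t > s i" if "i \<in> P" for i t
    using that by (auto simp: P_def s_def field_simps)
  have posM: "\<alpha> i + t * \<beta> i > 0 \<longleftrightarrow> t < s i" if "i \<in> M" for i t
    using that by (auto simp: M_def s_def field_simps)
  have \<alpha>P: "\<alpha> i > 0 \<longleftrightarrow> s i < 0" if "i \<in> P" for i using posP[OF that, of 0] by simp
  have \<alpha>M: "\<alpha> i > 0 \<longleftrightarrow> s i > 0" if "i \<in> M" for i using posM[OF that, of 0] by simp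
  define good where "good k \<longleftrightarrow> s k > 0 \<and> (\<forall>i\<in>P. i \<noteq> k \<longrightarrow> s k > s i) \<and> (\<forall>i\<in>M. i \<noteq> k \<longrightarrow> s k < s i)" for k
  have good: "s k > 0 \<and> (\<forall>i\<in>I. i \<noteq> k \<longrightarrow> \<alpha> i + s k * \<beta> i > 0) \<longleftrightarrow> good k" for k
    unfolding I good_def using posP posM by blast
  \<comment> \<open>The point is in the orthant exactly between the last coordinate becoming
    positive, at \<open>p\<close>, and the first becoming negative, at \<open>m\<close>.
    \<open>Max\<close> and \<open>Min\<close> carry no information for empty sets, hence the case
    distinctions.\<close>
  define p where "p = Max (s ` P)"
  define m where "m = Min (s ` M)"
  have p: "p \<in> s ` P" "\<And>i. i \<in> P \<Longrightarrow> s i \<le> p" if "P \<noteq> {}" using that PM by (auto simp: p_def)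
  have m: "m \<in> s ` M" "\<And>i. i \<in> M \<Longrightarrow> m \<le> s i" if "M \<noteq> {}" using that PM by (auto simp: m_def)
  have sumP: "(\<Sum>k\<in>P. if good k then 1 else 0) = (if P \<noteq> {} \<and> p > 0 \<and> (M = {} \<or> p < m) then 1 else 0 :: real)"
  proof (cases "P = {}")
    case False
    then obtain k where k: "k \<in> P" "s k = p" using p by auto
    have "good i \<longleftrightarrow> i = k \<and> p > 0 \<and> (M = {} \<or> p < m)" if i: "i \<in> P" for i
    proof
      assume g: "good i"
      have "i = k"
        using g k p(2)[OF False i] by (force simp: good_def)
      moreover have "M = {} \<or> p < m" using g m(1) k \<open>i = k\<close> I(2) by (fastforce simp: good_def)
      ultimately show "i = k \<and> p > 0 \<and> (M = {} \<or> p < m)" using g k by (auto simp: good_def)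
    next
      assume a: "i = k \<and> p > 0 \<and> (M = {} \<or> p < m)"
      have "s j < s k" if "j \<in> P" "j \<noteq> k" for j
        using p(2)[OF False that(1)] k inj that I by (metis Un_iff inj_on_contraD less_eq_real_def)
      moreover have "s k < s j" if "j \<in> M" for j
        using that a m(2)[of j] k by force
      ultimately show "good i" using a k by (auto simp: good_def)
    qed
    then have "(\<Sum>i\<in>P. if good i then 1 else 0) = (if p > 0 \<and> (M = {} \<or> p < m) then 1 else 0 :: real)"
      by (rule sum_unique_indicator[OF PM(1) k(1)])
    then show ?thesis using False by simp
  qed simp
  have sumM: "(\<Sum>k\<in>M. if good k then 1 else 0) = (if M \<noteq> {} \<and> m > 0 \<and> (P = {} \<or> p < m) then 1 else 0 :: real)"
  proof (cases "M = {}")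
    case False
    then obtain k where k: "k \<in> M" "s k = m" using m by auto
    have "good i \<longleftrightarrow> i = k \<and> m > 0 \<and> (P = {} \<or> p < m)" if i: "i \<in> M" for i
    proof
      assume g: "good i"
      have "i = k"
        using g k m(2)[OF False i] by (force simp: good_def)
      moreover have "P = {} \<or> p < m" using g p(1) k \<open>i = k\<close> I(2) by (fastforce simp: good_def)
      ultimately show "i = k \<and> m > 0 \<and> (P = {} \<or> p < m)" using g k by (auto simp: good_def)
    next
      assume a: "i = k \<and> m > 0 \<and> (P = {} \<or> p < m)"
      have "s k < s j" if "j \<in> M" "j \<noteq> k" for j
        using m(2)[OF False that(1)] k inj that I by (metis Un_iff inj_on_contraD less_eq_real_def)
      moreover have "s j < s k" if "j \<in> P" for j
        using that a p(2)[of j] k by force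
      ultimately show "good i" using a k by (auto simp: good_def)
    qed
    then have "(\<Sum>i\<in>M. if good i then 1 else 0) = (if m > 0 \<and> (P = {} \<or> p < m) then 1 else 0 :: real)"
      by (rule sum_unique_indicator[OF PM(2) k(1)])
    then show ?thesis using False by simp
  qed simp
  have "(\<Sum>k\<in>I. if s k > 0 \<and> (\<forall>i\<in>I. i \<noteq> k \<longrightarrow> \<alpha> i + s k * \<beta> i > 0) then sgn (\<beta> k) else 0)
     = (\<Sum>k\<in>P. if good k then 1 else 0) - (\<Sum>k\<in>M. if good k then 1 else 0)"
    unfolding good unfolding I(1) sum.union_disjoint[OF PM I(2)] diff_conv_add_uminus sum_negf[symmetric]
    by (intro arg_cong2[where f = "(+)"] sum.cong) (auto simp: P_def M_def)
  moreover have "(\<forall>i\<in>I. \<beta> i > 0) \<longleftrightarrow> M = {}"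
    using \<beta> by (auto simp: M_def) (metis linorder_neqE_linordered_idom)
  moreover have "(\<forall>i\<in>I. \<alpha> i > 0) \<longleftrightarrow> (P = {} \<or> p < 0) \<and> (M = {} \<or> m > 0)"
  proof -
    have "(\<forall>i\<in>P. \<alpha> i > 0) \<longleftrightarrow> P = {} \<or> p < 0"
      using \<alpha>P p by (metis empty_iff imageE le_less_trans)
    moreover have "(\<forall>i\<in>M. \<alpha> i > 0) \<longleftrightarrow> M = {} \<or> m > 0"
      using \<alpha>M m by (metis empty_iff imageE less_le_trans)
    ultimately show ?thesis unfolding I by blast
  qed
  moreover have "P \<noteq> {} \<Longrightarrow> p \<noteq> 0" using p(1) s0 I by auto
  moreover have "M \<noteq> {} \<Longrightarrow> m \<noteq> 0" using m(1) s0 I by auto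
  moreover have "p \<noteq> m" if PM_ne: "P \<noteq> {}" "M \<noteq> {}"
  proof
    assume "p = m"
    then obtain i j where "i \<in> P" "j \<in> M" "s i = s j" using p(1)[OF PM_ne(1)] m(1)[OF PM_ne(2)] by auto
    then show False using inj_onD[OF inj, of i j] I by auto
  qed
  moreover have "P \<noteq> {} \<or> M \<noteq> {}" using ne I by auto
  ultimately show ?thesis
    unfolding s_def[symmetric] sumP sumM
    by (cases "P = {}"; cases "M = {}") auto
qed

text \<open>The intersection number of the ray through \<open>w\<close> with the oriented simplex
  spanned by the columns. Only interior points count; general position will keep \<open>w\<close>
  off the walls.\<close>

definition cone_count :: "real mat \<Rightarrow> real vec \<Rightarrow> real" where
  "cone_count A w =
     (if \<exists>x\<in>carrier_vec (dim_col A). A *\<^sub>v x = w \<and> (\<forall>i<dim_col A. x $ i > 0) then sgn (det A) else 0)"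

lemma mult_mat_vec_cancel:
  assumes A: "(A :: real mat) \<in> carrier_mat n n" "det A \<noteq> 0"
    and x: "x \<in> carrier_vec n" "y \<in> carrier_vec n" "A *\<^sub>v x = A *\<^sub>v y"
  shows "x = y"
proof -
  have "A *\<^sub>v (x - y) = 0\<^sub>v n"
    using A x by (simp add: mult_minus_distrib_mat_vec)
  then have "x - y = 0\<^sub>v n"
    using A x det_0_iff_vec_prod_zero[OF A(1)] by (metis minus_carrier_vec)
  then have "(x - y) $ i = 0" if "i < n" for i using that by simp
  then show ?thesis using x by (intro eq_vecI) auto
qed

lemma cone_count_eq:
  assumes A: "A \<in> carrier_mat n n" "det A \<noteq> 0" and x: "x \<in> carrier_vec n"
  shows "cone_count A (A *\<^sub>v x) = (if \<forall>i<n. x $ i > 0 then sgn (det A) else 0)"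
  using mult_mat_vec_cancel[OF A _ x] A x by (auto simp: cone_count_def)

lemma det_replace_col:
  assumes "(A :: real mat) \<in> carrier_mat n n" "x \<in> carrier_vec n" "k < n"
  shows "det (replace_col A (A *\<^sub>v x) k) = x $ k * det A"
  using assms by (rule cramer_lemma_mat)

lemma replace_col_carrier: "A \<in> carrier_mat n n \<Longrightarrow> replace_col A b k \<in> carrier_mat n n"
  by (simp add: replace_col_def)

lemma mult_mat_vec_nth:
  "\<lbrakk>A \<in> carrier_mat n m; x \<in> carrier_vec m; i < n\<rbrakk> \<Longrightarrow>
   (A *\<^sub>v x) $ i = (\<Sum>j<m. A $$ (i, j) * (x $ j :: 'a::semiring_0))"
  by (auto simp: scalar_prod_def atLeast0LessThan intro!: sum.cong)

lemma mult_mat_nth: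
  "\<lbrakk>A \<in> carrier_mat n m; B \<in> carrier_mat m l; i < n; j < l\<rbrakk> \<Longrightarrow>
   (A * B) $$ (i, j) = (\<Sum>k<m. A $$ (i, k) * (B $$ (k, j) :: 'a::semiring_0))"
  by (auto simp: scalar_prod_def atLeast0LessThan intro!: sum.cong)

text \<open>Push \<open>w = A \<alpha>\<close> in the direction \<open>b = A \<beta>\<close>. It
  crosses the wall opposite to column \<open>k\<close> at a positive time exactly when
  \<open>w\<close> lies in the cone where that column is replaced by \<open>- b\<close>, so this is
  \<open>orthant_jump_sum\<close> in the coordinates given by \<open>A\<close>.\<close>

lemma cone_count_exchange:
  assumes A: "A \<in> carrier_mat n n" "det A \<noteq> 0" and n: "n > 0"
    and \<alpha>: "\<alpha> \<in> carrier_vec n" "\<And>i. i < n \<Longrightarrow> \<alpha> $ i \<noteq> 0"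
    and \<beta>: "\<beta> \<in> carrier_vec n" "\<And>i. i < n \<Longrightarrow> \<beta> $ i \<noteq> 0"
    and distinct: "\<And>i j. \<lbrakk>i < n; j < n; i \<noteq> j\<rbrakk> \<Longrightarrow> \<alpha> $ i * \<beta> $ j \<noteq> \<alpha> $ j * \<beta> $ i"
  shows "cone_count A (A *\<^sub>v \<alpha>) =
    cone_count A (A *\<^sub>v \<beta>) + (\<Sum>k<n. cone_count (replace_col A (A *\<^sub>v (- \<beta>)) k) (A *\<^sub>v \<alpha>))"
proof -
  have col: "cone_count (replace_col A (A *\<^sub>v (- \<beta>)) k) (A *\<^sub>v \<alpha>) =
      - sgn (det A) * (if - \<alpha> $ k / \<beta> $ k > 0 \<and>
        (\<forall>i\<in>{..<n}. i \<noteq> k \<longrightarrow> \<alpha> $ i + (- \<alpha> $ k / \<beta> $ k) * \<beta> $ i > 0) then sgn (\<beta> $ k) else 0)"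
    if k: "k < n" for k
  proof -
    let ?B = "replace_col A (A *\<^sub>v (- \<beta>)) k" and ?s = "- \<alpha> $ k / \<beta> $ k"
    \<comment> \<open>The coordinates of \<open>w\<close> with respect to the new columns:
      \<open>w + ?s b\<close> has no component along column \<open>k\<close>, and \<open>w\<close>
      is that vector plus \<open>?s\<close> times \<open>- b\<close>.\<close>
    define y where "y = vec n (\<lambda>i. if i = k then ?s else \<alpha> $ i + ?s * \<beta> $ i)"
    have B: "?B \<in> carrier_mat n n" using A by (simp add: replace_col_carrier)
    have mb: "- \<beta> \<in> carrier_vec n" using \<beta> by simp
    have dB: "det ?B = - \<beta> $ k * det A" using det_replace_col[OF A(1) mb k] \<beta> k by simp
    have "?B *\<^sub>v y = A *\<^sub>v \<alpha>"
    proof (rule eq_vecI)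
      fix i assume "i < dim_vec (A *\<^sub>v \<alpha>)"
      then have i: "i < n" using A by simp
      have Ai: "(A *\<^sub>v (- \<beta>)) $ i = - (\<Sum>j<n. A $$ (i, j) * \<beta> $ j)"
        unfolding mult_mat_vec_nth[OF A(1) mb i] sum_negf[symmetric]
        using \<beta> by (intro sum.cong) auto
      have "(?B *\<^sub>v y) $ i = (\<Sum>j<n. ?B $$ (i, j) * y $ j)"
        by (rule mult_mat_vec_nth[OF B _ i]) (simp add: y_def)
      also have "\<dots> = (\<Sum>j<n. A $$ (i, j) * (if j = k then 0 else \<alpha> $ j + ?s * \<beta> $ j)
           + (if j = k then (A *\<^sub>v (- \<beta>)) $ i * ?s else 0))"
        using A i by (intro sum.cong) (auto simp: y_def replace_col_def)
      also have "\<dots> = (\<Sum>j<n. A $$ (i, j) * (if j = k then 0 else \<alpha> $ j + ?s * \<beta> $ j))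
           + (A *\<^sub>v (- \<beta>)) $ i * ?s"
        using k by (simp add: sum.distrib)
      also have "(\<Sum>j<n. A $$ (i, j) * (if j = k then 0 else \<alpha> $ j + ?s * \<beta> $ j)) =
          (\<Sum>j<n. A $$ (i, j) * \<alpha> $ j) + ?s * (\<Sum>j<n. A $$ (i, j) * \<beta> $ j)"
        unfolding sum_distrib_left sum.distrib[symmetric]
        using \<beta>(2)[OF k] by (intro sum.cong) (auto simp: algebra_simps)
      finally show "(?B *\<^sub>v y) $ i = (A *\<^sub>v \<alpha>) $ i"
        unfolding Ai mult_mat_vec_nth[OF A(1) \<alpha>(1) i] by simp
    qed (use A B in auto)
    then have "cone_count ?B (A *\<^sub>v \<alpha>) = (if \<forall>i<n. y $ i > 0 then sgn (det ?B) else 0)"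
      using cone_count_eq[OF B, of y] dB \<beta>(2)[OF k] A(2) by (simp add: y_def)
    moreover have "(\<forall>i<n. y $ i > 0) \<longleftrightarrow> ?s > 0 \<and> (\<forall>i\<in>{..<n}. i \<noteq> k \<longrightarrow> \<alpha> $ i + ?s * \<beta> $ i > 0)"
      using k by (auto simp: y_def)
    ultimately have "cone_count ?B (A *\<^sub>v \<alpha>) = (if ?s > 0 \<and>
        (\<forall>i\<in>{..<n}. i \<noteq> k \<longrightarrow> \<alpha> $ i + ?s * \<beta> $ i > 0) then sgn (det ?B) else 0)"
      by (simp only:)
    also have "sgn (det ?B) = - sgn (det A) * sgn (\<beta> $ k)" by (simp add: dB sgn_mult)
    finally show ?thesis by (simp only: if_distrib[of "(*) (- sgn (det A))"] mult_zero_right)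
  qed
  have "(\<Sum>k<n. cone_count (replace_col A (A *\<^sub>v (- \<beta>)) k) (A *\<^sub>v \<alpha>)) =
     - sgn (det A) * (\<Sum>k<n. if - \<alpha> $ k / \<beta> $ k > 0 \<and>
        (\<forall>i\<in>{..<n}. i \<noteq> k \<longrightarrow> \<alpha> $ i + (- \<alpha> $ k / \<beta> $ k) * \<beta> $ i > 0) then sgn (\<beta> $ k) else 0)"
    unfolding sum_distrib_left by (rule sum.cong) (simp_all only: col lessThan_iff)
  also have "\<dots> = - sgn (det A) * ((if \<forall>i\<in>{..<n}. \<beta> $ i > 0 then 1 else 0) - (if \<forall>i\<in>{..<n}. \<alpha> $ i > 0 then 1 else 0))"
    using n \<alpha>(2) \<beta>(2) distinct by (subst orthant_jump_sum) auto
  finally have sum: "(\<Sum>k<n. cone_count (replace_col A (A *\<^sub>v (- \<beta>)) k) (A *\<^sub>v \<alpha>)) =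
     - sgn (det A) * ((if \<forall>i<n. \<beta> $ i > 0 then 1 else 0) - (if \<forall>i<n. \<alpha> $ i > 0 then 1 else 0))"
    by (simp only: Ball_def lessThan_iff)
  have "(if P then x else 0) = (if Q then x else 0) + - x * ((if Q then 1 else 0) - (if P then 1 else 0))"
    for P Q and x :: real by simp
  then show ?thesis
    unfolding cone_count_eq[OF A \<alpha>(1)] cone_count_eq[OF A \<beta>(1)] sum .
qed

lemma coeff_sum_monom_lessThan:
  "Polynomial.coeff (\<Sum>i<n. monom (f i) i) k = (if k < n then f k else (0::real))"
  by (simp add: coeff_sum)

text \<open>Along the moment curve \<open>(1, t, t^2, ...)\<close> the product with each
  \<open>r\<close> is a nonzero polynomial in \<open>t\<close>, so only finitely many
  \<open>t\<close> are excluded.\<close>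

lemma generic_vector:
  assumes "finite R" "\<And>r. r \<in> R \<Longrightarrow> r \<in> carrier_vec n \<and> r \<noteq> 0\<^sub>v n"
  obtains b :: "real vec" where "b \<in> carrier_vec n" "\<And>r. r \<in> R \<Longrightarrow> r \<bullet> b \<noteq> 0"
proof -
  define q where "q r = (\<Sum>i<n. monom (r $ i) i)" for r :: "real vec"
  have q0: "q r \<noteq> 0" if "r \<in> R" for r
  proof
    assume "q r = 0"
    then have "r $ i = 0" if "i < n" for i
      using coeff_sum_monom_lessThan[of "\<lambda>i. r $ i" n i] that by (simp add: q_def)
    then have "r = 0\<^sub>v n" using assms(2)[OF that] by (intro eq_vecI) auto
    then show False using assms(2)[OF that] by simp
  qed
  have "finite (\<Union>r\<in>R. {t. poly (q r) t = 0})"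
    using assms(1) q0 by (auto intro: poly_roots_finite)
  then obtain t where t: "t \<notin> (\<Union>r\<in>R. {t. poly (q r) t = 0})"
    using ex_new_if_finite infinite_UNIV_char_0 by blast
  have "r \<bullet> vec n (\<lambda>i. t ^ i) = poly (q r) t" for r
    by (auto simp: scalar_prod_def q_def poly_sum poly_monom atLeast0LessThan intro!: sum.cong)
  then show thesis using t by (intro that[of "vec n (\<lambda>i. t ^ i)"]) auto
qed

text \<open>Exchanging the columns for \<open>x\<close> one at a time is the cocycle relation for the columns and \<open>x\<close>.
  The remaining count, of \<open>- x\<close> in the cone of the columns, vanishes because \<open>x\<close> is chosen in the
  half-space of the columns.\<close>

lemma cone_count_auxiliary_vector:
  fixes w v :: "real vec"
  assumes n: "n > 0" and fin: "finite \<A>"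
    and A: "\<And>A. A \<in> \<A> \<Longrightarrow> A \<in> carrier_mat n n \<and> det A \<noteq> 0"
    and w: "w \<in> carrier_vec n" and v: "v \<in> carrier_vec n"
    and wA: "\<And>A j. \<lbrakk>A \<in> \<A>; j < n\<rbrakk> \<Longrightarrow> det (replace_col A w j) \<noteq> 0"
    and pos: "\<And>A j. \<lbrakk>A \<in> \<A>; j < n\<rbrakk> \<Longrightarrow> v \<bullet> col A j > 0"
  obtains x where "x \<in> carrier_vec n"
    "\<And>A. A \<in> \<A> \<Longrightarrow> cone_count A w = (\<Sum>k<n. cone_count (replace_col A x k) w)"
proof (cases "\<A> = {}")
  case True
  then show ?thesis using that[of "0\<^sub>v n"] by simp
next
  case False
  define Ainv where "Ainv A = (1 / det A) \<cdot>\<^sub>m adj_mat A" for A :: "real mat"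
  have inv: "Ainv A \<in> carrier_mat n n" "A * Ainv A = 1\<^sub>m n" "Ainv A * A = 1\<^sub>m n" if "A \<in> \<A>" for A
  proof -
    have AA: "A \<in> carrier_mat n n" "det A \<noteq> 0" using A[OF that] by auto
    note adj = adj_mat[OF AA(1)]
    have one: "(1 / det A) \<cdot>\<^sub>m (det A \<cdot>\<^sub>m 1\<^sub>m n) = 1\<^sub>m n" using AA(2) by (intro eq_matI) auto
    show "Ainv A \<in> carrier_mat n n" using adj by (simp add: Ainv_def)
    show "A * Ainv A = 1\<^sub>m n" "Ainv A * A = 1\<^sub>m n"
      unfolding Ainv_def mult_smult_distrib[OF AA(1) adj(1)] mult_smult_assoc_mat[OF adj(1) AA(1)] adj one by simp_all
  qed
  have A_inv: "A *\<^sub>v (Ainv A *\<^sub>v y) = y" if "A \<in> \<A>" "y \<in> carrier_vec n" for A y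
    using A[OF that(1)] inv[OF that(1)] that(2) by (metis assoc_mult_mat_vec one_mult_mat_vec)
  define \<alpha> where "\<alpha> A = Ainv A *\<^sub>v w" for A
  have \<alpha>: "\<alpha> A \<in> carrier_vec n" "A *\<^sub>v \<alpha> A = w" if "A \<in> \<A>" for A
    using inv[OF that] w A_inv[OF that w] by (auto simp: \<alpha>_def)
  have \<alpha>0: "\<alpha> A $ i \<noteq> 0" if "A \<in> \<A>" "i < n" for A i
    using det_replace_col[of A n "\<alpha> A" i] A \<alpha> wA that by auto
  \<comment> \<open>Being orthogonal to none of these says three things about \<open>b\<close>:
    \<open>v\<close> does not vanish on it, none of its coordinates with respect to \<open>A\<close>
    is 0, and no two coordinates of \<open>w + t b\<close> vanish at the same
    \<open>t\<close>.\<close>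
  define R where "R = insert v (\<Union>A\<in>\<A>. (\<Union>i<n. insert (Matrix.row (Ainv A) i)
     (\<Union>j\<in>{..<n} - {i}. {\<alpha> A $ i \<cdot>\<^sub>v Matrix.row (Ainv A) j - \<alpha> A $ j \<cdot>\<^sub>v Matrix.row (Ainv A) i})))"
  have row_col: "Matrix.row (Ainv A) i \<bullet> col A j = (if i = j then 1 else 0)" if "A \<in> \<A>" "i < n" "j < n" for A i j
    using arg_cong[OF inv(3)[OF that(1)], of "\<lambda>X. X $$ (i, j)"] that
      carrier_matD[OF conjunct1[OF A[OF that(1)]]] carrier_matD[OF inv(1)[OF that(1)]] by simp
  have "r \<in> carrier_vec n \<and> r \<noteq> 0\<^sub>v n" if r: "r \<in> R" for r
  proof -
    consider "r = v" | A i where "A \<in> \<A>" "i < n" "r = Matrix.row (Ainv A) i"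
      | A i j where "A \<in> \<A>" "i < n" "j < n" "j \<noteq> i" "r = \<alpha> A $ i \<cdot>\<^sub>v Matrix.row (Ainv A) j - \<alpha> A $ j \<cdot>\<^sub>v Matrix.row (Ainv A) i"
      using r unfolding R_def by blast
    then show ?thesis
    proof cases
      case 1
      obtain A where "A \<in> \<A>" using False by blast
      then have "v \<bullet> col A 0 > 0" "col A 0 \<in> carrier_vec n" using pos n A by auto
      then show ?thesis using v 1 by auto
    next
      case 2
      have "r \<bullet> col A i = 1" using row_col 2 by simp
      moreover have "r \<in> carrier_vec n" "col A i \<in> carrier_vec n" using 2 inv A by (auto simp: Matrix.row_def) 
      ultimately show ?thesis by auto
    next
      case 3
      have c: "Matrix.row (Ainv A) i \<in> carrier_vec n" "Matrix.row (Ainv A) j \<in> carrier_vec n" "col A j \<in> carrier_vec n"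
        using 3 inv(1)[of A] A[of A] by (auto simp: Matrix.row_def)
      have "r \<bullet> col A j = \<alpha> A $ i"
        using 3 c row_col[of A] by (simp add: minus_scalar_prod_distrib[of _ n])
      then show ?thesis using \<alpha>0 3 c by auto
    qed
  qed
  moreover have "finite R" using fin by (auto simp: R_def)
  ultimately obtain b0 where b0: "b0 \<in> carrier_vec n" "\<And>r. r \<in> R \<Longrightarrow> r \<bullet> b0 \<noteq> 0"
    using generic_vector by metis
  \<comment> \<open>This sign puts \<open>- b\<close> into the half-space of the columns, so that
    \<open>b\<close> lies in none of their cones.\<close>
  define b where "b = (if v \<bullet> b0 < 0 then b0 else - b0)"
  have b: "b \<in> carrier_vec n" using b0 by (simp add: b_def)
  have rb: "r \<bullet> b \<noteq> 0" if "r \<in> R" "r \<in> carrier_vec n" for r using b0 that by (auto simp: b_def)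
  have "v \<bullet> b0 \<noteq> 0" using b0(2)[of v] by (simp add: R_def)
  then have vb: "v \<bullet> b < 0" using b0 v by (auto simp: b_def)
  show thesis
  proof (rule that[of "- b"])
    show "- b \<in> carrier_vec n" using b by simp
    fix A assume AA: "A \<in> \<A>"
    define \<beta> where "\<beta> = Ainv A *\<^sub>v b"
    have \<beta>: "\<beta> \<in> carrier_vec n" "A *\<^sub>v \<beta> = b" using inv[OF AA] b A_inv[OF AA b] by (auto simp: \<beta>_def)
    have rc: "Matrix.row (Ainv A) i \<in> carrier_vec n" if "i < n" for i using inv(1)[OF AA] that by (auto simp: Matrix.row_def)
    have \<beta>i: "\<beta> $ i = Matrix.row (Ainv A) i \<bullet> b" if "i < n" for i using that inv[OF AA] by (simp add: \<beta>_def)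
    have mb: "A *\<^sub>v (- \<beta>) = - b"
    proof (rule eq_vecI)
      fix i assume i: "i < dim_vec (- b)"
      have "(A *\<^sub>v (- \<beta>)) $ i = - ((A *\<^sub>v \<beta>) $ i)"
        using i b A[OF AA] \<beta>(1) mult_mat_vec_nth[of A n n \<beta> i] mult_mat_vec_nth[of A n n "- \<beta>" i]
        by (simp add: sum_negf)
      then show "(A *\<^sub>v (- \<beta>)) $ i = (- b) $ i" using \<beta> i by simp
    qed (use A[OF AA] b in auto)
    have "cone_count A (A *\<^sub>v \<alpha> A) =
      cone_count A (A *\<^sub>v \<beta>) + (\<Sum>k<n. cone_count (replace_col A (A *\<^sub>v (- \<beta>)) k) (A *\<^sub>v \<alpha> A))"
    proof (rule cone_count_exchange)
      show "A \<in> carrier_mat n n" "det A \<noteq> 0" "n > 0" "\<alpha> A \<in> carrier_vec n" "\<beta> \<in> carrier_vec n"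
        using A[OF AA] n \<alpha>[OF AA] \<beta> by auto
      show "\<alpha> A $ i \<noteq> 0" if "i < n" for i using \<alpha>0[OF AA that] .
      show "\<beta> $ i \<noteq> 0" if "i < n" for i
        unfolding \<beta>i[OF that] using AA that by (intro rb rc) (auto simp: R_def)
      show "\<alpha> A $ i * \<beta> $ j \<noteq> \<alpha> A $ j * \<beta> $ i" if ij: "i < n" "j < n" "i \<noteq> j" for i j
      proof -
        have "(\<alpha> A $ i \<cdot>\<^sub>v Matrix.row (Ainv A) j - \<alpha> A $ j \<cdot>\<^sub>v Matrix.row (Ainv A) i) \<bullet> b \<noteq> 0"
          using AA ij rc by (intro rb) (force simp: R_def, auto)
        then show ?thesis
          using rc[OF ij(1)] rc[OF ij(2)] b \<beta>i ij by (simp add: minus_scalar_prod_distrib[of _ n])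
      qed
    qed
    moreover have "cone_count A b = 0"
    proof -
      have "\<not> (\<forall>i<n. \<beta> $ i > 0)"
      proof
        assume p: "\<forall>i<n. \<beta> $ i > 0"
        have "v \<bullet> b = (\<Sum>i<n. v $ i * (\<Sum>j<n. A $$ (i, j) * \<beta> $ j))"
          unfolding scalar_prod_def using b \<beta>(2) mult_mat_vec_nth[of A n n \<beta>] A[OF AA] \<beta>(1)
          by (auto simp: atLeast0LessThan intro!: sum.cong)
        also have "\<dots> = (\<Sum>j<n. \<beta> $ j * (\<Sum>i<n. v $ i * A $$ (i, j)))"
          unfolding sum_distrib_left by (subst sum.swap) (simp add: mult_ac)
        also have "\<dots> = (\<Sum>j<n. \<beta> $ j * (v \<bullet> col A j))"
          using A[OF AA] by (auto simp: scalar_prod_def atLeast0LessThan intro!: sum.cong)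
        also have "\<dots> > 0" using p pos[OF AA] n by (intro sum_pos) auto
        finally show False using vb by simp
      qed
      then show ?thesis using cone_count_eq[of A n \<beta>] A[OF AA] \<beta> by auto
    qed
    ultimately show "cone_count A w = (\<Sum>k<n. cone_count (replace_col A (- b) k) w)"
      using \<alpha>[OF AA] \<beta> mb by simp
  qed
qed

section \<open>Positive definite forms in general position\<close>

lemma group_special_linear_group: "group (special_linear_group TYPE('a::comm_ring_1) n)"
proof (rule groupI)
  fix A :: "'a mat"
  assume "A \<in> carrier (special_linear_group TYPE('a) n)"
  then have A: "A \<in> carrier_mat n n" "det A = 1" by (auto simp: special_linear_group_def)
  have inv: "adj_mat A * A = 1\<^sub>m n" "adj_mat A \<in> carrier_mat n n"
    using adj_mat[OF A(1)] A(2) by auto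
  then have "det (adj_mat A) * det A = 1" by (metis A(1) det_mult det_one)
  then have "adj_mat A \<in> carrier (special_linear_group TYPE('a) n)"
    using inv A by (simp add: special_linear_group_def)
  then show "\<exists>B\<in>carrier (special_linear_group TYPE('a) n).
      B \<otimes>\<^bsub>special_linear_group TYPE('a) n\<^esub> A = \<one>\<^bsub>special_linear_group TYPE('a) n\<^esub>"
    using inv by (auto simp: special_linear_group_def)
qed (auto simp: special_linear_group_def det_mult)

section \<open>Countable and finite sets of integral matrices and vectors\<close>

lemma countable_carrier_mat: "countable (carrier_mat n m :: 'a::countable mat set)"
proof (rule countable_subset[OF _ countable_image[of "UNIV :: 'a list list set"]])
  show "carrier_mat n m \<subseteq> (\<lambda>xs. mat n m (\<lambda>(i, j). xs ! i ! j)) ` (UNIV :: 'a list list set)"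
  proof
    fix A :: "'a mat" assume "A \<in> carrier_mat n m"
    then have "A = mat n m (\<lambda>(i, j). map (\<lambda>i. map (\<lambda>j. A $$ (i, j)) [0..<m]) [0..<n] ! i ! j)"
      by (intro eq_matI) auto
    then show "A \<in> (\<lambda>xs. mat n m (\<lambda>(i, j). xs ! i ! j)) ` (UNIV :: 'a list list set)" by blast
  qed
qed simp

lemma countable_carrier_vec: "countable (carrier_vec n :: 'a::countable vec set)"
proof (rule countable_subset[OF _ countable_image[of "UNIV :: 'a list set"]])
  show "carrier_vec n \<subseteq> (\<lambda>xs. vec n ((!) xs)) ` (UNIV :: 'a list set)"
  proof
    fix v :: "'a vec" assume "v \<in> carrier_vec n"
    then have "v = vec n ((!) (map (\<lambda>i. v $ i) [0..<n]))" by (intro eq_vecI) auto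
    then show "v \<in> (\<lambda>xs. vec n ((!) xs)) ` (UNIV :: 'a list set)" by blast
  qed
qed simp

lemma finite_bounded_int_vecs: "finite {v \<in> carrier_vec n. \<forall>i<n. \<bar>v $ i\<bar> \<le> (B::int)}"
proof (rule finite_subset)
  show "{v \<in> carrier_vec n. \<forall>i<n. \<bar>v $ i\<bar> \<le> B} \<subseteq> (\<lambda>f. vec n f) ` ({..<n} \<rightarrow>\<^sub>E {-B..B})"
  proof
    fix v assume v: "v \<in> {v \<in> carrier_vec n. \<forall>i<n. \<bar>v $ i\<bar> \<le> B}"
    then have "v = vec n (\<lambda>i\<in>{..<n}. v $ i)" by (intro eq_vecI) auto
    moreover have "(\<lambda>i\<in>{..<n}. v $ i) \<in> {..<n} \<rightarrow>\<^sub>E {-B..B}" using v by (auto simp: abs_le_iff)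
    ultimately show "v \<in> (\<lambda>f. vec n f) ` ({..<n} \<rightarrow>\<^sub>E {-B..B})" by blast
  qed
qed (auto intro: finite_PiE)

locale dimension =
  fixes n :: nat
  assumes n_pos: "n > 0"
begin

abbreviation SL :: "int mat monoid" where "SL \<equiv> SL_int n"

sublocale SL: group SL by (rule group_special_linear_group)

lemma SL_simps: "g \<in> carrier SL \<longleftrightarrow> g \<in> carrier_mat n n \<and> det g = 1" "g \<otimes>\<^bsub>SL\<^esub> h = g * h" "\<one>\<^bsub>SL\<^esub> = 1\<^sub>m n"
  by (auto simp: special_linear_group_def)

text \<open>The action of the transpose of \<open>g\<close> on covectors, which are functions whose
  values below \<open>n\<close> matter.\<close>

definition tr :: "int mat \<Rightarrow> (nat \<Rightarrow> real) \<Rightarrow> nat \<Rightarrow> real" where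
  "tr g h l = (\<Sum>m<n. real_of_int (g $$ (m, l)) * h m)"

text \<open>\<open>form t\<close> is the linear map given by the matrix \<open>1 + t m m\<^sup>T\<close> where \<open>m = (1, t, t\<^sup>2, \<dots>)\<close>, and
  \<open>phi t g v\<close> is the functional \<open>q(v, \<cdot>)\<close> for the translate \<open>q\<close> of that form by \<open>g\<close>.\<close>

definition form :: "real \<Rightarrow> (nat \<Rightarrow> real) \<Rightarrow> nat \<Rightarrow> real" where
  "form t z j = z j + t ^ Suc j * (\<Sum>l<n. t ^ l * z l)"

definition phi :: "real \<Rightarrow> int mat \<Rightarrow> (nat \<Rightarrow> real) \<Rightarrow> nat \<Rightarrow> real" where
  "phi t g v i = (\<Sum>j<n. real_of_int (g $$ (i, j)) * form t (tr g v) j)"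

lemma form_pairing:
  "(\<Sum>j<n. h j * form t z j) = (\<Sum>j<n. h j * z j) + t * (\<Sum>j<n. t ^ j * h j) * (\<Sum>l<n. t ^ l * z l)"
  by (simp add: form_def distrib_left sum.distrib sum_distrib_left sum_distrib_right mult_ac)

lemma phi_pairing: "(\<Sum>i<n. h i * phi t g v i) = (\<Sum>j<n. tr g h j * form t (tr g v) j)"
  unfolding phi_def tr_def sum_distrib_left sum_distrib_right by (subst sum.swap) (simp add: mult_ac)

lemma tr_mult:
  assumes "g \<in> carrier_mat n n" "h \<in> carrier_mat n n" "l < n"
  shows "tr (g * h) v l = tr h (tr g v) l"
proof -
  have "tr (g * h) v l = (\<Sum>m<n. \<Sum>k<n. real_of_int (g $$ (m, k)) * real_of_int (h $$ (k, l)) * v m)"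
    unfolding tr_def by (rule sum.cong) (auto simp: mult_mat_nth[OF assms(1,2)] assms(3) sum_distrib_right)
  also have "\<dots> = tr h (tr g v) l"
    unfolding tr_def sum_distrib_left by (subst sum.swap) (simp add: mult_ac)
  finally show ?thesis .
qed

lemma tr_one: "l < n \<Longrightarrow> tr (1\<^sub>m n) v l = v l"
proof -
  assume l: "l < n"
  have "tr (1\<^sub>m n) v l = (\<Sum>m<n. if m = l then v m else 0)"
    unfolding tr_def by (rule sum.cong) (auto simp: l)
  then show ?thesis using l by simp
qed

lemma form_cong: "(\<And>l. l < n \<Longrightarrow> z l = z' l) \<Longrightarrow> j < n \<Longrightarrow> form t z j = form t z' j"
  unfolding form_def by (intro arg_cong2[where f = "(+)"] arg_cong2[where f = "(*)"] sum.cong) auto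

lemma tr_cong: "(\<And>m. m < n \<Longrightarrow> v m = v' m) \<Longrightarrow> tr g v l = tr g v' l"
  unfolding tr_def by (rule sum.cong) auto

lemma tr_inv:
  assumes "g \<in> carrier SL"
  shows "\<exists>g'\<in>carrier SL. \<forall>v. \<forall>l<n. tr g' (tr g v) l = v l"
proof (intro bexI allI impI)
  show "inv\<^bsub>SL\<^esub> g \<in> carrier SL" using assms by simp
  have c: "g \<in> carrier_mat n n" "inv\<^bsub>SL\<^esub> g \<in> carrier_mat n n" "g * inv\<^bsub>SL\<^esub> g = 1\<^sub>m n"
    using assms SL.inv_closed[OF assms] SL.r_inv[OF assms] by (auto simp: SL_simps)
  show "tr (inv\<^bsub>SL\<^esub> g) (tr g v) l = v l" if "l < n" for v l
    using tr_mult[OF c(1,2) that, of v] tr_one[OF that] c(3) by simp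
qed

lemma tr_nonzero:
  assumes "g \<in> carrier SL" "\<exists>i<n. v i \<noteq> 0"
  shows "\<exists>i<n. tr g v i \<noteq> 0"
proof (rule ccontr)
  assume a: "\<not> (\<exists>i<n. tr g v i \<noteq> 0)"
  obtain g' where g': "\<forall>v. \<forall>l<n. tr g' (tr g v) l = v l" using tr_inv[OF assms(1)] by blast
  have "v l = 0" if "l < n" for l
    using g'[rule_format, OF that, of v] a by (simp add: tr_def)
  then show False using assms(2) by blast
qed

text \<open>By \<open>form_pairing\<close> the pairing is a polynomial in \<open>t\<close>: the
  constant \<open>h z\<close> plus \<open>t\<close> times the product of the polynomials with
  coefficients \<open>h\<close> and \<open>z\<close>. That product is nonzero even if
  \<open>h z = 0\<close>, so each pair excludes finitely many \<open>t\<close>, and an interval is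
  uncountable.\<close>

lemma generic_parameter:
  assumes C: "countable C" and nz: "\<And>h z. (h, z) \<in> C \<Longrightarrow> (\<exists>i<n. h i \<noteq> 0) \<and> (\<exists>i<n. z i \<noteq> 0)"
    and \<delta>: "\<delta> > 0"
  obtains t where "0 < t" "t < \<delta>" "\<And>h z. (h, z) \<in> C \<Longrightarrow> (\<Sum>j<n. h j * form t z j) \<noteq> 0"
proof -
  define q where "q h = (\<Sum>i<n. monom (h i) i)" for h :: "nat \<Rightarrow> real"
  have q0: "q h \<noteq> 0" if "\<exists>i<n. h i \<noteq> 0" for h
    using that coeff_sum_monom_lessThan[of h n] unfolding q_def by (metis coeff_0)
  have qp: "poly (q h) t = (\<Sum>j<n. t ^ j * h j)" for h t by (simp add: q_def poly_sum poly_monom mult.commute)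
  define p where "p hz = pCons (\<Sum>j<n. fst hz j * snd hz j) (q (fst hz) * q (snd hz))" for hz :: "(nat \<Rightarrow> real) \<times> (nat \<Rightarrow> real)"
  have "countable (\<Union>hz\<in>C. {t. poly (p hz) t = 0})"
  proof (rule countable_UN[OF C])
    fix hz assume "hz \<in> C"
    then have "p hz \<noteq> 0" using q0 nz[of "fst hz" "snd hz"] by (simp add: p_def)
    then show "countable {t. poly (p hz) t = 0}" by (simp add: poly_roots_finite countable_finite)
  qed
  then obtain t where t: "t \<in> {0<..<\<delta>}" "t \<notin> (\<Union>hz\<in>C. {t. poly (p hz) t = 0})"
    using uncountable_open_interval[of 0 \<delta>] \<delta> countable_subset by (metis subsetI)
  show thesis
  proof
    show "0 < t" "t < \<delta>" using t by auto
    fix h z assume "(h, z) \<in> C"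
    then have "poly (p (h, z)) t \<noteq> 0" using t by auto
    then show "(\<Sum>j<n. h j * form t z j) \<noteq> 0"
      by (simp add: form_pairing p_def qp mult_ac)
  qed
qed

text \<open>A normal vector of a hyperplane through the vectors \<open>y i\<close>. The choice
  depends only on the values of \<open>y\<close> on \<open>T\<close>, so it is unaffected when later
  parameters are chosen.\<close>

definition annihilator :: "nat set \<Rightarrow> (nat \<Rightarrow> nat \<Rightarrow> real) \<Rightarrow> nat \<Rightarrow> real" where
  "annihilator T y = (SOME h. (\<exists>r<n. h r \<noteq> 0) \<and> (\<forall>i\<in>T. (\<Sum>r<n. h r * y i r) = 0))"

lemma annihilator:
  assumes T: "finite T" "card T < n"
  shows "(\<exists>r<n. annihilator T y r \<noteq> 0)" "i \<in> T \<Longrightarrow> (\<Sum>r<n. annihilator T y r * y i r) = 0"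
proof -
  obtain e where e: "bij_betw e {..<card T} T" using ex_bij_betw_nat_finite[OF T(1)] by (auto simp: atLeast0LessThan)
  \<comment> \<open>The rows from \<open>card T\<close> on are 0, and there is at least one of them,
    so the matrix is singular.\<close>
  define A where "A = mat n n (\<lambda>(r, c). if r < card T then y (e r) c else 0)"
  have A: "A \<in> carrier_mat n n" by (simp add: A_def)
  have nz: "unit_vec n (n - 1) \<noteq> (0\<^sub>v n :: real vec)"
  proof
    assume "unit_vec n (n - 1) = (0\<^sub>v n :: real vec)"
    then have "(unit_vec n (n - 1) :: real vec) $ (n - 1) = 0" using n_pos by simp
    then show False using n_pos by simp
  qed
  have "transpose_mat A *\<^sub>v unit_vec n (n - 1) = 0\<^sub>v n"
  proof (rule eq_vecI)
    fix i assume "i < dim_vec (0\<^sub>v n :: real vec)"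
    then show "(transpose_mat A *\<^sub>v unit_vec n (n - 1)) $ i = (0\<^sub>v n :: real vec) $ i"
      using n_pos T A by (simp add: A_def scalar_prod_right_unit)
  qed (use A in simp)
  then have "det (transpose_mat A) = 0"
    using det_0_iff_vec_prod_zero[of "transpose_mat A" n] A nz by (metis transpose_carrier_mat unit_vec_carrier)
  then have "det A = 0" using det_transpose[OF A] by simp
  then obtain h where h: "h \<in> carrier_vec n" "h \<noteq> 0\<^sub>v n" "A *\<^sub>v h = 0\<^sub>v n"
    using det_0_iff_vec_prod_zero[OF A] by blast
  have "(\<exists>r<n. h $ r \<noteq> 0) \<and> (\<forall>i\<in>T. (\<Sum>r<n. h $ r * y i r) = 0)"
  proof (intro conjI ballI)
    show "\<exists>r<n. h $ r \<noteq> 0"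
    proof (rule ccontr)
      assume "\<not> (\<exists>r<n. h $ r \<noteq> 0)"
      then have "h = 0\<^sub>v n" using h by (intro eq_vecI) auto
      then show False using h by simp
    qed
    fix i assume "i \<in> T"
    then have "i \<in> e ` {..<card T}" using bij_betw_imp_surj_on[OF e] by simp
    then obtain k where k: "k < card T" "e k = i" by auto
    have "(A *\<^sub>v h) $ k = (\<Sum>r<n. y i r * h $ r)"
      using k T by (subst mult_mat_vec_nth[OF A h(1)]) (auto simp: A_def intro!: sum.cong)
    then show "(\<Sum>r<n. h $ r * y i r) = 0" using h(3) k T by (simp add: mult.commute)
  qed
  from someI[of "\<lambda>h. (\<exists>r<n. h r \<noteq> 0) \<and> (\<forall>i\<in>T. (\<Sum>r<n. h r * y i r) = 0)", OF this]
  show "(\<exists>r<n. annihilator T y r \<noteq> 0)" "i \<in> T \<Longrightarrow> (\<Sum>r<n. annihilator T y r * y i r) = 0"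
    by (auto simp: annihilator_def)
qed

lemma annihilator_cong: "(\<And>i. i \<in> T \<Longrightarrow> y i = y' i) \<Longrightarrow> annihilator T y = annihilator T y'"
  by (simp add: annihilator_def cong: ball_cong)

abbreviation rvec :: "int vec \<Rightarrow> nat \<Rightarrow> real" where "rvec v i \<equiv> real_of_int (v $ i)"

text \<open>The vectors to be put in general position, with \<open>w\<close> in front. Index
  \<open>Suc k\<close> belongs to slot \<open>k\<close>, so the indices up to \<open>k\<close>
  involve only parameters before \<open>ts k\<close>.\<close>

definition position :: "(nat \<Rightarrow> real) \<Rightarrow> int vec \<Rightarrow> int vec \<Rightarrow> int mat list \<Rightarrow> nat \<Rightarrow> nat \<Rightarrow> real" where
  "position ts v w gs i = (case i of 0 \<Rightarrow> rvec w | Suc k \<Rightarrow> phi (ts k) (gs ! k) (rvec v))"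

text \<open>The parameters are chosen one after the other: the functionals of the \<open>k\<close>-th form avoid the
  countably many hyperplanes spanned by \<open>w\<close> and functionals of the earlier forms.\<close>

definition avoids :: "(nat \<Rightarrow> real) \<Rightarrow> nat \<Rightarrow> bool" where
  "avoids ts k \<longleftrightarrow> (\<forall>v w gs T. v \<in> carrier_vec n \<longrightarrow> w \<in> carrier_vec n \<longrightarrow> v \<noteq> 0\<^sub>v n \<longrightarrow>
     set gs \<subseteq> carrier SL \<longrightarrow> length gs = n \<longrightarrow> T \<subseteq> {..k} \<longrightarrow> card T < n \<longrightarrow>
     (\<Sum>r<n. annihilator T (position ts v w gs) r * phi (ts k) (gs ! k) (rvec v) r) \<noteq> 0)"

lemma position_cong: "(\<And>j. j < i \<Longrightarrow> ts j = ts' j) \<Longrightarrow> position ts v w gs i = position ts' v w gs i"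
  by (simp add: position_def split: nat.split)

lemma avoids_cong:
  assumes "\<And>j. j \<le> k \<Longrightarrow> ts j = ts' j"
  shows "avoids ts k \<longleftrightarrow> avoids ts' k"
proof -
  have "annihilator T (position ts v w gs) = annihilator T (position ts' v w gs)" if "T \<subseteq> {..k}" for T v w gs
    using that assms by (intro annihilator_cong position_cong) auto
  then show ?thesis unfolding avoids_def using assms[of k] by auto
qed

lemma ex_generic_parameters:
  assumes \<delta>: "\<delta> > 0"
  shows "k \<le> n \<Longrightarrow> \<exists>ts. \<forall>j<k. 0 < ts j \<and> ts j < \<delta> \<and> avoids ts j"
proof (induction k)
  case (Suc k)
  then obtain ts where ts: "\<And>j. j < k \<Longrightarrow> 0 < ts j \<and> ts j < \<delta> \<and> avoids ts j" by auto
  define X where "X = (carrier_vec n - {0\<^sub>v n} :: int vec set) \<times> (carrier_vec n :: int vec set) \<times>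
     {gs. set gs \<subseteq> carrier SL \<and> length gs = n} \<times> {T. T \<subseteq> {..k} \<and> card T < n}"
  have "countable (carrier SL)"
    using countable_carrier_mat[of n n, where 'a = int] by (rule countable_subset[rotated]) (auto simp: SL_simps)
  then have "countable {gs. set gs \<subseteq> carrier SL \<and> length gs = n}"
    by (rule countable_subset[OF _ countable_lists, rotated]) auto
  moreover have "countable {T. T \<subseteq> {..k} \<and> card T < n}"
    by (rule countable_finite) auto
  ultimately have cX: "countable X"
    unfolding X_def by (intro countable_SIGMA countable_Diff countable_carrier_vec)
  \<comment> \<open>\<open>phi_pairing\<close> moves \<open>gs ! k\<close> into both arguments of
    the form, so every condition on the new parameter comes from a pair that does not depend on
    it.\<close>
  define C where "C = (\<lambda>(v, w, gs, T). (tr (gs ! k) (annihilator T (position ts v w gs)), tr (gs ! k) (rvec v))) ` X"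
  have "countable C" unfolding C_def using cX by (rule countable_image)
  moreover have "(\<exists>i<n. h i \<noteq> 0) \<and> (\<exists>i<n. z i \<noteq> 0)" if hzC: "(h, z) \<in> C" for h z
  proof -
    obtain v w gs T where x: "(v, w, gs, T) \<in> X" and hz: "h = tr (gs ! k) (annihilator T (position ts v w gs))"
      "z = tr (gs ! k) (rvec v)" using hzC by (auto simp: C_def)
    have g: "gs ! k \<in> carrier SL" using x Suc.prems by (auto simp: X_def)
    have T: "finite T" "card T < n" using x by (auto simp: X_def intro: finite_subset)
    have "\<exists>i<n. v $ i \<noteq> 0"
    proof (rule ccontr)
      assume "\<not> (\<exists>i<n. v $ i \<noteq> 0)"
      then have "v = 0\<^sub>v n" using x by (intro eq_vecI) (auto simp: X_def)
      then show False using x by (auto simp: X_def)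
    qed
    then show ?thesis using tr_nonzero[OF g] annihilator(1)[OF T] unfolding hz by auto
  qed
  ultimately obtain t where t: "0 < t" "t < \<delta>" "\<And>h z. (h, z) \<in> C \<Longrightarrow> (\<Sum>j<n. h j * form t z j) \<noteq> 0"
    using generic_parameter[OF _ _ \<delta>, of C] by blast
  let ?ts = "ts(k := t)"
  have "avoids ?ts k"
    unfolding avoids_def
  proof (intro allI impI)
    fix v w :: "int vec" and gs T
    assume a: "v \<in> carrier_vec n" "w \<in> carrier_vec n" "v \<noteq> 0\<^sub>v n" "set gs \<subseteq> carrier SL" "length gs = n"
      "T \<subseteq> {..k}" "card T < n"
    have "annihilator T (position ?ts v w gs) = annihilator T (position ts v w gs)"
      using a(6) by (intro annihilator_cong position_cong) auto
    moreover have "(tr (gs ! k) (annihilator T (position ts v w gs)), tr (gs ! k) (rvec v)) \<in> C"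
      unfolding C_def X_def using a by (auto intro!: image_eqI[of _ _ "(v, w, gs, T)"])
    ultimately show "(\<Sum>r<n. annihilator T (position ?ts v w gs) r * phi (?ts k) (gs ! k) (rvec v) r) \<noteq> 0"
      using t(3) by (simp add: phi_pairing)
  qed
  moreover have "0 < ?ts j \<and> ?ts j < \<delta> \<and> avoids ?ts j" if "j < k" for j
    using ts[OF that] avoids_cong[of j ts ?ts] that by auto
  ultimately have "0 < ?ts j \<and> ?ts j < \<delta> \<and> avoids ?ts j" if "j < Suc k" for j
    using that t by (cases "j = k") (simp_all only: fun_upd_same less_Suc_eq simp_thms)
  then show ?case by blast
qed simp

text \<open>In a relation that omits \<open>i0\<close>, fewer than \<open>n\<close> vectors with
  nonzero coefficients precede the last such vector. They lie in a hyperplane that the last one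
  avoids; if the last one is \<open>w\<close>, the relation says \<open>w = 0\<close>.\<close>

lemma generic_independent:
  assumes ts: "\<And>k. k < n \<Longrightarrow> avoids ts k"
    and v: "v \<in> carrier_vec n" "v \<noteq> 0\<^sub>v n" and w: "w \<in> carrier_vec n" "w \<noteq> 0\<^sub>v n"
    and gs: "set gs \<subseteq> carrier SL" "length gs = n"
    and c: "i0 \<le> n" "c i0 = 0" and rel: "\<And>r. r < n \<Longrightarrow> (\<Sum>i\<le>n. c i * position ts v w gs i r) = 0"
    and i: "i \<le> n"
  shows "c i = 0"
proof (rule ccontr)
  assume ci: "c i \<noteq> 0"
  define J where "J = {i. i \<le> n \<and> c i \<noteq> 0}"
  have J: "finite J" "J \<noteq> {}" "J \<subseteq> {..n} - {i0}" using ci i c by (auto simp: J_def)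
  define j where "j = Max J"
  have j: "j \<in> J" "\<And>i. i \<in> J \<Longrightarrow> i \<le> j" using J by (auto simp: j_def)
  define T where "T = J - {j}"
  have "card J \<le> card ({..n} - {i0})" using J by (intro card_mono) auto
  then have T: "finite T" "card T < n" using J j c n_pos by (auto simp: T_def card_Diff_singleton)
  have cj: "c j \<noteq> 0" "j \<le> n" using j by (auto simp: J_def)
  have split: "(\<Sum>i\<le>n. c i * f i) = c j * f j + (\<Sum>i\<in>T. c i * f i)" for f :: "nat \<Rightarrow> real"
  proof -
    have "(\<Sum>i\<le>n. c i * f i) = (\<Sum>i\<in>J. c i * f i)" by (rule sum.mono_neutral_right) (auto simp: J_def)
    then show ?thesis using J j by (simp add: T_def sum.remove)
  qed
  show False
  proof (cases j)
    case 0
    then have "T = {}" using j by (auto simp: T_def)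
    then have "rvec w r = 0" if "r < n" for r
      using rel[OF that] cj 0 unfolding split by (simp add: position_def)
    then have "w = 0\<^sub>v n" using w by (intro eq_vecI) auto
    then show False using w by simp
  next
    case (Suc k)
    have "T \<subseteq> {..k}" using j Suc by (force simp: T_def)
    then have ne: "(\<Sum>r<n. annihilator T (position ts v w gs) r * position ts v w gs j r) \<noteq> 0"
      using ts[of k] v w gs T Suc cj unfolding avoids_def by (simp add: position_def)
    let ?h = "annihilator T (position ts v w gs)"
    have "0 = (\<Sum>r<n. ?h r * (\<Sum>i\<le>n. c i * position ts v w gs i r))" using rel by simp
    also have "\<dots> = (\<Sum>i\<le>n. c i * (\<Sum>r<n. ?h r * position ts v w gs i r))"
      unfolding sum_distrib_left by (subst sum.swap) (simp add: mult_ac)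
    also have "\<dots> = c j * (\<Sum>r<n. ?h r * position ts v w gs j r)"
      unfolding split using annihilator(2)[OF T] by simp
    finally show False using ne cj by simp
  qed
qed

end

section \<open>The intersection cocycle\<close>

text \<open>\<open>Delta [p\<^sub>0, \<dots>, p\<^sub>m] f\<close> is the alternating sum of \<open>f [q\<^sub>1, \<dots>, q\<^sub>m]\<close> over the choices
  \<open>q\<^sub>k \<in> {p\<^sub>k\<^sub>-\<^sub>1, p\<^sub>k}\<close>. For a product \<open>f\<^sub>1(q\<^sub>1) \<cdots> f\<^sub>m(q\<^sub>m)\<close> it is the cup product of the coboundaries of the
  \<open>f\<^sub>k\<close>, which explains why it is a cocycle.\<close>

fun Delta :: "'g list \<Rightarrow> ('g list \<Rightarrow> real) \<Rightarrow> real" where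
  "Delta [] f = 0"
| "Delta [p] f = f []"
| "Delta (p # q # ps) f = Delta (q # ps) (\<lambda>l. f (q # l) - f (p # l))"

lemma Delta_diff: "Delta ps (\<lambda>l. f l - g l) = Delta ps f - Delta ps g"
proof (induction ps f arbitrary: g rule: Delta.induct)
  case (3 p q ps f)
  have "(\<lambda>l. f (q # l) - g (q # l) - (f (p # l) - g (p # l))) =
    (\<lambda>l. (f (q # l) - f (p # l)) - (g (q # l) - g (p # l)))" by auto
  then show ?case using 3 by simp
qed auto

lemma Delta_zero: "Delta ps (\<lambda>l. 0) = 0"
  using Delta_diff[of ps "\<lambda>_. 0" "\<lambda>_. 0"] by simp

lemma Delta_sum: "Delta ps (\<lambda>l. \<Sum>i\<in>I. f i l) = (\<Sum>i\<in>I. Delta ps (f i))"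
proof (induction I rule: infinite_finite_induct)
  case (insert i I)
  have "Delta ps (\<lambda>l. \<Sum>i\<in>insert i I. f i l) = Delta ps (\<lambda>l. f i l - (0 - (\<Sum>i\<in>I. f i l)))"
    using insert by simp
  then show ?case using insert unfolding Delta_diff Delta_zero by simp
qed (auto simp: Delta_zero)

lemma Delta_cong:
  "(\<And>l. \<lbrakk>set l \<subseteq> set ps; Suc (length l) = length ps\<rbrakk> \<Longrightarrow> f l = g l) \<Longrightarrow> Delta ps f = Delta ps g"
proof (induction ps f arbitrary: g rule: Delta.induct)
  case (3 p q ps f)
  have "Delta (q # ps) (\<lambda>l. f (q # l) - f (p # l)) = Delta (q # ps) (\<lambda>l. g (q # l) - g (p # l))"
    by (rule "3.IH") (intro arg_cong2[where f = "(-)"] "3.prems"; auto)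
  then show ?case by simp
qed auto

lemma Delta_map: "Delta (map h ps) f = Delta ps (\<lambda>l. f (map h l))"
  by (induction ps arbitrary: f rule: induct_list012) auto

text \<open>The two choices for slot \<open>k\<close> enter with opposite signs.\<close>

lemma Delta_independent:
  "\<lbrakk>\<And>l g. f (l[k := g]) = f l; Suc k < length ps\<rbrakk> \<Longrightarrow> Delta ps f = 0"
proof (induction ps f arbitrary: k rule: Delta.induct)
  case (3 p q ps f)
  show ?case
  proof (cases k)
    case 0
    have "f (q # l) = f (p # l)" for l using "3.prems"(1)[of "p # l" q] 0 by simp
    then show ?thesis by (simp add: Delta_zero)
  next
    case (Suc k')
    have "f (q # l[k' := g]) - f (p # l[k' := g]) = f (q # l) - f (p # l)" for l g
      using "3.prems"(1)[of "q # l" g] "3.prems"(1)[of "p # l" g] Suc by simp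
    then show ?thesis using "3.IH"[of k'] "3.prems"(2) Suc by simp
  qed
qed auto

definition del :: "nat \<Rightarrow> 'g list \<Rightarrow> 'g list" where
  "del i xs = take i xs @ drop (Suc i) xs"

lemma del_simps: "del 0 (x # xs) = xs" "del (Suc i) (x # xs) = x # del i xs"
  by (auto simp: del_def)

text \<open>Induction over the first slot: the faces omitting \<open>p\<close> and \<open>q\<close>
  together give \<open>- Delta ps ?g\<close>, and the induction hypothesis for \<open>?g\<close>
  shows that the remaining faces cancel it.\<close>

lemma Delta_cocycle:
  "2 \<le> length ps \<Longrightarrow> (\<Sum>i<length ps. (-1) ^ i * Delta (del i ps) f) = 0"
proof (induction ps f rule: Delta.induct)
  case (3 p q ps f)
  show ?case
  proof (cases ps)
    case Nil
    then show ?thesis by (simp add: del_simps)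
  next
    case (Cons r rest)
    let ?g = "\<lambda>l. f (q # l) - f (p # l)"
    have IH: "(\<Sum>i<length (q # ps). (-1) ^ i * Delta (del i (q # ps)) ?g) = 0"
      using 3 Cons by simp
    then have e: "(\<Sum>i<length ps. (-1) ^ i * Delta (q # del i ps) ?g) = Delta ps ?g"
      unfolding length_Cons sum.lessThan_Suc_shift by (simp add: del_simps sum_negf)
    have "(\<Sum>i<length (p # q # ps). (-1) ^ i * Delta (del i (p # q # ps)) f) =
       Delta (q # ps) f - Delta (p # ps) f + (\<Sum>i<length ps. (-1) ^ i * Delta (q # del i ps) ?g)"
      unfolding length_Cons sum.lessThan_Suc_shift by (simp add: del_simps)
    also have "Delta (q # ps) f - Delta (p # ps) f = - Delta ps ?g"
      unfolding Cons by (simp add: Delta_diff)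
    finally show ?thesis using e by simp
  qed
qed auto

text \<open>Homogeneous coordinates of a bar simplex: its vertices are the partial products. A merge
  deletes a vertex other than the first; omitting the first one amounts to a translation as
  well.\<close>

fun products :: "('g, 'm) monoid_scheme \<Rightarrow> 'g \<Rightarrow> 'g list \<Rightarrow> 'g list" where
  "products G p [] = [p]"
| "products G p (g # gs) = p # products G (p \<otimes>\<^bsub>G\<^esub> g) gs"

lemma length_products: "length (products G p gs) = Suc (length gs)"
  by (induction gs arbitrary: p) auto

lemma products_closed:
  "\<lbrakk>group G; p \<in> carrier G; set gs \<subseteq> carrier G\<rbrakk> \<Longrightarrow> set (products G p gs) \<subseteq> carrier G"
  by (induction gs arbitrary: p) (auto simp: group.is_monoid monoid.m_closed)

lemma products_merge:
  "\<lbrakk>group G; p \<in> carrier G; set gs \<subseteq> carrier G; i < length gs\<rbrakk> \<Longrightarrow>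
   products G p (merge G i gs) = del (Suc i) (products G p gs)"
proof (induction G i gs arbitrary: p rule: merge.induct)
  case (3 G g h gs)
  then interpret group G by simp
  show ?case using 3 by (simp add: m_assoc del_simps)
next
  case (4 G i g gs)
  then interpret group G by simp
  show ?case using 4 by (simp add: del_simps)
qed (auto simp: del_simps)

lemma products_left_mult:
  "\<lbrakk>group G; h \<in> carrier G; p \<in> carrier G; set gs \<subseteq> carrier G\<rbrakk> \<Longrightarrow>
   products G (h \<otimes>\<^bsub>G\<^esub> p) gs = map ((\<otimes>\<^bsub>G\<^esub>) h) (products G p gs)"
proof (induction gs arbitrary: p)
  case (Cons g gs)
  then interpret group G by simp
  show ?case using Cons by (simp add: m_assoc)
qed auto

text \<open>The bound 1/100 keeps every form close to the standard one, as the estimates on the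
  torus require.\<close>

locale generic_forms = dimension +
  fixes ts :: "nat \<Rightarrow> real"
  assumes ts_bounds: "k < n \<Longrightarrow> 0 < ts k \<and> ts k < 1 / 100"
    and ts_avoids: "k < n \<Longrightarrow> avoids ts k"
begin

definition cols :: "int vec \<Rightarrow> int mat list \<Rightarrow> real mat" where
  "cols v gs = mat n n (\<lambda>(i, k). phi (ts k) (gs ! k) (rvec v) i)"

definition K :: "int vec \<times> int vec \<Rightarrow> int mat list \<Rightarrow> real" where
  "K \<omega> gs = cone_count (cols (fst \<omega>) gs) (map_vec real_of_int (snd \<omega>))"

definition SLs :: "int mat list set" where
  "SLs = {gs. set gs \<subseteq> carrier SL \<and> length gs = n}"

definition pairs :: "(int vec \<times> int vec) set" where
  "pairs = {(v, w). v \<in> carrier_vec n \<and> w \<in> carrier_vec n \<and> (\<Sum>i<n. v $ i * w $ i) = 1}"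

lemma pairs_nonzero:
  assumes "(v, w) \<in> pairs"
  shows "v \<noteq> 0\<^sub>v n" "w \<noteq> 0\<^sub>v n" "\<exists>i<n. rvec v i \<noteq> 0" "\<exists>i<n. rvec w i \<noteq> 0"
proof -
  have s: "(\<Sum>i<n. v $ i * w $ i) \<noteq> 0" using assms by (simp add: pairs_def)
  then obtain i where i: "i < n" "v $ i * w $ i \<noteq> 0" by (metis (no_types, lifting) lessThan_iff sum.neutral)
  then show "v \<noteq> 0\<^sub>v n" "w \<noteq> 0\<^sub>v n" "\<exists>i<n. rvec v i \<noteq> 0" "\<exists>i<n. rvec w i \<noteq> 0" by auto
qed

lemma cols_carrier: "cols v gs \<in> carrier_mat n n"
  by (simp add: cols_def)

lemma cols_mult:
  "\<lbrakk>x \<in> carrier_vec n; i < n\<rbrakk> \<Longrightarrow>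
   (cols v gs *\<^sub>v x) $ i = (\<Sum>k<n. x $ k * phi (ts k) (gs ! k) (rvec v) i)"
  by (subst mult_mat_vec_nth[OF cols_carrier]) (auto simp: cols_def mult.commute intro!: sum.cong)

text \<open>Two cases of \<open>generic_independent\<close>: a relation between the columns omits
  \<open>w\<close>, and one with \<open>w\<close> in place of column \<open>j\<close> omits the
  position \<open>Suc j\<close>.\<close>

lemma cols_generic:
  assumes vw: "(v, w) \<in> pairs" and gs: "gs \<in> SLs"
  shows "det (cols v gs) \<noteq> 0"
    and "j < n \<Longrightarrow> det (replace_col (cols v gs) (map_vec real_of_int w) j) \<noteq> 0"
proof -
  have vwc: "v \<in> carrier_vec n" "w \<in> carrier_vec n" using vw by (auto simp: pairs_def)
  note indep = generic_independent[OF ts_avoids vwc(1) pairs_nonzero(1)[OF vw] vwc(2) pairs_nonzero(2)[OF vw], of gs]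
  have gs': "set gs \<subseteq> carrier SL" "length gs = n" using gs by (auto simp: SLs_def)
  have shift: "(\<Sum>i\<le>n. f i) = f 0 + (\<Sum>k<n. f (Suc k))" for f :: "nat \<Rightarrow> real"
    unfolding lessThan_Suc_atMost[symmetric] sum.lessThan_Suc_shift ..
  show "det (cols v gs) \<noteq> 0"
  proof
    assume "det (cols v gs) = 0"
    then obtain u where u: "u \<in> carrier_vec n" "u \<noteq> 0\<^sub>v n" "cols v gs *\<^sub>v u = 0\<^sub>v n"
      using det_0_iff_vec_prod_zero[OF cols_carrier] by blast
    define c where "c i = (case i of 0 \<Rightarrow> 0 | Suc k \<Rightarrow> u $ k)" for i
    have "c i = 0" if "i \<le> n" for i
    proof (rule indep[OF _ gs', of 0 c])
      fix r assume r: "r < n"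
      show "(\<Sum>i\<le>n. c i * position ts v w gs i r) = 0"
        using cols_mult[OF u(1) r, of v gs] u(3) r by (simp add: shift c_def position_def)
    qed (use that in \<open>auto simp: c_def\<close>)
    from this[of "Suc k" for k] have "u $ k = 0" if "k < n" for k using that by (simp add: c_def)
    then have "u = 0\<^sub>v n" using u by (intro eq_vecI) auto
    then show False using u by simp
  qed
  assume j: "j < n"
  let ?B = "replace_col (cols v gs) (map_vec real_of_int w) j"
  have B: "?B \<in> carrier_mat n n" using replace_col_carrier[OF cols_carrier] .
  show "det ?B \<noteq> 0"
  proof
    assume "det ?B = 0"
    then obtain u where u: "u \<in> carrier_vec n" "u \<noteq> 0\<^sub>v n" "?B *\<^sub>v u = 0\<^sub>v n"
      using det_0_iff_vec_prod_zero[OF B] by blast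
    define c where "c i = (case i of 0 \<Rightarrow> u $ j | Suc k \<Rightarrow> if k = j then 0 else u $ k)" for i
    have c0: "c i = 0" if "i \<le> n" for i
    proof (rule indep[OF _ gs', of "Suc j" c])
      fix r assume r: "r < n"
      have "0 = (?B *\<^sub>v u) $ r" using u r by simp
      also have "\<dots> = (\<Sum>k<n. (if k = j then rvec w r * u $ j else 0) +
          (if k = j then 0 else u $ k) * phi (ts k) (gs ! k) (rvec v) r)"
        unfolding mult_mat_vec_nth[OF B u(1) r] using r vwc
        by (intro sum.cong) (auto simp: replace_col_def cols_def)
      also have "\<dots> = rvec w r * u $ j + (\<Sum>k<n. (if k = j then 0 else u $ k) * phi (ts k) (gs ! k) (rvec v) r)"
        using j by (simp add: sum.distrib)
      finally show "(\<Sum>i\<le>n. c i * position ts v w gs i r) = 0"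
        by (simp add: shift c_def position_def mult.commute)
    qed (use that j in \<open>auto simp: c_def\<close>)
    have "u $ k = 0" if "k < n" for k
      using c0[of "Suc k"] c0[of 0] that by (cases "k = j") (auto simp: c_def)
    then have "u = 0\<^sub>v n" using u by (intro eq_vecI) auto
    then show False using u by simp
  qed
qed

section \<open>Finiteness of the set of contributing pairs\<close>

lemma form_self_pairing_ge:
  assumes "k < n" shows "(\<Sum>j<n. z j * form (ts k) z j) \<ge> (\<Sum>j<n. (z j)\<^sup>2)"
  using ts_bounds[OF assms] by (simp add: form_pairing power2_eq_square mult.assoc)

lemma sum_squares_pos: "\<exists>i<n. z i \<noteq> 0 \<Longrightarrow> (\<Sum>j<n. (z j)\<^sup>2) > (0::real)"
  by (auto intro!: sum_pos2)

lemma K_solution: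
  assumes \<omega>: "(v, w) \<in> pairs" and "K (v, w) gs \<noteq> 0"
  obtains x where "\<And>k. k < n \<Longrightarrow> x k > 0"
    "\<And>i. i < n \<Longrightarrow> rvec w i = (\<Sum>k<n. x k * phi (ts k) (gs ! k) (rvec v) i)"
proof -
  obtain y where y: "y \<in> carrier_vec n" "cols v gs *\<^sub>v y = map_vec real_of_int w" "\<forall>i<n. y $ i > 0"
    using assms(2) cols_carrier[of v gs] unfolding K_def cone_count_def by (auto split: if_splits)
  have wc: "w \<in> carrier_vec n" using \<omega> by (simp add: pairs_def)
  have s: "rvec w i = (\<Sum>k<n. y $ k * phi (ts k) (gs ! k) (rvec v) i)" if "i < n" for i
    using cols_mult[OF y(1) that, of v gs] y(2) that wc by simp
  show thesis by (rule that[of "\<lambda>k. y $ k"]) (use y s in auto)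
qed

text \<open>Pair the expression for \<open>w\<close> with \<open>v\<close>, and use
  \<open>v w = 1\<close>. The resulting normalisation of the weights \<open>x k\<close> drives both
  the finiteness of the support and the bound on \<open>w $ 0\<close> over the torus.\<close>

lemma K_pairing:
  assumes \<omega>: "(v, w) \<in> pairs"
    and x: "\<And>i. i < n \<Longrightarrow> rvec w i = (\<Sum>k<n. x k * phi (ts k) (gs ! k) (rvec v) i)"
  shows "(\<Sum>k<n. x k * (\<Sum>j<n. tr (gs ! k) (rvec v) j * form (ts k) (tr (gs ! k) (rvec v)) j)) = 1"
proof -
  have "1 = (\<Sum>i<n. rvec v i * rvec w i)"
    using \<omega> by (simp add: pairs_def flip: of_int_mult of_int_sum)
  also have "\<dots> = (\<Sum>i<n. rvec v i * (\<Sum>k<n. x k * phi (ts k) (gs ! k) (rvec v) i))"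
    by (rule sum.cong) (auto simp: x)
  also have "\<dots> = (\<Sum>k<n. x k * (\<Sum>i<n. rvec v i * phi (ts k) (gs ! k) (rvec v) i))"
    unfolding sum_distrib_left by (subst sum.swap) (simp add: mult_ac)
  finally show ?thesis by (simp add: phi_pairing)
qed

lemma tr_int: "\<exists>z::int. tr g (rvec v) l = real_of_int z"
  by (rule exI[of _ "\<Sum>m<n. g $$ (m, l) * v $ m"]) (simp add: tr_def)

lemma ex_common_bound: "\<exists>C\<ge>1. \<forall>k<n. \<forall>i<n. \<forall>j<n. \<bar>h k i j\<bar> \<le> (C::real)"
proof -
  let ?X = "insert 1 ((\<lambda>(k, i, j). \<bar>h k i j\<bar>) ` ({..<n} \<times> {..<n} \<times> {..<n}))"
  have "\<bar>h k i j\<bar> \<le> Max ?X" if "k < n" "i < n" "j < n" for k i j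
    using that by (intro Max_ge) (auto intro!: image_eqI[of _ _ "(k, i, j)"])
  moreover have "1 \<le> Max ?X" by (intro Max_ge) auto
  ultimately show ?thesis by blast
qed

text \<open>The weights satisfy a normalisation in terms of \<open>q_k(v, v)\<close>, which is at
  least the squared norm of \<open>z k\<close>; since \<open>z k\<close> is integral, this dominates
  its 1-norm \<open>a k\<close>. That bounds \<open>w\<close>. As \<open>w\<close> has an entry of
  absolute value at least 1, the weights cannot be too small, and this bounds
  \<open>v\<close>.\<close>

lemma finite_K_support:
  assumes gs: "gs \<in> SLs"
  shows "finite {\<omega> \<in> pairs. K \<omega> gs \<noteq> 0}"
proof -
  obtain C0 where C0: "C0 \<ge> 1" "\<And>k i j. \<lbrakk>k < n; i < n; j < n\<rbrakk> \<Longrightarrow> \<bar>real_of_int (gs ! k $$ (i, j))\<bar> \<le> C0"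
    using ex_common_bound[of "\<lambda>k i j. real_of_int (gs ! k $$ (i, j))"] by auto
  define C where "C = n * C0"
  have C1: "C \<ge> 1" using C0(1) n_pos mult_mono[of 1 "real n" 1 C0] by (simp add: C_def)
  have C: "(\<Sum>j<n. \<bar>real_of_int (gs ! k $$ (i, j))\<bar>) \<le> C" if "k < n" "i < n" for i k
    using sum_bounded_above[of "{..<n}" "\<lambda>j. \<bar>real_of_int (gs ! k $$ (i, j))\<bar>" C0] C0(2)[OF that]
    by (simp add: C_def)
  have "\<forall>k<n. \<exists>g'\<in>carrier SL. \<forall>v. \<forall>l<n. tr g' (tr (gs ! k) v) l = v l"
    using gs nth_mem tr_inv unfolding SLs_def by blast
  then obtain g' where g': "\<And>k v l. \<lbrakk>k < n; l < n\<rbrakk> \<Longrightarrow> tr (g' k) (tr (gs ! k) v) l = v l" by metis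
  obtain C' where C'1: "C' \<ge> 1" and C': "\<And>k m l. \<lbrakk>k < n; m < n; l < n\<rbrakk> \<Longrightarrow> \<bar>real_of_int (g' k $$ (m, l))\<bar> \<le> C'"
    using ex_common_bound[of "\<lambda>k m l. real_of_int (g' k $$ (m, l))"] by auto
  let ?V = "{v \<in> carrier_vec n. \<forall>i<n. \<bar>v $ i\<bar> \<le> \<lceil>2 * C * C' * n\<rceil>}"
  let ?W = "{w \<in> carrier_vec n. \<forall>i<n. \<bar>w $ i\<bar> \<le> \<lceil>2 * C\<rceil>}"
  have "{\<omega> \<in> pairs. K \<omega> gs \<noteq> 0} \<subseteq> ?V \<times> ?W"
  proof
    fix \<omega> assume a: "\<omega> \<in> {\<omega> \<in> pairs. K \<omega> gs \<noteq> 0}"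
    obtain v w where \<omega>: "\<omega> = (v, w)" by (cases \<omega>)
    have vw: "(v, w) \<in> pairs" "K (v, w) gs \<noteq> 0" using a \<omega> by auto
    obtain x where x: "\<And>k. k < n \<Longrightarrow> x k > 0"
      "\<And>i. i < n \<Longrightarrow> rvec w i = (\<Sum>k<n. x k * phi (ts k) (gs ! k) (rvec v) i)"
      using K_solution[OF vw] by blast
    define z where "z k = tr (gs ! k) (rvec v)" for k
    define a where "a k = (\<Sum>l<n. \<bar>z k l\<bar>)" for k
    define s where "s k = (\<Sum>l<n. (z k l)\<^sup>2)" for k
    have a0: "a k \<ge> 0" for k by (auto simp: a_def intro: sum_nonneg)
    have as: "a k \<le> s k" for k
      unfolding a_def s_def
    proof (rule sum_mono)
      fix l
      obtain y :: int where y: "z k l = real_of_int y" using tr_int z_def by metis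
      have "\<bar>y\<bar> \<le> y\<^sup>2" using self_le_power[of "\<bar>y\<bar>" 2] by (cases "y = 0") auto
      then have "real_of_int \<bar>y\<bar> \<le> real_of_int (y\<^sup>2)" by (simp only: of_int_le_iff)
      then show "\<bar>z k l\<bar> \<le> (z k l)\<^sup>2" by (simp add: y)
    qed
    have a2: "(a k)\<^sup>2 \<le> n * s k" for k
      using Cauchy_Schwarz_ineq_sum[of "\<lambda>_. 1" "\<lambda>l. \<bar>z k l\<bar>" "{..<n}"] by (simp add: a_def s_def)
    have xs: "(\<Sum>k<n. x k * s k) \<le> 1"
    proof -
      have "(\<Sum>k<n. x k * s k) \<le> (\<Sum>k<n. x k * (\<Sum>j<n. z k j * form (ts k) (z k) j))"
        using x(1) form_self_pairing_ge by (intro sum_mono mult_left_mono) (auto simp: s_def less_imp_le)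
      then show ?thesis using K_pairing[OF vw(1) x(2)] by (simp add: z_def)
    qed
    have form_le: "\<bar>form (ts k) (z k) j\<bar> \<le> 2 * a k" if "k < n" "j < n" for k j
    proof -
      have t: "0 \<le> ts k" "ts k \<le> 1" using ts_bounds[OF that(1)] by auto
      have "\<bar>\<Sum>l<n. ts k ^ l * z k l\<bar> \<le> (\<Sum>l<n. \<bar>ts k ^ l * z k l\<bar>)" by (rule sum_abs)
      also have "\<dots> \<le> a k"
        unfolding a_def using t by (intro sum_mono) (auto simp: abs_mult power_le_one mult_left_le_one_le)
      finally have "\<bar>ts k ^ Suc j * (\<Sum>l<n. ts k ^ l * z k l)\<bar> \<le> a k"
        using t power_le_one[OF t, of "Suc j"] mult_mono[of "\<bar>ts k ^ Suc j\<bar>" 1 _ "a k"]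
        by (simp add: abs_mult)
      moreover have "\<bar>z k j\<bar> \<le> a k"
        unfolding a_def using that by (intro member_le_sum) auto
      ultimately show ?thesis by (simp add: form_def)
    qed
    have phi_le: "\<bar>phi (ts k) (gs ! k) (rvec v) i\<bar> \<le> 2 * C * a k" if "k < n" "i < n" for k i
    proof -
      have "\<bar>phi (ts k) (gs ! k) (rvec v) i\<bar> \<le> (\<Sum>j<n. \<bar>real_of_int (gs ! k $$ (i, j)) * form (ts k) (z k) j\<bar>)"
        unfolding phi_def z_def by (rule sum_abs)
      also have "\<dots> \<le> (\<Sum>j<n. \<bar>real_of_int (gs ! k $$ (i, j))\<bar> * (2 * a k))"
        unfolding abs_mult using form_le[OF that(1)] by (intro sum_mono mult_left_mono) auto
      also have "\<dots> \<le> C * (2 * a k)"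
        unfolding sum_distrib_right[symmetric] using C[OF that] a0 by (intro mult_right_mono) auto
      finally show ?thesis by simp
    qed
    have w_le: "\<bar>rvec w i\<bar> \<le> 2 * C * (\<Sum>k<n. x k * a k)" if "i < n" for i
    proof -
      have "\<bar>rvec w i\<bar> \<le> (\<Sum>k<n. \<bar>x k * phi (ts k) (gs ! k) (rvec v) i\<bar>)"
        unfolding x(2)[OF that] by (rule sum_abs)
      also have "\<dots> \<le> (\<Sum>k<n. x k * (2 * C * a k))"
        unfolding abs_mult using phi_le[OF _ that] x(1) by (intro sum_mono mult_mono) (auto simp: less_imp_le abs_of_pos)
      finally show ?thesis by (simp add: sum_distrib_left mult_ac)
    qed
    have xa: "(\<Sum>k<n. x k * a k) \<le> 1"
    proof -
      have "(\<Sum>k<n. x k * a k) \<le> (\<Sum>k<n. x k * s k)"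
        using as x(1) by (intro sum_mono mult_left_mono) (auto simp: less_imp_le)
      then show ?thesis using xs by simp
    qed
    have "w \<in> ?W"
    proof -
      have "\<bar>w $ i\<bar> \<le> \<lceil>2 * C\<rceil>" if "i < n" for i
      proof -
        have "\<bar>rvec w i\<bar> \<le> 2 * C" using w_le[OF that] mult_left_mono[OF xa, of "2 * C"] C1 by linarith
        then show ?thesis by linarith
      qed
      then show ?thesis using vw by (auto simp: pairs_def)
    qed
    moreover have "v \<in> ?V"
    proof -
      have "\<bar>v $ l\<bar> \<le> \<lceil>2 * C * C' * n\<rceil>" if l: "l < n" for l
      proof -
        have av: "\<bar>rvec v l\<bar> \<le> C' * a k" if k: "k < n" for k
        proof -
          have "\<bar>rvec v l\<bar> = \<bar>\<Sum>m<n. real_of_int (g' k $$ (m, l)) * z k m\<bar>"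
            using g'[OF k l, of "rvec v"] by (simp add: tr_def z_def)
          also have "\<dots> \<le> (\<Sum>m<n. C' * \<bar>z k m\<bar>)"
            using C'[OF k _ l] by (intro order_trans[OF sum_abs] sum_mono) (auto simp: abs_mult mult_right_mono)
          finally show ?thesis by (simp add: a_def sum_distrib_left)
        qed
        obtain i where i: "i < n" "rvec w i \<noteq> 0" using pairs_nonzero[OF vw(1)] by blast
        then have "1 \<le> \<bar>rvec w i\<bar>" by (simp flip: of_int_abs)
        then have one: "1 \<le> 2 * C * (\<Sum>k<n. x k * a k)" using w_le[OF i(1)] by simp
        \<comment> \<open>The lower bound \<open>one\<close> is multiplied by the entry of
          \<open>v\<close>, which is at most \<open>C' * a k\<close> for every \<open>k\<close>. The
          sum becomes quadratic in \<open>a k\<close>, so that \<open>a2\<close> and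
          \<open>xs\<close> apply.\<close>
        have "\<bar>rvec v l\<bar> \<le> \<bar>rvec v l\<bar> * (2 * C * (\<Sum>k<n. x k * a k))"
          using mult_left_mono[OF one, of "\<bar>rvec v l\<bar>"] by simp
        also have "\<dots> = 2 * C * (\<Sum>k<n. x k * (a k * \<bar>rvec v l\<bar>))"
          by (simp add: sum_distrib_left mult_ac)
        also have "\<dots> \<le> 2 * C * (\<Sum>k<n. x k * (a k * (C' * a k)))"
          using av x(1) a0 C1 by (intro mult_left_mono sum_mono) (auto simp: less_imp_le)
        also have "\<dots> = 2 * C * C' * (\<Sum>k<n. x k * (a k)\<^sup>2)"
          by (simp add: sum_distrib_left mult_ac power2_eq_square)
        also have "\<dots> \<le> 2 * C * C' * (\<Sum>k<n. x k * (n * s k))"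
          using a2 x(1) C1 C'1 by (intro mult_left_mono sum_mono) (auto simp: less_imp_le)
        also have "\<dots> = 2 * C * C' * n * (\<Sum>k<n. x k * s k)"
          by (simp add: sum_distrib_left mult_ac)
        also have "\<dots> \<le> 2 * C * C' * n" using xs C1 C'1 by (simp add: mult_left_le)
        finally show ?thesis by linarith
      qed
      then show ?thesis using vw by (auto simp: pairs_def)
    qed
    ultimately show "\<omega> \<in> ?V \<times> ?W" using \<omega> by simp
  qed
  then show ?thesis by (rule finite_subset) (rule finite_cartesian_product[OF finite_bounded_int_vecs finite_bounded_int_vecs])
qed

end

lemma cone_count_left_mult:
  assumes h: "h \<in> carrier_mat n n" "det h = 1" and A: "A \<in> carrier_mat n n" and w: "w \<in> carrier_vec n"
  shows "cone_count (h * A) (h *\<^sub>v w) = cone_count A w"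
proof -
  have iff: "h * A *\<^sub>v x = h *\<^sub>v w \<longleftrightarrow> A *\<^sub>v x = w" if x: "x \<in> carrier_vec n" for x
  proof -
    have "h * A *\<^sub>v x = h *\<^sub>v (A *\<^sub>v x)" using h A x by (intro assoc_mult_mat_vec) auto
    moreover have "A *\<^sub>v x \<in> carrier_vec n" using A x by simp
    ultimately show ?thesis using mult_mat_vec_cancel[OF h(1), of "A *\<^sub>v x" w] h(2) w by auto
  qed
  have e: "(\<exists>x\<in>carrier_vec n. h * A *\<^sub>v x = h *\<^sub>v w \<and> (\<forall>i<n. x $ i > 0)) \<longleftrightarrow>
      (\<exists>x\<in>carrier_vec n. A *\<^sub>v x = w \<and> (\<forall>i<n. x $ i > 0))"
    using iff by blast
  have dims: "dim_col (h * A) = n" "dim_col A = n" "det (h * A) = det A"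
    using h A by (auto simp: det_mult)
  show ?thesis unfolding cone_count_def dims e ..
qed

definition residue :: "int vec \<Rightarrow> int vec" where
  "residue w = map_vec (\<lambda>x. x mod 4) w"

section \<open>The orbit of classes modulo 4 and the total count\<close>

context generic_forms
begin

lemma residue_mult_residue:
  assumes g: "g \<in> carrier_mat n n" and w: "w \<in> carrier_vec n"
  shows "residue (g *\<^sub>v residue w) = residue (g *\<^sub>v w)"
proof (rule eq_vecI)
  fix i assume "i < dim_vec (residue (g *\<^sub>v w))"
  then have i: "i < n" using g by (simp add: residue_def)
  have rw: "residue w \<in> carrier_vec n" using w by (simp add: residue_def)
  have "(\<Sum>j<n. g $$ (i, j) * (w $ j mod 4)) mod 4 = (\<Sum>j<n. g $$ (i, j) * w $ j) mod 4"
    by (subst (1 2) mod_sum_eq[symmetric]) (simp add: mod_mult_right_eq)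
  then show "residue (g *\<^sub>v residue w) $ i = residue (g *\<^sub>v w) $ i"
    using i g w rw mult_mat_vec_nth[OF g rw i] mult_mat_vec_nth[OF g w i] by (simp add: residue_def)
qed (use g in \<open>simp add: residue_def\<close>)

definition act :: "int mat \<Rightarrow> int vec \<Rightarrow> int vec" where
  "act g s = residue (g *\<^sub>v s)"

text \<open>In the affine hyperplane \<open>w $ 0 = 1\<close>, and for \<open>n\<close> at most 4,
  the other entries decrease strictly between 4 and 0. This is the interior of one simplex in the
  standard triangulation of the cube of side 4.\<close>

definition base :: "int vec" where
  "base = vec n (\<lambda>j. if j = 0 then 1 else 4 - int j)"

definition orbit :: "int vec set" where
  "orbit = (\<lambda>g. residue (g *\<^sub>v base)) ` carrier SL"

lemma base_carrier: "base \<in> carrier_vec n"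
  by (simp add: base_def)

lemma act_residue: "\<lbrakk>g \<in> carrier SL; w \<in> carrier_vec n\<rbrakk> \<Longrightarrow> act g (residue w) = residue (g *\<^sub>v w)"
  by (simp add: act_def residue_mult_residue SL_simps)

lemma mult_SL_vec: "\<lbrakk>g \<in> carrier SL; w \<in> carrier_vec n\<rbrakk> \<Longrightarrow> g *\<^sub>v w \<in> carrier_vec n"
  using mult_mat_vec_carrier[of g n n w] by (simp add: SL_simps)

sublocale orb: transitive_action SL orbit act
proof
  have mv: "(g * h) *\<^sub>v w = g *\<^sub>v (h *\<^sub>v w)" if "g \<in> carrier SL" "h \<in> carrier SL" "w \<in> carrier_vec n" for g h w
    using that by (intro assoc_mult_mat_vec) (auto simp: SL_simps)
  have orbitE: "\<exists>h\<in>carrier SL. s = residue (h *\<^sub>v base)" if "s \<in> orbit" for s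
    using that by (auto simp: orbit_def)
  have "orbit \<subseteq> (\<lambda>w. w) ` {w \<in> carrier_vec n. \<forall>i<n. \<bar>w $ i\<bar> \<le> 4}"
    using mult_SL_vec[OF _ base_carrier] by (auto simp: orbit_def residue_def SL_simps)
  then show "finite orbit" by (rule finite_surj[OF finite_bounded_int_vecs])
  show "orbit \<noteq> {}" using SL.one_closed by (auto simp: orbit_def)
  show "act g s \<in> orbit" if g: "g \<in> carrier SL" and s: "s \<in> orbit" for g s
  proof -
    obtain h where h: "h \<in> carrier SL" "s = residue (h *\<^sub>v base)" using orbitE[OF s] by blast
    then have "act g s = residue ((g * h) *\<^sub>v base)"
      using g by (simp add: act_residue mult_SL_vec base_carrier mv)
    moreover have "g * h \<in> carrier SL" using SL.m_closed[OF g h(1)] by (simp add: SL_simps(2))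
    ultimately show ?thesis by (auto simp: orbit_def)
  qed
  show "act \<one>\<^bsub>SL\<^esub> s = s" if s: "s \<in> orbit" for s
  proof -
    obtain h where h: "h \<in> carrier SL" "s = residue (h *\<^sub>v base)" using orbitE[OF s] by blast
    note c = mult_SL_vec[OF h(1) base_carrier]
    show ?thesis
      unfolding h(2) act_residue[OF SL.one_closed c] unfolding SL_simps(3) one_mult_mat_vec[OF c] ..
  qed
  show act_mult: "act (g \<otimes>\<^bsub>SL\<^esub> h) s = act g (act h s)" if gh: "g \<in> carrier SL" "h \<in> carrier SL" and s: "s \<in> orbit" for g h s
  proof -
    obtain k where k: "k \<in> carrier SL" "s = residue (k *\<^sub>v base)" using orbitE[OF s] by blast
    note c = mult_SL_vec[OF k(1) base_carrier]
    show ?thesis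
      using act_residue[OF SL.m_closed[OF gh] c] act_residue[OF gh(2) c]
        act_residue[OF gh(1) mult_SL_vec[OF gh(2) c]] mv[OF gh c] k by (simp add: SL_simps(2))
  qed
  show "\<exists>g\<in>carrier SL. act g s = t" if s: "s \<in> orbit" and t: "t \<in> orbit" for s t
  proof -
    obtain k where k: "k \<in> carrier SL" "s = residue (k *\<^sub>v base)" using orbitE[OF s] by blast
    obtain h where h: "h \<in> carrier SL" "t = residue (h *\<^sub>v base)" using orbitE[OF t] by blast
    have "act (h \<otimes>\<^bsub>SL\<^esub> inv\<^bsub>SL\<^esub> k) s = residue ((h \<otimes>\<^bsub>SL\<^esub> inv\<^bsub>SL\<^esub> k) *\<^sub>v (k *\<^sub>v base))"
      using h k by (simp add: act_residue mult_SL_vec base_carrier)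
    also have "(h \<otimes>\<^bsub>SL\<^esub> inv\<^bsub>SL\<^esub> k) *\<^sub>v (k *\<^sub>v base) = (h \<otimes>\<^bsub>SL\<^esub> inv\<^bsub>SL\<^esub> k \<otimes>\<^bsub>SL\<^esub> k) *\<^sub>v base"
      using mv[of "h \<otimes>\<^bsub>SL\<^esub> inv\<^bsub>SL\<^esub> k" k base] h k base_carrier by (simp add: SL_simps(2)[symmetric])
    also have "h \<otimes>\<^bsub>SL\<^esub> inv\<^bsub>SL\<^esub> k \<otimes>\<^bsub>SL\<^esub> k = h" using h k by (simp add: SL.m_assoc)
    finally show ?thesis using h k by (intro bexI[of _ "h \<otimes>\<^bsub>SL\<^esub> inv\<^bsub>SL\<^esub> k"]) auto
  qed
qed

definition fiber :: "int vec \<Rightarrow> (int vec \<times> int vec) set" where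
  "fiber s = {\<omega> \<in> pairs. residue (snd \<omega>) = s}"

definition F :: "int mat list \<Rightarrow> int vec \<Rightarrow> real" where
  "F gs s = (\<Sum>\<omega>\<in>{\<omega> \<in> fiber s. K \<omega> gs \<noteq> 0}. K \<omega> gs)"

lemma F_eq_sum:
  assumes "finite \<Theta>" "\<Theta> \<subseteq> fiber s" "{\<omega> \<in> fiber s. K \<omega> gs \<noteq> 0} \<subseteq> \<Theta>"
  shows "F gs s = (\<Sum>\<omega>\<in>\<Theta>. K \<omega> gs)"
  unfolding F_def using assms by (intro sum.mono_neutral_left) auto

text \<open>\<open>F\<close> sums over a support that varies with the tuple. Over a common finite
  index set \<open>Delta\<close> commutes with the sum.\<close>

lemma F_common_support:
  assumes "finite \<G>" "\<G> \<subseteq> SLs"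
  obtains \<Theta> where "finite \<Theta>" "\<Theta> \<subseteq> fiber s" "\<And>gs. gs \<in> \<G> \<Longrightarrow> F gs s = (\<Sum>\<omega>\<in>\<Theta>. K \<omega> gs)"
proof -
  let ?T = "\<Union>gs\<in>\<G>. {\<omega> \<in> fiber s. K \<omega> gs \<noteq> 0}"
  have "finite {\<omega> \<in> fiber s. K \<omega> gs \<noteq> 0}" if "gs \<in> \<G>" for gs
    using finite_K_support[of gs] assms(2) that
    by (rule_tac finite_subset[of _ "{\<omega> \<in> pairs. K \<omega> gs \<noteq> 0}"]) (auto simp: fiber_def)
  then have fin: "finite ?T" using assms(1) by blast
  show thesis
    by (rule that[of ?T], rule fin, blast, rule F_eq_sum[OF fin]) blast+
qed

text \<open>The auxiliary vector and the common support must serve all lists at which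
  \<open>Delta\<close> evaluates, with either head, so these are collected in a finite set.\<close>

lemma finite_two_heads:
  assumes q: "q \<in> carrier SL" "q' \<in> carrier SL" and ps: "set ps \<subseteq> carrier SL" "length ps = n"
  obtains \<G> where "finite \<G>" "\<G> \<subseteq> SLs"
    "\<And>r l. \<lbrakk>r \<in> {q, q'}; set l \<subseteq> set ps; Suc (length l) = length ps\<rbrakk> \<Longrightarrow> r # l \<in> \<G>"
proof
  let ?L = "{l. set l \<subseteq> set ps \<and> length l = n - 1}"
  have "finite ?L" by (simp add: finite_lists_length_eq)
  then show "finite ((#) q ` ?L \<union> (#) q' ` ?L)" by blast
  show "(#) q ` ?L \<union> (#) q' ` ?L \<subseteq> SLs" using q ps n_pos unfolding SLs_def by force
  show "r # l \<in> (#) q ` ?L \<union> (#) q' ` ?L"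
    if "r \<in> {q, q'}" "set l \<subseteq> set ps" "Suc (length l) = length ps" for r l
  proof -
    have "l \<in> ?L" using that(2,3) ps by simp
    then show ?thesis using that(1) by blast
  qed
qed

text \<open>An auxiliary vector splits the count into terms \<open>E k\<close> that do not depend on
  entry \<open>k\<close>. \<open>Delta\<close> kills the terms with \<open>k > 0\<close>, and
  \<open>E 0\<close> does not see the head.\<close>

lemma Delta_K_independent:
  assumes \<omega>: "\<omega> \<in> pairs" and q: "q \<in> carrier SL" "q' \<in> carrier SL"
    and ps: "set ps \<subseteq> carrier SL" "length ps = n"
  shows "Delta ps (\<lambda>l. K \<omega> (q # l)) = Delta ps (\<lambda>l. K \<omega> (q' # l))"
proof -
  obtain v w where vw: "\<omega> = (v, w)" by (cases \<omega>)
  obtain \<G> where fin: "finite \<G>" and SLs: "\<G> \<subseteq> SLs"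
    and \<G>: "\<And>r l. \<lbrakk>r \<in> {q, q'}; set l \<subseteq> set ps; Suc (length l) = length ps\<rbrakk> \<Longrightarrow> r # l \<in> \<G>"
    using finite_two_heads[OF q ps] by blast
  have vwp: "(v, w) \<in> pairs" using \<omega> vw by simp
  have wc: "w \<in> carrier_vec n" "v \<in> carrier_vec n" using vwp by (auto simp: pairs_def)
  let ?w = "map_vec real_of_int w"
  obtain x where x: "x \<in> carrier_vec n"
    "\<And>A. A \<in> cols v ` \<G> \<Longrightarrow> cone_count A ?w = (\<Sum>k<n. cone_count (replace_col A x k) ?w)"
  proof (rule cone_count_auxiliary_vector[OF n_pos finite_imageI[OF fin]])
    show "A \<in> carrier_mat n n \<and> det A \<noteq> 0" if "A \<in> cols v ` \<G>" for A
      using that cols_generic(1)[OF vwp] SLs cols_carrier by auto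
    show "?w \<in> carrier_vec n" "map_vec real_of_int v \<in> carrier_vec n" using wc by auto
    show "det (replace_col A ?w j) \<noteq> 0" if "A \<in> cols v ` \<G>" "j < n" for A j
      using that cols_generic(2)[OF vwp] SLs by auto
    show "map_vec real_of_int v \<bullet> col A j > 0" if A: "A \<in> cols v ` \<G>" and j: "j < n" for A j
    proof -
      obtain gs where gs: "gs \<in> SLs" "A = cols v gs" using A SLs by auto
      have g: "gs ! j \<in> carrier SL" using gs j by (auto simp: SLs_def)
      have "map_vec real_of_int v \<bullet> col A j = (\<Sum>i<n. rvec v i * phi (ts j) (gs ! j) (rvec v) i)"
        using j wc by (auto simp: gs cols_def scalar_prod_def atLeast0LessThan intro!: sum.cong)
      also have "\<dots> \<ge> (\<Sum>i<n. (tr (gs ! j) (rvec v) i)\<^sup>2)"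
        unfolding phi_pairing by (rule form_self_pairing_ge[OF j])
      finally show ?thesis
        using sum_squares_pos[OF tr_nonzero[OF g pairs_nonzero(3)[OF vwp]]] by linarith
    qed
  qed blast
  define E where "E k gs = cone_count (replace_col (cols v gs) x k) ?w" for k gs
  have E: "E k (gs[k := g]) = E k gs" for k gs g
  proof -
    have "replace_col (cols v (gs[k := g])) x k = replace_col (cols v gs) x k"
    proof (rule eq_matI)
      fix i j assume "i < dim_row (replace_col (cols v gs) x k)" "j < dim_col (replace_col (cols v gs) x k)"
      then show "replace_col (cols v (gs[k := g])) x k $$ (i, j) = replace_col (cols v gs) x k $$ (i, j)"
        by (cases "j = k") (auto simp: replace_col_def cols_def)
    qed (auto simp: replace_col_def cols_def)
    then show ?thesis by (simp add: E_def)
  qed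
  have D: "Delta ps (\<lambda>l. K \<omega> (r # l)) = Delta ps (\<lambda>l. E 0 (q # l))" if r: "r \<in> {q, q'}" for r
  proof -
    have "Delta ps (\<lambda>l. K \<omega> (r # l)) = Delta ps (\<lambda>l. \<Sum>k<n. E k (r # l))"
    proof (rule Delta_cong)
      fix l assume "set l \<subseteq> set ps" "Suc (length l) = length ps"
      then have "r # l \<in> \<G>" by (rule \<G>[OF r])
      then show "K \<omega> (r # l) = (\<Sum>k<n. E k (r # l))" using x(2)[of "cols v (r # l)"] by (simp add: K_def E_def vw)
    qed
    also have "\<dots> = (\<Sum>k<n. Delta ps (\<lambda>l. E k (r # l)))" by (rule Delta_sum)
    also have "\<dots> = (\<Sum>k<n. if k = 0 then Delta ps (\<lambda>l. E 0 (q # l)) else 0)"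
    proof (rule sum.cong)
      fix k assume k: "k \<in> {..<n}"
      show "Delta ps (\<lambda>l. E k (r # l)) = (if k = 0 then Delta ps (\<lambda>l. E 0 (q # l)) else 0)"
      proof (cases k)
        case 0
        have "E 0 (r # l) = E 0 (q # l)" for l using E[of 0 "q # l" r] by simp
        then show ?thesis using 0 by simp
      next
        \<comment> \<open>Behind the head, entry \<open>Suc j\<close> is entry \<open>j\<close> of
          \<open>l\<close>, on which \<open>Delta\<close> acts.\<close>
        case (Suc j)
        have "E (Suc j) (r # l[j := g]) = E (Suc j) (r # l)" for l g using E[of "Suc j" "r # l" g] by simp
        then show ?thesis using Suc k ps by (simp add: Delta_independent[of "\<lambda>l. E (Suc j) (r # l)" j])
      qed
    qed simp
    finally show ?thesis using n_pos by simp
  qed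
  show ?thesis using D[of q] D[of q'] by simp
qed

lemma Delta_F_independent:
  assumes q: "q \<in> carrier SL" "q' \<in> carrier SL" and ps: "set ps \<subseteq> carrier SL" "length ps = n"
  shows "Delta ps (\<lambda>l. F (q # l) s) = Delta ps (\<lambda>l. F (q' # l) s)"
proof -
  obtain \<G> where fin: "finite \<G>" and SLs: "\<G> \<subseteq> SLs"
    and \<G>: "\<And>r l. \<lbrakk>r \<in> {q, q'}; set l \<subseteq> set ps; Suc (length l) = length ps\<rbrakk> \<Longrightarrow> r # l \<in> \<G>"
    using finite_two_heads[OF q ps] by blast
  obtain \<Theta> where \<Theta>: "finite \<Theta>" "\<Theta> \<subseteq> fiber s" "\<And>gs. gs \<in> \<G> \<Longrightarrow> F gs s = (\<Sum>\<omega>\<in>\<Theta>. K \<omega> gs)"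
    using F_common_support[OF fin SLs] by blast
  have "Delta ps (\<lambda>l. F (r # l) s) = (\<Sum>\<omega>\<in>\<Theta>. Delta ps (\<lambda>l. K \<omega> (r # l)))" if "r \<in> {q, q'}" for r
    unfolding Delta_sum[symmetric] using that by (intro Delta_cong \<Theta>(3) \<G>)
  moreover have "Delta ps (\<lambda>l. K \<omega> (q # l)) = Delta ps (\<lambda>l. K \<omega> (q' # l))" if "\<omega> \<in> \<Theta>" for \<omega>
    using that \<Theta>(2) by (intro Delta_K_independent q ps) (auto simp: fiber_def)
  ultimately show ?thesis by (auto intro!: sum.cong)
qed

section \<open>Equivariance and the cocycle relation\<close>

definition dual_mult :: "int mat \<Rightarrow> int vec \<Rightarrow> int vec" where
  "dual_mult h v = transpose_mat h *\<^sub>v v"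

lemma rvec_dual_mult:
  assumes "h \<in> carrier SL" "v \<in> carrier_vec n" "l < n"
  shows "rvec (dual_mult h v) l = tr h (rvec v) l"
  using assms by (auto simp: dual_mult_def tr_def scalar_prod_def SL_simps atLeast0LessThan intro!: sum.cong)

text \<open>The vector for \<open>h * g\<close> at \<open>v\<close> is \<open>h\<close> applied to
  the vector for \<open>g\<close> at the transpose of \<open>h\<close> applied to \<open>v\<close>.
  So \<open>h\<close> multiplies all columns, and its determinant 1 preserves the sign.\<close>

lemma K_equivariant:
  assumes h: "h \<in> carrier SL" and gs: "gs \<in> SLs" and v: "v \<in> carrier_vec n" and w: "w \<in> carrier_vec n"
  shows "K (v, h *\<^sub>v w) (map ((*) h) gs) = K (dual_mult h v, w) gs"
proof -
  let ?h = "map_mat real_of_int h"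
  have hc: "h \<in> carrier_mat n n" "det h = 1" using h by (auto simp: SL_simps)
  have "cols v (map ((*) h) gs) = ?h * cols (dual_mult h v) gs"
  proof (rule eq_matI)
    fix i k assume "i < dim_row (?h * cols (dual_mult h v) gs)" "k < dim_col (?h * cols (dual_mult h v) gs)"
    then have ik: "i < n" "k < n" using hc by (auto simp: cols_def)
    have "gs ! k \<in> carrier SL" and kl: "k < length gs" using gs ik by (auto simp: SLs_def)
    then have g: "gs ! k \<in> carrier_mat n n" "k < length gs" by (simp_all add: SL_simps(1))
    let ?z = "form (ts k) (tr (gs ! k) (rvec (dual_mult h v)))"
    have f: "form (ts k) (tr (h * gs ! k) (rvec v)) j = ?z j" if "j < n" for j
    proof (rule form_cong[OF _ that])
      fix l assume l: "l < n"
      show "tr (h * gs ! k) (rvec v) l = tr (gs ! k) (rvec (dual_mult h v)) l"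
        unfolding tr_mult[OF hc(1) g(1) l] by (rule tr_cong) (simp add: rvec_dual_mult[OF h v])
    qed
    have "cols v (map ((*) h) gs) $$ (i, k) = (\<Sum>j<n. real_of_int ((h * gs ! k) $$ (i, j)) * ?z j)"
      using ik g by (auto simp: cols_def phi_def f intro!: sum.cong)
    also have "\<dots> = (\<Sum>j<n. \<Sum>m<n. real_of_int (h $$ (i, m)) * (real_of_int (gs ! k $$ (m, j)) * ?z j))"
      by (rule sum.cong) (auto simp: mult_mat_nth[OF hc(1) g(1)] ik sum_distrib_right mult.assoc)
    also have "\<dots> = (\<Sum>m<n. real_of_int (h $$ (i, m)) * phi (ts k) (gs ! k) (rvec (dual_mult h v)) m)"
      unfolding phi_def sum_distrib_left by (rule sum.swap)
    also have "\<dots> = (?h * cols (dual_mult h v) gs) $$ (i, k)"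
      using ik hc by (auto simp: scalar_prod_def cols_def atLeast0LessThan intro!: sum.cong)
    finally show "cols v (map ((*) h) gs) $$ (i, k) = (?h * cols (dual_mult h v) gs) $$ (i, k)" .
  qed (use hc in \<open>auto simp: cols_def\<close>)
  moreover have "map_vec real_of_int (h *\<^sub>v w) = ?h *\<^sub>v map_vec real_of_int w"
    using hc w by (rule_tac of_int_hom.mult_mat_vec_hom) auto
  moreover have "det ?h = 1" using hc by simp
  ultimately show ?thesis
    using cone_count_left_mult[of ?h n "cols (dual_mult h v) gs" "map_vec real_of_int w"] hc w cols_carrier
    by (simp add: K_def)
qed

text \<open>\<open>h\<close> acts on \<open>w\<close> directly and on \<open>v\<close> by the
  inverse transpose. This preserves \<open>v w\<close> and maps the fiber over \<open>s\<close>
  bijectively to the fiber over \<open>act h s\<close>.\<close>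

lemma F_equivariant:
  assumes h: "h \<in> carrier SL" and gs: "gs \<in> SLs" and s: "s \<in> orbit"
  shows "F (map ((*) h) gs) (act h s) = F gs s"
proof -
  let ?i = "inv\<^bsub>SL\<^esub> h"
  have i: "?i \<in> carrier SL" using h by simp
  have hm: "h \<in> carrier_mat n n" "?i \<in> carrier_mat n n" using h i by (auto simp: SL_simps)
  have inv: "h * ?i = 1\<^sub>m n" "?i * h = 1\<^sub>m n"
    using SL.r_inv[OF h] SL.l_inv[OF h] by (simp_all add: SL_simps)
  have w1: "?i *\<^sub>v (h *\<^sub>v w) = w" "h *\<^sub>v (?i *\<^sub>v w) = w" if "w \<in> carrier_vec n" for w
    using that assoc_mult_mat_vec[OF hm(2,1) that] assoc_mult_mat_vec[OF hm(1,2) that] inv by auto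
  have v1: "dual_mult ?i (dual_mult h v) = v" "dual_mult h (dual_mult ?i v) = v" if "v \<in> carrier_vec n" for v
  proof -
    have "transpose_mat ?i * transpose_mat h = 1\<^sub>m n" "transpose_mat h * transpose_mat ?i = 1\<^sub>m n"
      unfolding transpose_mult[OF hm(1,2), symmetric] transpose_mult[OF hm(2,1), symmetric] inv by simp_all
    then show "dual_mult ?i (dual_mult h v) = v" "dual_mult h (dual_mult ?i v) = v"
      unfolding dual_mult_def
      using assoc_mult_mat_vec[of "transpose_mat ?i" n n "transpose_mat h" n v]
        assoc_mult_mat_vec[of "transpose_mat h" n n "transpose_mat ?i" n v] hm that by auto
  qed
  have dc: "dual_mult k v \<in> carrier_vec n" if "k \<in> carrier SL" "v \<in> carrier_vec n" for k v
    using that mult_mat_vec_carrier[of "transpose_mat k" n n v] by (simp add: dual_mult_def SL_simps)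
  have pair: "(\<Sum>j<n. dual_mult k v $ j * w $ j) = (\<Sum>j<n. v $ j * (k *\<^sub>v w) $ j)"
    if "k \<in> carrier SL" "v \<in> carrier_vec n" "w \<in> carrier_vec n" for k v w
  proof -
    have km: "k \<in> carrier_mat n n" using that by (simp add: SL_simps)
    have "dual_mult k v \<bullet> w = v \<bullet> (k *\<^sub>v w)"
      unfolding dual_mult_def
      using transpose_vec_mult_scalar[OF km that(3,2)] .
    then show ?thesis using that dc[OF that(1,2)] km by (simp add: scalar_prod_def atLeast0LessThan)
  qed
  have K: "K (dual_mult ?i v, h *\<^sub>v w) (map ((*) h) gs) = K (v, w) gs"
    if "v \<in> carrier_vec n" "w \<in> carrier_vec n" for v w
    using K_equivariant[OF h gs dc[OF i that(1)] that(2)] v1 that by simp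
  let ?f = "\<lambda>(v, w). (dual_mult ?i v, h *\<^sub>v w)" and ?b = "\<lambda>(v, w). (dual_mult h v, ?i *\<^sub>v w)"
  have sc: "s \<in> carrier_vec n" using s mult_SL_vec[OF _ base_carrier] by (auto simp: orbit_def residue_def)
  have f: "?f \<omega> \<in> fiber (act h s)" if "\<omega> \<in> fiber s" for \<omega>
  proof -
    obtain v w where \<omega>: "\<omega> = (v, w)" by (cases \<omega>)
    have vw: "v \<in> carrier_vec n" "w \<in> carrier_vec n" "(\<Sum>i<n. v $ i * w $ i) = 1" "residue w = s"
      using that by (auto simp: \<omega> fiber_def pairs_def)
    have "(\<Sum>j<n. dual_mult ?i v $ j * (h *\<^sub>v w) $ j) = 1"
      using pair[OF i vw(1) mult_SL_vec[OF h vw(2)]] w1[OF vw(2)] vw by simp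
    then show ?thesis
      using vw dc[OF i vw(1)] mult_SL_vec[OF h vw(2)] act_residue[OF h vw(2)]
      by (simp add: \<omega> fiber_def pairs_def)
  qed
  have b: "?b \<omega> \<in> fiber s" if "\<omega> \<in> fiber (act h s)" for \<omega>
  proof -
    obtain v w where \<omega>: "\<omega> = (v, w)" by (cases \<omega>)
    have vw: "v \<in> carrier_vec n" "w \<in> carrier_vec n" "(\<Sum>i<n. v $ i * w $ i) = 1" "residue w = act h s"
      using that by (auto simp: \<omega> fiber_def pairs_def)
    have "(\<Sum>j<n. dual_mult h v $ j * (?i *\<^sub>v w) $ j) = 1"
      using pair[OF h vw(1) mult_SL_vec[OF i vw(2)]] w1[OF vw(2)] vw by simp
    moreover have "residue (?i *\<^sub>v w) = s"
      using act_residue[OF i vw(2)] vw(4) orb.act_inv_act[OF h s] by simp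
    ultimately show ?thesis
      using vw dc[OF h vw(1)] mult_SL_vec[OF i vw(2)] by (simp add: \<omega> fiber_def pairs_def)
  qed
  have car: "fst \<omega> \<in> carrier_vec n" "snd \<omega> \<in> carrier_vec n" if "\<omega> \<in> fiber t" for \<omega> t
    using that by (auto simp: fiber_def pairs_def)
  show ?thesis
    unfolding F_def
  proof (rule sum.reindex_bij_witness[of _ ?f ?b])
    fix \<omega> assume a: "\<omega> \<in> {\<omega> \<in> fiber (act h s). K \<omega> (map ((*) h) gs) \<noteq> 0}"
    then have \<omega>: "\<omega> \<in> fiber (act h s)" by simp
    note c = car[OF \<omega>]
    show fb: "?f (?b \<omega>) = \<omega>" using v1 w1 c by (cases \<omega>) simp
    have bc: "fst (?b \<omega>) \<in> carrier_vec n" "snd (?b \<omega>) \<in> carrier_vec n" using car[OF b[OF \<omega>]] by auto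
    show e: "K (?b \<omega>) gs = K \<omega> (map ((*) h) gs)"
      using K[OF bc] fb by (simp add: split_beta)
    show "?b \<omega> \<in> {\<omega> \<in> fiber s. K \<omega> gs \<noteq> 0}" using b[OF \<omega>] e a by simp
  next
    fix \<omega> assume a: "\<omega> \<in> {\<omega> \<in> fiber s. K \<omega> gs \<noteq> 0}"
    then have \<omega>: "\<omega> \<in> fiber s" by simp
    note c = car[OF \<omega>]
    show "?b (?f \<omega>) = \<omega>" using v1 w1 c by (cases \<omega>) simp
    have "K (?f \<omega>) (map ((*) h) gs) = K \<omega> gs" using K[OF c] by (simp add: split_beta)
    then show "?f \<omega> \<in> {\<omega> \<in> fiber (act h s). K \<omega> (map ((*) h) gs) \<noteq> 0}" using f[OF \<omega>] a by simp
  qed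
qed

definition cocycle :: "int mat list \<Rightarrow> int vec \<Rightarrow> real" where
  "cocycle gs s = Delta (products SL \<one>\<^bsub>SL\<^esub> gs) (\<lambda>l. F (\<one>\<^bsub>SL\<^esub> # l) s)"

theorem cocycle:
  assumes gs: "gs \<in> tuples SL n" and s: "s \<in> orbit"
  shows "orb.d cocycle gs s = 0"
proof -
  have gsc: "set gs \<subseteq> carrier SL" "length gs = n" using gs by (auto simp: tuples_def)
  then obtain g gs' where g: "gs = g # gs'" using n_pos by (cases gs) auto
  have gc: "g \<in> carrier SL" "set gs' \<subseteq> carrier SL" using gsc g by auto
  let ?P = "products SL \<one>\<^bsub>SL\<^esub> gs"
  have P: "set ?P \<subseteq> carrier SL" "length ?P = Suc n"
    using products_closed[OF SL.is_group SL.one_closed gsc(1)] gsc by (auto simp: length_products)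
  have delP: "set (del i ?P) \<subseteq> carrier SL" "length (del i ?P) = n" if "i \<le> n" for i
    using P that set_take_subset[of i ?P] set_drop_subset[of "Suc i" ?P] by (auto simp: del_def)
  have first: "cocycle (tl gs) (act (inv\<^bsub>SL\<^esub> g) s) = Delta (del 0 ?P) (\<lambda>l. F (\<one>\<^bsub>SL\<^esub> # l) s)"
  proof -
    let ?Q = "products SL \<one>\<^bsub>SL\<^esub> gs'"
    have Q: "set ?Q \<subseteq> carrier SL" "length ?Q = n"
      using products_closed[OF SL.is_group SL.one_closed gc(2)] gsc g by (auto simp: length_products)
    have PQ: "del 0 ?P = map ((*) g) ?Q"
      using products_left_mult[OF SL.is_group gc(1) SL.one_closed gc(2), unfolded SL.r_one[OF gc(1)]]
      unfolding g products.simps del_simps SL.l_one[OF gc(1)] by (simp add: SL_simps(2)[abs_def])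
    have s': "act (inv\<^bsub>SL\<^esub> g) s \<in> orbit" using orb.act_closed s gc by simp
    have g1: "g * \<one>\<^bsub>SL\<^esub> = g" using gc SL.r_one[OF gc(1)] by (simp add: SL_simps(2))
    have "cocycle (tl gs) (act (inv\<^bsub>SL\<^esub> g) s) = Delta ?Q (\<lambda>l. F (map ((*) g) (\<one>\<^bsub>SL\<^esub> # l)) s)"
      unfolding cocycle_def g list.sel
    proof (rule Delta_cong)
      fix l assume "set l \<subseteq> set ?Q" "Suc (length l) = length ?Q"
      then have "\<one>\<^bsub>SL\<^esub> # l \<in> SLs" using Q by (auto simp: SLs_def)
      from F_equivariant[OF gc(1) this s'] orb.act_act_inv[OF gc(1) s]
      show "F (\<one>\<^bsub>SL\<^esub> # l) (act (inv\<^bsub>SL\<^esub> g) s) = F (map ((*) g) (\<one>\<^bsub>SL\<^esub> # l)) s" by simp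
    qed
    also have "\<dots> = Delta (del 0 ?P) (\<lambda>l. F (g # l) s)" unfolding PQ Delta_map by (simp add: g1)
    also have "\<dots> = Delta (del 0 ?P) (\<lambda>l. F (\<one>\<^bsub>SL\<^esub> # l) s)"
      by (rule Delta_F_independent[OF gc(1) SL.one_closed delP]) simp_all
    finally show ?thesis .
  qed
  have rest: "cocycle (merge SL i gs) s = Delta (del (Suc i) ?P) (\<lambda>l. F (\<one>\<^bsub>SL\<^esub> # l) s)" if "i < n" for i
    using products_merge[OF SL.is_group SL.one_closed gsc(1), of i] that gsc(2) by (simp add: cocycle_def)
  have "0 = (\<Sum>i<Suc n. (-1) ^ i * Delta (del i ?P) (\<lambda>l. F (\<one>\<^bsub>SL\<^esub> # l) s))"
    using Delta_cocycle[of ?P] P n_pos by simp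
  also have "\<dots> = orb.d cocycle gs s"
    unfolding sum.lessThan_Suc_shift orb.d_def using first rest g gsc
    by (simp add: sum_negf)
  finally show ?thesis ..
qed

end

section \<open>Evaluation on the unipotent torus\<close>

context generic_forms
begin

definition U :: "(nat \<Rightarrow> int) \<Rightarrow> int mat" where
  "U \<tau> = mat n n (\<lambda>(r, c). if r = c then 1 else if c = 0 then \<tau> r else 0)"

lemma U_closed: "U \<tau> \<in> carrier SL"
proof -
  have U: "U \<tau> \<in> carrier_mat n n" by (simp add: U_def)
  have "det (U \<tau>) = prod_list (diag_mat (U \<tau>))"
    by (rule det_lower_triangular[OF _ U]) (auto simp: U_def)
  also have "diag_mat (U \<tau>) = replicate n 1"
    by (rule nth_equalityI) (auto simp: diag_mat_def U_def)
  finally show ?thesis using U by (simp add: SL_simps prod_list_replicate)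
qed

lemma sum_U:
  "i < n \<Longrightarrow> (\<Sum>j<n. of_int (U \<tau> $$ (i, j)) * f j) = f i + (if i = 0 then 0 else of_int (\<tau> i) * f 0)"
  for f :: "nat \<Rightarrow> 'a::comm_ring_1"
proof -
  assume i: "i < n"
  have "(\<Sum>j<n. of_int (U \<tau> $$ (i, j)) * f j) =
      (\<Sum>j<n. (if j = i then f i else 0) + (if j = 0 then (if i = 0 then 0 else of_int (\<tau> i) * f 0) else 0))"
    using i by (intro sum.cong) (auto simp: U_def)
  then show ?thesis using i n_pos by (simp add: sum.distrib)
qed

lemma U_carrier: "U \<tau> \<in> carrier_mat n n"
  by (simp add: U_def)

lemma U_mult: "U \<tau> * U \<tau>' = U (\<lambda>r. \<tau> r + \<tau>' r)"
proof (rule eq_matI)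
  fix r c assume "r < dim_row (U (\<lambda>r. \<tau> r + \<tau>' r))" "c < dim_col (U (\<lambda>r. \<tau> r + \<tau>' r))"
  then have rc: "r < n" "c < n" by (auto simp: U_def)
  show "(U \<tau> * U \<tau>') $$ (r, c) = U (\<lambda>r. \<tau> r + \<tau>' r) $$ (r, c)"
    using sum_U[OF rc(1), of \<tau> "\<lambda>k. U \<tau>' $$ (k, c)"] rc
    by (simp add: mult_mat_nth[OF U_carrier U_carrier rc]) (auto simp: U_def)
qed (auto simp: U_def)

lemma tr_U:
  assumes "l < n"
  shows "tr (U \<tau>) v l = v l + (if l = 0 then \<Sum>r\<in>{1..<n}. \<tau> r * v r else 0)"
proof -
  have "tr (U \<tau>) v l = (\<Sum>m<n. (if m = l then v m else 0) + (if l = 0 \<and> m \<noteq> 0 then \<tau> m * v m else 0))"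
    unfolding tr_def using assms by (intro sum.cong) (auto simp: U_def)
  also have "\<dots> = v l + (\<Sum>m<n. if l = 0 \<and> m \<noteq> 0 then \<tau> m * v m else 0)"
    using assms by (simp add: sum.distrib)
  also have "(\<Sum>m<n. if l = 0 \<and> m \<noteq> 0 then \<tau> m * v m else 0) = (if l = 0 then \<Sum>r\<in>{1..<n}. \<tau> r * v r else 0)"
    by (auto intro!: sum.mono_neutral_cong_right)
  finally show ?thesis .
qed

lemma phi_U:
  "i < n \<Longrightarrow> phi t (U \<tau>) v i =
    form t (tr (U \<tau>) v) i + (if i = 0 then 0 else \<tau> i * form t (tr (U \<tau>) v) 0)"
  unfolding phi_def by (rule sum_U)

text \<open>Restricting to translations by multiples of 4 makes the coefficients trivial, so a cycle
  with trivial coefficients can be evaluated at a single class.\<close>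

lemma act_U:
  assumes \<tau>: "\<And>r. 4 dvd \<tau> r" and s: "s \<in> orbit"
  shows "act (U \<tau>) s = s"
proof -
  obtain g where g: "g \<in> carrier SL" "s = residue (g *\<^sub>v base)" using s by (auto simp: orbit_def)
  define w where "w = g *\<^sub>v base"
  have w: "w \<in> carrier_vec n" unfolding w_def by (rule mult_SL_vec[OF g(1) base_carrier])
  have "residue (U \<tau> *\<^sub>v w) = residue w"
  proof (rule eq_vecI)
    fix i assume "i < dim_vec (residue w)"
    then have i: "i < n" using w by (simp add: residue_def)
    have e: "(U \<tau> *\<^sub>v w) $ i = w $ i + (if i = 0 then 0 else \<tau> i * w $ 0)"
      using sum_U[OF i, of \<tau> "\<lambda>j. w $ j"] by (simp add: mult_mat_vec_nth[OF U_carrier w i])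
    obtain k where "\<tau> i = 4 * k" using \<tau> by (auto elim: dvdE)
    then have "(U \<tau> *\<^sub>v w) $ i mod 4 = w $ i mod 4" by (simp add: e mult.assoc)
    then show "residue (U \<tau> *\<^sub>v w) $ i = residue w $ i" using i w U_carrier[of \<tau>] by (simp add: residue_def)
  qed (use w in \<open>simp add: residue_def U_def\<close>)
  then show ?thesis using act_residue[OF U_closed w] g by (simp add: w_def)
qed

text \<open>This is where \<open>\<bar>z\<^sub>0\<bar> < q(z, z)\<close> enters: an intersection with the torus forces \<open>\<bar>w\<^sub>0\<bar> < 1\<close>
  unless \<open>v\<close> is a multiple of the first basis vector.\<close>

lemma form_zero_less:
  assumes k: "k < n" and r: "0 < r" "r < n" and z: "\<bar>z r\<bar> \<ge> 1"
  shows "\<bar>form (ts k) z 0\<bar> < (\<Sum>j<n. z j * form (ts k) z j)"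
proof -
  let ?t = "ts k" and ?L = "\<Sum>l<n. ts k ^ l * z l" and ?Q = "\<Sum>j<n. (z j)\<^sup>2"
  have t: "0 < ?t" "?t < 1 / 100" using ts_bounds[OF k] by auto
  have "(\<Sum>j\<in>{0, r}. (z j)\<^sup>2) \<le> ?Q" using r by (intro sum_mono2) auto
  moreover have "1 \<le> (z r)\<^sup>2" using z by (simp add: abs_le_square_iff[of 1, simplified])
  \<comment> \<open>The 1 gained from entry \<open>r\<close> pays for the constants in both
    applications of \<open>sq\<close> below.\<close>
  ultimately have Q: "(z 0)\<^sup>2 + 1 \<le> ?Q" using r by simp
  have sq: "2 * \<bar>a\<bar> \<le> a\<^sup>2 + 1" for a :: real
    using zero_le_power2[of "\<bar>a\<bar> - 1"] by (simp add: power2_eq_square algebra_simps)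
  have "\<bar>form ?t z 0\<bar> \<le> \<bar>z 0\<bar> + ?t * \<bar>?L\<bar>"
    using t abs_triangle_ineq[of "z 0" "?t * ?L"] by (simp add: form_def abs_mult)
  also have "\<dots> \<le> ?Q / 2 + ?t * ((?L\<^sup>2 + 1) / 2)"
    using sq[of "z 0"] sq[of ?L] Q t by (intro add_mono mult_left_mono) auto
  also have "\<dots> < ?Q + ?t * ?L\<^sup>2"
  proof -
    have "0 \<le> ?t * ?L\<^sup>2" "?t * ((?L\<^sup>2 + 1) / 2) = ?t * ?L\<^sup>2 / 2 + ?t / 2"
      using t by (auto simp: field_simps)
    then show ?thesis using Q t zero_le_power2[of "z 0"] by linarith
  qed
  also have "\<dots> = (\<Sum>j<n. z j * form ?t z j)"
    by (simp add: form_pairing power2_eq_square mult.assoc)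
  finally show ?thesis .
qed

lemma torus_support:
  assumes \<omega>: "(v, w) \<in> pairs" and K: "K (v, w) gs \<noteq> 0"
    and gs: "\<And>k. k < n \<Longrightarrow> \<exists>\<tau>. gs ! k = U \<tau>" and w0: "w $ 0 \<noteq> 0"
  shows "\<And>r. \<lbrakk>0 < r; r < n\<rbrakk> \<Longrightarrow> v $ r = 0" "v $ 0 * w $ 0 = 1"
proof -
  show v0: "v $ r = 0" if r: "0 < r" "r < n" for r
  proof (rule ccontr)
    assume "v $ r \<noteq> 0"
    then have vr: "1 \<le> \<bar>rvec v r\<bar>" by (simp flip: of_int_abs)
    obtain x where x: "\<And>k. k < n \<Longrightarrow> x k > 0"
      "\<And>i. i < n \<Longrightarrow> rvec w i = (\<Sum>k<n. x k * phi (ts k) (gs ! k) (rvec v) i)"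
      using K_solution[OF \<omega> K] by blast
    let ?z = "\<lambda>k. tr (gs ! k) (rvec v)"
    have less: "\<bar>form (ts k) (?z k) 0\<bar> < (\<Sum>j<n. ?z k j * form (ts k) (?z k) j)" if k: "k < n" for k
    proof -
      obtain \<tau> where \<tau>: "gs ! k = U \<tau>" using gs[OF k] by blast
      \<comment> \<open>The transpose of \<open>U \<tau>\<close> changes only entry 0 of a
        covector.\<close>
      have "?z k r = rvec v r" using tr_U[OF r(2)] r(1) by (simp add: \<tau>)
      then show ?thesis using form_zero_less[OF k r, of "?z k"] vr by simp
    qed
    have "phi (ts k) (gs ! k) (rvec v) 0 = form (ts k) (?z k) 0" if k: "k < n" for k
    proof -
      obtain \<tau> where "gs ! k = U \<tau>" using gs[OF k] by blast
      then show ?thesis using phi_U[OF n_pos] by simp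
    qed
    then have "\<bar>rvec w 0\<bar> = \<bar>\<Sum>k<n. x k * form (ts k) (?z k) 0\<bar>"
      unfolding x(2)[OF n_pos] by simp
    also have "\<dots> \<le> (\<Sum>k<n. x k * \<bar>form (ts k) (?z k) 0\<bar>)"
      using x(1) by (intro order_trans[OF sum_abs] sum_mono) (simp add: abs_mult abs_of_pos)
    also have "\<dots> < (\<Sum>k<n. x k * (\<Sum>j<n. ?z k j * form (ts k) (?z k) j))"
      using less x(1) n_pos by (intro sum_strict_mono) auto
    also have "\<dots> = 1" by (rule K_pairing[OF \<omega> x(2)])
    finally show False using w0 by (simp flip: of_int_abs)
  qed
  have "1 = (\<Sum>i<n. v $ i * w $ i)" using \<omega> by (simp add: pairs_def)
  also have "\<dots> = (\<Sum>i<n. if i = 0 then v $ 0 * w $ 0 else 0)" using v0 by (intro sum.cong) auto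
  finally show "v $ 0 * w $ 0 = 1" using n_pos by simp
qed

text \<open>Translation by the vertex of the cube of side 4 whose nonzero coordinates are those in
  \<open>A\<close>.\<close>

definition T :: "nat set \<Rightarrow> int mat" where
  "T A = U (\<lambda>r. if r \<in> A then 4 else 0)"

definition e0 :: "int vec" where "e0 = vec n (\<lambda>i. if i = 0 then 1 else 0)"

lemma T_closed: "T A \<in> carrier SL"
  by (simp add: T_def U_closed)

lemma T_mult: "A \<inter> B = {} \<Longrightarrow> T A * T B = T (A \<union> B)"
  by (auto simp: T_def U_mult fun_eq_iff intro!: arg_cong[of _ _ U])

lemma T_commute: "T A * T B = T B * T A"
  by (simp add: T_def U_mult add.commute)

lemma T_empty: "T {} = \<one>\<^bsub>SL\<^esub>"
  by (auto simp: T_def U_def SL_simps intro!: eq_matI)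

lemma act_T: "s \<in> orbit \<Longrightarrow> act (T A) s = s"
  unfolding T_def by (rule act_U) auto

lemma act_inv_T: "s \<in> orbit \<Longrightarrow> act (inv\<^bsub>SL\<^esub> (T A)) s = s"
  using orb.act_inv_act[OF T_closed, of s A] act_T[of s A] by simp

lemma phi_T:
  assumes "i < n"
  shows "phi t (T A) (rvec e0) i = (if i = 0 then 1 + t else t ^ Suc i + (if i \<in> A then 4 * (1 + t) else 0))"
proof -
  let ?z = "tr (U (\<lambda>r. if r \<in> A then 4 else 0)) (rvec e0)"
  have z: "?z l = (if l = 0 then 1 else 0)" if "l < n" for l
  proof -
    have "(\<Sum>r\<in>{1..<n}. (if r \<in> A then 4 else 0) * rvec e0 r) = 0"
      by (rule sum.neutral) (auto simp: e0_def)
    then show ?thesis using that tr_U[OF that] n_pos by (auto simp: e0_def)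
  qed
  have "(\<Sum>l<n. t ^ l * ?z l) = (\<Sum>l<n. if l = 0 then 1 else 0)"
    by (rule sum.cong) (auto simp: z)
  then have "(\<Sum>l<n. t ^ l * ?z l) = 1" using n_pos by simp
  then have f: "form t ?z j = (if j = 0 then 1 else 0) + t ^ Suc j" if "j < n" for j
    using z[OF that] by (simp add: form_def)
  show ?thesis
    unfolding T_def phi_U[OF assms] f[OF assms] f[OF n_pos] by auto
qed

text \<open>The barycentric coordinates \<open>y\<close> below are those of the point \<open>w\<close> of the affine hyperplane
  \<open>w\<^sub>0 = 1\<close> with respect to vertices close to the points of the lattice \<open>4\<int>\<^sup>n\<^sup>-\<^sup>1\<close>.\<close>

lemma torus_coordinates:
  assumes w: "w \<in> carrier_vec n" "w $ 0 = 1" and As: "length As = n"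
    and x: "\<And>i. i < n \<Longrightarrow> rvec w i = (\<Sum>k<n. x k * phi (ts k) (map T As ! k) (rvec e0) i)"
  defines "y \<equiv> \<lambda>k. x k * (1 + ts k)"
  shows "(\<Sum>k<n. y k) = 1"
    and "\<And>j. \<lbrakk>0 < j; j < n\<rbrakk> \<Longrightarrow> \<bar>rvec w j - 4 * (\<Sum>k<n. if j \<in> As ! k then y k else 0)\<bar> \<le> (\<Sum>k<n. \<bar>y k\<bar>) / 100"
proof -
  have t: "0 < ts k" "ts k < 1 / 100" if "k < n" for k using ts_bounds[OF that] by auto
  have "(\<Sum>k<n. y k) = rvec w 0"
    unfolding x[OF n_pos] y_def using As n_pos by (intro sum.cong) (auto simp: phi_T)
  then show "(\<Sum>k<n. y k) = 1" using w by simp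
  fix j assume j: "0 < j" "j < n"
  have "rvec w j = (\<Sum>k<n. x k * ts k ^ Suc j + 4 * (if j \<in> As ! k then y k else 0))"
    unfolding x[OF j(2)] y_def using As j by (intro sum.cong) (auto simp: phi_T algebra_simps)
  then have "rvec w j - 4 * (\<Sum>k<n. if j \<in> As ! k then y k else 0) = (\<Sum>k<n. x k * ts k ^ Suc j)"
    by (simp add: sum.distrib sum_distrib_left)
  moreover have "\<bar>\<Sum>k<n. x k * ts k ^ Suc j\<bar> \<le> (\<Sum>k<n. \<bar>y k\<bar> / 100)"
  proof (rule order_trans[OF sum_abs], rule sum_mono)
    fix k assume "k \<in> {..<n}"
    then have t: "0 < ts k" "ts k < 1 / 100" using t by auto
    have "ts k ^ Suc j \<le> ts k * 1" using t by (simp add: power_le_one mult_left_le)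
    also have "\<dots> \<le> (1 + ts k) / 100" using t by simp
    finally have "ts k ^ Suc j \<le> (1 + ts k) / 100" .
    then have "\<bar>x k\<bar> * ts k ^ Suc j \<le> \<bar>x k\<bar> * ((1 + ts k) / 100)" by (intro mult_left_mono) auto
    then show "\<bar>x k * ts k ^ Suc j\<bar> \<le> \<bar>y k\<bar> / 100" using t by (simp add: abs_mult y_def)
  qed
  ultimately show "\<bar>rvec w j - 4 * (\<Sum>k<n. if j \<in> As ! k then y k else 0)\<bar> \<le> (\<Sum>k<n. \<bar>y k\<bar>) / 100"
    by (simp add: sum_divide_distrib)
qed

lemma torus_barycentric:
  assumes \<omega>: "(e0, w) \<in> pairs" and w: "w $ 0 = 1" and As: "length As = n" and K: "K (e0, w) (map T As) \<noteq> 0"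
  obtains y where "\<And>k. k < n \<Longrightarrow> y k > 0" "(\<Sum>k<n. y k) = 1"
    "\<And>j. \<lbrakk>0 < j; j < n\<rbrakk> \<Longrightarrow> \<bar>rvec w j - 4 * (\<Sum>k<n. if j \<in> As ! k then y k else 0)\<bar> \<le> 1 / 100"
proof -
  obtain x where x: "\<And>k. k < n \<Longrightarrow> x k > 0"
    "\<And>i. i < n \<Longrightarrow> rvec w i = (\<Sum>k<n. x k * phi (ts k) (map T As ! k) (rvec e0) i)"
    using K_solution[OF \<omega> K] by blast
  define y where "y k = x k * (1 + ts k)" for k
  have wc: "w \<in> carrier_vec n" using \<omega> by (simp add: pairs_def)
  have y: "y k > 0" if "k < n" for k using x(1)[OF that] ts_bounds[OF that] by (simp add: y_def)
  have s: "(\<Sum>k<n. y k) = 1" using torus_coordinates(1)[OF wc w As x(2)] by (simp add: y_def)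
  have "(\<Sum>k<n. \<bar>y k\<bar>) = (\<Sum>k<n. y k)" using y by (intro sum.cong) (auto simp: abs_of_pos)
  then have c: "\<bar>rvec w j - 4 * (\<Sum>k<n. if j \<in> As ! k then y k else 0)\<bar> \<le> 1 / 100" if "0 < j" "j < n" for j
    using torus_coordinates(2)[OF wc w As x(2) that] s unfolding y_def by simp
  show thesis by (rule that[OF y s c])
qed

end

text \<open>For \<open>n \<le> 4\<close> the entries \<open>4 - j\<close> of \<open>base\<close>
  with \<open>0 < j\<close> lie strictly between 0 and 4, so they are reduced and nonzero modulo
  4.\<close>

locale low_dimension = generic_forms +
  assumes n34: "n = 3 \<or> n = 4"
begin

lemma residue_base: "residue base = base"
  using n34 by (auto simp: residue_def base_def intro!: eq_vecI)

lemma base_orbit: "base \<in> orbit"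
  using SL.one_closed residue_base base_carrier
  by (auto simp: orbit_def SL_simps intro!: image_eqI[of _ _ "1\<^sub>m n"])

lemma e0_base_fiber: "(e0, base) \<in> fiber base"
proof -
  have "(\<Sum>i<n. e0 $ i * base $ i) = (\<Sum>i<n. if i = 0 then 1 else 0)"
    by (rule sum.cong) (auto simp: e0_def base_def)
  then show ?thesis
    using residue_base base_carrier n_pos by (simp add: fiber_def pairs_def e0_def)
qed

text \<open>Here \<open>w $ 0\<close> is a unit congruent to 1 modulo 4, hence 1, and
  \<open>v\<close> must be \<open>e0\<close>. The barycentric bounds leave the integers 0 to 4 for
  the other entries of \<open>w\<close>, among which a nonzero class has one representative.\<close>

lemma torus_fiber_base:
  assumes \<omega>: "\<omega> \<in> fiber base" and As: "length As = n" and K: "K \<omega> (map T As) \<noteq> 0"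
  shows "\<omega> = (e0, base)"
proof -
  obtain v w where vw: "\<omega> = (v, w)" by (cases \<omega>)
  have p: "(v, w) \<in> pairs" and r: "residue w = base" using \<omega> vw by (auto simp: fiber_def)
  have c: "v \<in> carrier_vec n" "w \<in> carrier_vec n" using p by (auto simp: pairs_def)
  have rw: "w $ j mod 4 = base $ j" if "j < n" for j
    using arg_cong[OF r, of "\<lambda>u. u $ j"] that c by (simp add: residue_def)
  have w04: "w $ 0 mod 4 = 1" using rw[OF n_pos] n_pos by (simp add: base_def)
  have Tn: "\<exists>\<tau>. map T As ! k = U \<tau>" if "k < n" for k using As that by (auto simp: T_def)
  have K': "K (v, w) (map T As) \<noteq> 0" using K vw by simp
  have "w $ 0 \<noteq> 0" using w04 by auto
  note sup = torus_support[OF p K' Tn this]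
  have "w $ 0 = 1 \<and> v $ 0 = 1" using sup(2) w04 zmult_eq_1_iff[of "v $ 0" "w $ 0"] by auto
  then have w0: "w $ 0 = 1" and v0: "v $ 0 = 1" by auto
  have ve: "v = e0" using c sup(1) v0 by (intro eq_vecI) (auto simp: e0_def)
  obtain y where y: "\<And>k. k < n \<Longrightarrow> y k > 0" "(\<Sum>k<n. y k) = 1"
    "\<And>j. \<lbrakk>0 < j; j < n\<rbrakk> \<Longrightarrow> \<bar>rvec w j - 4 * (\<Sum>k<n. if j \<in> As ! k then y k else 0)\<bar> \<le> 1 / 100"
    using torus_barycentric[OF _ w0 As] p K' ve by blast
  have "w = base"
  proof (rule eq_vecI)
    fix j assume "j < dim_vec base"
    then have j: "j < n" using base_carrier by simp
    show "w $ j = base $ j"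
    proof (cases "j = 0")
      case False
      have "(\<Sum>k<n. if j \<in> As ! k then y k else 0) \<le> (\<Sum>k<n. y k)"
        using y(1) by (intro sum_mono) (auto simp: less_imp_le)
      moreover have "0 \<le> (\<Sum>k<n. if j \<in> As ! k then y k else 0)"
        using y(1) by (intro sum_nonneg) (auto simp: less_imp_le)
      moreover have "\<bar>rvec w j - 4 * (\<Sum>k<n. if j \<in> As ! k then y k else 0)\<bar> \<le> 1 / 100"
        using y(3) False j by simp
      ultimately have "- 1 < rvec w j" "rvec w j < 5"
        using y(2) unfolding abs_le_iff by linarith+
      then have "0 \<le> w $ j" "w $ j \<le> 4" by linarith+
      moreover have "base $ j = 4 - int j" "1 \<le> j" "j \<le> 3" using False j n34 by (auto simp: base_def)
      ultimately show ?thesis using rw[OF j] by (cases "w $ j = 4") auto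
    qed (use w0 j in \<open>simp add: base_def\<close>)
  qed (use c base_carrier in auto)
  then show ?thesis using ve vw by simp
qed

lemma F_base:
  assumes "length As = n"
  shows "F (map T As) base = K (e0, base) (map T As)"
proof (cases "K (e0, base) (map T As) = 0")
  case True
  then have "{\<omega> \<in> fiber base. K \<omega> (map T As) \<noteq> 0} = {}" using torus_fiber_base[OF _ assms] by auto
  then show ?thesis unfolding F_def True by (simp only: sum.empty)
next
  case False
  have "\<omega> \<in> {\<omega> \<in> fiber base. K \<omega> (map T As) \<noteq> 0} \<longleftrightarrow> \<omega> \<in> {(e0, base)}" for \<omega>
    using False torus_fiber_base[OF _ assms, of \<omega>] e0_base_fiber by blast
  then have e: "{\<omega> \<in> fiber base. K \<omega> (map T As) \<noteq> 0} = {(e0, base)}" by (simp only: set_eq_iff simp_thms)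
  show ?thesis unfolding F_def e by simp
qed

text \<open>In the cone of such a simplex, after scaling to \<open>w $ 0 = 1\<close>, coordinate
  \<open>j\<close> exceeds coordinate \<open>Suc j\<close> by no more than the perturbation, where
  coordinate \<open>n\<close> is read as 0. In \<open>base\<close> the excess is at least 1.\<close>

lemma F_base_zero:
  assumes As: "length As = n" and j: "0 < j" "j < n"
    and no: "\<And>A. A \<in> set As \<Longrightarrow> j \<in> A \<Longrightarrow> Suc j < n \<and> Suc j \<in> A"
  shows "F (map T As) base = 0"
proof (rule ccontr)
  assume "F (map T As) base \<noteq> 0"
  then have K: "K (e0, base) (map T As) \<noteq> 0" using F_base[OF As] by simp
  have p: "(e0, base) \<in> pairs" using e0_base_fiber by (simp add: fiber_def)
  have b: "base $ 0 = 1" using n_pos by (simp add: base_def)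
  obtain y where y: "\<And>k. k < n \<Longrightarrow> y k > 0" "(\<Sum>k<n. y k) = 1"
    "\<And>j. \<lbrakk>0 < j; j < n\<rbrakk> \<Longrightarrow> \<bar>rvec base j - 4 * (\<Sum>k<n. if j \<in> As ! k then y k else 0)\<bar> \<le> 1 / 100"
    using torus_barycentric[OF p b As K] by blast
  have bj: "rvec base j = 4 - real j" "real j \<le> 3" using j n34 by (auto simp: base_def)
  show False
  proof (cases "Suc j < n")
    case False
    then have "j \<notin> As ! k" if "k < n" for k using no[OF nth_mem, of k] As that by auto
    then have "(\<Sum>k<n. if j \<in> As ! k then y k else 0) = 0"
      by (intro sum.neutral) auto
    then show False using y(3)[OF j] bj by simp
  next
    case True
    have "(\<Sum>k<n. if j \<in> As ! k then y k else 0) \<le> (\<Sum>k<n. if Suc j \<in> As ! k then y k else 0)"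
      using no As y(1) by (intro sum_mono) (auto simp: nth_mem less_imp_le)
    moreover have "rvec base (Suc j) = 3 - real j" using True by (simp add: base_def)
    ultimately show False using y(3)[OF j] y(3)[OF zero_less_Suc True] bj unfolding abs_le_iff by linarith
  qed
qed

text \<open>Positivity is now the goal, so the coordinates come from inverting the matrix and their
  signs are unknown. The premise \<open>pos\<close> isolates the numerical estimate that supplies
  them.\<close>

lemma F_base_chain:
  assumes As: "length As = n"
    and pos: "\<And>y. \<lbrakk>(\<Sum>k<n. y k) = 1;
      \<And>j. \<lbrakk>0 < j; j < n\<rbrakk> \<Longrightarrow> \<bar>4 - real j - 4 * (\<Sum>k<n. if j \<in> As ! k then y k else 0)\<bar> \<le> (\<Sum>k<n. \<bar>y k\<bar>) / 100\<rbrakk>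
      \<Longrightarrow> \<forall>k<n. y k > 0"
  shows "F (map T As) base \<noteq> 0"
proof -
  have p: "(e0, base) \<in> pairs" using e0_base_fiber by (simp add: fiber_def)
  have SLs: "map T As \<in> SLs" using As T_closed by (auto simp: SLs_def)
  let ?A = "cols e0 (map T As)" and ?w = "map_vec real_of_int base"
  have A: "?A \<in> carrier_mat n n" "det ?A \<noteq> 0" using cols_carrier cols_generic(1)[OF p SLs] by auto
  define x where "x = (1 / det ?A) \<cdot>\<^sub>v (adj_mat ?A *\<^sub>v ?w)"
  have w: "?w \<in> carrier_vec n" using base_carrier by simp
  have adj: "adj_mat ?A \<in> carrier_mat n n" "?A * adj_mat ?A = det ?A \<cdot>\<^sub>m 1\<^sub>m n" using adj_mat[OF A(1)] by auto
  have x: "x \<in> carrier_vec n" using adj w by (simp add: x_def)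
  have "?A *\<^sub>v x = (1 / det ?A) \<cdot>\<^sub>v (?A *\<^sub>v (adj_mat ?A *\<^sub>v ?w))"
    unfolding x_def using mult_mat_vec_carrier[OF adj(1) w] by (rule mult_mat_vec[OF A(1)])
  also have "?A *\<^sub>v (adj_mat ?A *\<^sub>v ?w) = (?A * adj_mat ?A) *\<^sub>v ?w"
    by (rule assoc_mult_mat_vec[OF A(1) adj(1) w, symmetric])
  also have "(1 / det ?A) \<cdot>\<^sub>v ((?A * adj_mat ?A) *\<^sub>v ?w) = ?w"
  proof (rule eq_vecI)
    fix i assume "i < dim_vec ?w"
    then have i: "i < n" using base_carrier by simp
    have D: "det ?A \<cdot>\<^sub>m 1\<^sub>m n \<in> carrier_mat n n" by simp
    have "((det ?A \<cdot>\<^sub>m 1\<^sub>m n) *\<^sub>v ?w) $ i = (\<Sum>j<n. if j = i then det ?A * ?w $ i else 0)"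
      unfolding mult_mat_vec_nth[OF D w i] using i by (intro sum.cong) auto
    then show "((1 / det ?A) \<cdot>\<^sub>v ((?A * adj_mat ?A) *\<^sub>v ?w)) $ i = ?w $ i"
      unfolding adj(2) using i A(2) by simp
  qed (simp add: base_def cols_def)
  finally have Ax: "?A *\<^sub>v x = ?w" .
  have xs: "rvec base i = (\<Sum>k<n. x $ k * phi (ts k) (map T As ! k) (rvec e0) i)" if "i < n" for i
    using cols_mult[OF x that, of e0 "map T As"] Ax that base_carrier by simp
  have b0: "base $ 0 = 1" using n_pos by (simp add: base_def)
  have "\<forall>k<n. x $ k * (1 + ts k) > 0"
  proof (rule pos)
    show "(\<Sum>k<n. x $ k * (1 + ts k)) = 1"
      by (rule torus_coordinates(1)[OF base_carrier b0 As]) (rule xs)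
    fix j assume j: "0 < j" "j < n"
    have "rvec base j = 4 - real j" using j by (simp add: base_def)
    moreover have "\<bar>rvec base j - 4 * (\<Sum>k<n. if j \<in> As ! k then x $ k * (1 + ts k) else 0)\<bar>
        \<le> (\<Sum>k<n. \<bar>x $ k * (1 + ts k)\<bar>) / 100"
      by (rule torus_coordinates(2)[OF base_carrier b0 As _ j]) (rule xs)
    ultimately show "\<bar>4 - real j - 4 * (\<Sum>k<n. if j \<in> As ! k then x $ k * (1 + ts k) else 0)\<bar>
        \<le> (\<Sum>k<n. \<bar>x $ k * (1 + ts k)\<bar>) / 100" by simp
  qed
  then have "\<forall>k<n. x $ k > 0" using ts_bounds by (force simp: zero_less_mult_iff)
  then have "K (e0, base) (map T As) \<noteq> 0"
    using cone_count_eq[OF A x] Ax A(2) by (simp add: K_def sgn_zero_iff)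
  then show ?thesis using F_base[OF As] by simp
qed

text \<open>The elementary matrix makes the first entry \<open>1 - 3\<close>, which has class 2.
  That class contains no unit, so no pair over it can meet the torus.\<close>

definition base' :: "int vec" where
  "base' = residue (mat n n (\<lambda>(r, c). if r = c then 1 else if r = 0 \<and> c = 1 then - 1 else 0) *\<^sub>v base)"

lemma base'_orbit: "base' \<in> orbit"
proof -
  let ?h = "mat n n (\<lambda>(r, c). if r = c then 1 else if r = 0 \<and> c = 1 then - 1 else 0) :: int mat"
  have "det ?h = prod_list (diag_mat ?h)" by (rule det_upper_triangular[of _ n]) auto
  also have "diag_mat ?h = replicate n 1" by (rule nth_equalityI) (auto simp: diag_mat_def)
  finally have "?h \<in> carrier SL" by (simp add: SL_simps prod_list_replicate)
  then show ?thesis unfolding orbit_def base'_def by blast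
qed

lemma base'_0: "base' $ 0 = 2"
proof -
  let ?h = "mat n n (\<lambda>(r, c). if r = c then 1 else if r = 0 \<and> c = 1 then - 1 else 0) :: int mat"
  have "(?h *\<^sub>v base) $ 0 = (\<Sum>j<n. ?h $$ (0, j) * base $ j)"
    by (rule mult_mat_vec_nth[OF _ base_carrier n_pos]) simp
  also have "\<dots> = (\<Sum>j<n. (if j = 0 then 1 else 0) + (if j = 1 then - 3 else 0))"
    using n_pos by (intro sum.cong) (auto simp: base_def)
  also have "\<dots> = - 2" using n34 by (auto simp: sum.distrib)
  finally show ?thesis using n_pos by (simp add: base'_def residue_def)
qed

lemma F_base':
  assumes As: "length As = n"
  shows "F (map T As) base' = 0"
proof -
  have "\<not> (\<omega> \<in> fiber base' \<and> K \<omega> (map T As) \<noteq> 0)" for \<omega>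
  proof
    assume a: "\<omega> \<in> fiber base' \<and> K \<omega> (map T As) \<noteq> 0"
    obtain v w where vw: "\<omega> = (v, w)" by (cases \<omega>)
    have p: "(v, w) \<in> pairs" and r: "residue w = base'" and K: "K (v, w) (map T As) \<noteq> 0"
      using a vw by (auto simp: fiber_def)
    have "w \<in> carrier_vec n" using p by (simp add: pairs_def)
    then have w0: "w $ 0 mod 4 = 2"
      using arg_cong[OF r, of "\<lambda>u. u $ 0"] n_pos by (simp add: residue_def base'_0)
    have Tn: "\<exists>\<tau>. map T As ! k = U \<tau>" if "k < n" for k using As that by (auto simp: T_def)
    have "v $ 0 * w $ 0 = 1" by (rule torus_support(2)[OF p K Tn]) (use w0 in auto)
    then show False using w0 zmult_eq_1_iff[of "v $ 0" "w $ 0"] by auto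
  qed
  then have "{\<omega> \<in> fiber base'. K \<omega> (map T As) \<noteq> 0} = {}" by blast
  then show ?thesis unfolding F_def by (simp only: sum.empty)
qed

end

text \<open>With unknown signs the error is measured by the sum \<open>B\<close> of the absolute
  values. The hypotheses first bound \<open>B\<close> by 2; then \<open>a\<close>, \<open>b\<close>,
  \<open>c\<close> are close to 1/4, 1/4, 1/2.\<close>

lemma barycentric_positive3:
  fixes a b c :: real
  assumes s: "a + b + c = 1" and "\<bar>3 - 4 * (b + c)\<bar> \<le> (\<bar>a\<bar> + \<bar>b\<bar> + \<bar>c\<bar>) / 100"
    "\<bar>2 - 4 * c\<bar> \<le> (\<bar>a\<bar> + \<bar>b\<bar> + \<bar>c\<bar>) / 100"
  shows "0 < a \<and> 0 < b \<and> 0 < c"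
proof -
  define B where "B = \<bar>a\<bar> + \<bar>b\<bar> + \<bar>c\<bar>"
  have b: "\<bar>3 - 4 * (b + c)\<bar> \<le> B / 100" "\<bar>2 - 4 * c\<bar> \<le> B / 100" using assms by (simp_all add: B_def)
  note b = b[THEN abs_le_D1] b[THEN abs_le_D2]
  have "0 \<le> B" by (simp add: B_def)
  note b = b[unfolded distrib_left] this
  have "\<bar>a\<bar> \<le> 1 / 4 + B / 100" using b s by (intro abs_leI; linarith)
  moreover have "\<bar>b\<bar> \<le> 1 / 4 + B / 100" using b s by (intro abs_leI; linarith)
  moreover have "\<bar>c\<bar> \<le> 1 / 2 + B / 100" using b s by (intro abs_leI; linarith)
  ultimately have B: "B \<le> 2" using B_def by linarith
  have "0 < a" "0 < b" "0 < c" using b s B by linarith+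
  then show ?thesis by simp
qed

lemma barycentric_positive4:
  fixes a b c d :: real
  assumes s: "a + b + c + d = 1" and "\<bar>3 - 4 * (b + c + d)\<bar> \<le> (\<bar>a\<bar> + \<bar>b\<bar> + \<bar>c\<bar> + \<bar>d\<bar>) / 100"
    "\<bar>2 - 4 * (c + d)\<bar> \<le> (\<bar>a\<bar> + \<bar>b\<bar> + \<bar>c\<bar> + \<bar>d\<bar>) / 100"
    "\<bar>1 - 4 * d\<bar> \<le> (\<bar>a\<bar> + \<bar>b\<bar> + \<bar>c\<bar> + \<bar>d\<bar>) / 100"
  shows "0 < a \<and> 0 < b \<and> 0 < c \<and> 0 < d"
proof -
  define B where "B = \<bar>a\<bar> + \<bar>b\<bar> + \<bar>c\<bar> + \<bar>d\<bar>"
  have b: "\<bar>3 - 4 * (b + c + d)\<bar> \<le> B / 100" "\<bar>2 - 4 * (c + d)\<bar> \<le> B / 100" "\<bar>1 - 4 * d\<bar> \<le> B / 100"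
    using assms by (simp_all add: B_def)
  note b = b[THEN abs_le_D1] b[THEN abs_le_D2]
  have "0 \<le> B" by (simp add: B_def)
  note b = b[unfolded distrib_left] this
  have "\<bar>a\<bar> \<le> 1 / 4 + B / 100" using b s by (intro abs_leI; linarith)
  moreover have "\<bar>b\<bar> \<le> 1 / 4 + B / 100" using b s by (intro abs_leI; linarith)
  moreover have "\<bar>c\<bar> \<le> 1 / 4 + B / 100" using b s by (intro abs_leI; linarith)
  moreover have "\<bar>d\<bar> \<le> 1 / 4 + B / 100" using b s by (intro abs_leI; linarith)
  ultimately have B: "B \<le> 2" using B_def by linarith
  have "0 < a" "0 < b" "0 < c" "0 < d" using b s B by linarith+
  then show ?thesis by simp
qed

context low_dimension
begin

section \<open>Explicit simplices in dimensions 3 and 4\<close>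

lemma products_T2: "A \<inter> B = {} \<Longrightarrow> products SL \<one>\<^bsub>SL\<^esub> [T A, T B] = [T {}, T A, T (A \<union> B)]"
  using T_closed SL.l_one[OF T_closed, of A] by (simp add: T_empty) (simp add: SL_simps(2) T_mult)

lemma products_T3:
  "\<lbrakk>A \<inter> B = {}; (A \<union> B) \<inter> C = {}\<rbrakk> \<Longrightarrow>
   products SL \<one>\<^bsub>SL\<^esub> [T A, T B, T C] = [T {}, T A, T (A \<union> B), T (A \<union> B \<union> C)]"
  using T_closed SL.l_one[OF T_closed, of A] by (simp add: T_empty) (simp add: SL_simps(2) T_mult)

text \<open>These conditions on vertex sets discard every simplex that occurs in the evaluation
  except the chain \<open>{}\<close>, \<open>{1}\<close>, \<open>{1, 2}\<close>.\<close>

lemma F3_base_zero: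
  assumes "n = 3"
  shows "(\<forall>A\<in>{A0, A1, A2}. 1 \<in> A \<longrightarrow> 2 \<in> A) \<Longrightarrow> F [T A0, T A1, T A2] base = 0"
    and "(\<forall>A\<in>{A0, A1, A2}. 2 \<notin> A) \<Longrightarrow> F [T A0, T A1, T A2] base = 0"
  using F_base_zero[of "[A0, A1, A2]" 1] F_base_zero[of "[A0, A1, A2]" 2] assms
  by (auto simp: numeral_2_eq_2 numeral_3_eq_3)

lemma F4_base_zero:
  assumes "n = 4"
  shows "(\<forall>A\<in>{A0, A1, A2, A3}. 1 \<in> A \<longrightarrow> 2 \<in> A) \<Longrightarrow> F [T A0, T A1, T A2, T A3] base = 0"
    and "(\<forall>A\<in>{A0, A1, A2, A3}. 2 \<in> A \<longrightarrow> 3 \<in> A) \<Longrightarrow> F [T A0, T A1, T A2, T A3] base = 0"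
    and "(\<forall>A\<in>{A0, A1, A2, A3}. 3 \<notin> A) \<Longrightarrow> F [T A0, T A1, T A2, T A3] base = 0"
  using F_base_zero[of "[A0, A1, A2, A3]" 1] F_base_zero[of "[A0, A1, A2, A3]" 2]
    F_base_zero[of "[A0, A1, A2, A3]" 3] assms
  by (auto simp: numeral_2_eq_2 numeral_3_eq_3)

lemma F3_chain:
  assumes n: "n = 3"
  shows "F [T {}, T {1}, T {1, 2}] base \<noteq> 0"
proof -
  have "F (map T [{}, {1}, {1, 2}]) base \<noteq> 0"
  proof (rule F_base_chain)
    fix y :: "nat \<Rightarrow> real"
    have lt: "{..<n} = {0, 1, 2}" using n by auto
    assume s: "(\<Sum>k<n. y k) = 1" and b: "\<And>j. \<lbrakk>0 < j; j < n\<rbrakk> \<Longrightarrow>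
      \<bar>4 - real j - 4 * (\<Sum>k<n. if j \<in> [{}, {1}, {1, 2}] ! k then y k else 0)\<bar> \<le> (\<Sum>k<n. \<bar>y k\<bar>) / 100"
    have s': "y 0 + y 1 + y 2 = 1" using s by (simp add: lt)
    have "\<bar>3 - 4 * (y 1 + y 2)\<bar> \<le> (\<bar>y 0\<bar> + \<bar>y 1\<bar> + \<bar>y 2\<bar>) / 100"
      "\<bar>2 - 4 * y 2\<bar> \<le> (\<bar>y 0\<bar> + \<bar>y 1\<bar> + \<bar>y 2\<bar>) / 100"
      using b[of 1, unfolded lt] b[of 2, unfolded lt] n by (simp_all add: add.assoc)
    from barycentric_positive3[OF s' this]
    show "\<forall>k<n. y k > 0" using lt by (metis insertE lessThan_iff singletonD)
  qed (use n in simp)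
  then show ?thesis by simp
qed

lemma F4_chain:
  assumes n: "n = 4"
  shows "F [T {}, T {1}, T {1, 2}, T {1, 2, 3}] base \<noteq> 0"
proof -
  have "F (map T [{}, {1}, {1, 2}, {1, 2, 3}]) base \<noteq> 0"
  proof (rule F_base_chain)
    fix y :: "nat \<Rightarrow> real"
    have lt: "{..<n} = {0, 1, 2, 3}" using n by auto
    assume s: "(\<Sum>k<n. y k) = 1" and b: "\<And>j. \<lbrakk>0 < j; j < n\<rbrakk> \<Longrightarrow>
      \<bar>4 - real j - 4 * (\<Sum>k<n. if j \<in> [{}, {1}, {1, 2}, {1, 2, 3}] ! k then y k else 0)\<bar> \<le> (\<Sum>k<n. \<bar>y k\<bar>) / 100"
    have s': "y 0 + y 1 + y 2 + y 3 = 1" using s by (simp add: lt)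
    have "\<bar>3 - 4 * (y 1 + y 2 + y 3)\<bar> \<le> (\<bar>y 0\<bar> + \<bar>y 1\<bar> + \<bar>y 2\<bar> + \<bar>y 3\<bar>) / 100"
      "\<bar>2 - 4 * (y 2 + y 3)\<bar> \<le> (\<bar>y 0\<bar> + \<bar>y 1\<bar> + \<bar>y 2\<bar> + \<bar>y 3\<bar>) / 100"
      "\<bar>1 - 4 * y 3\<bar> \<le> (\<bar>y 0\<bar> + \<bar>y 1\<bar> + \<bar>y 2\<bar> + \<bar>y 3\<bar>) / 100"
      using b[of 1, unfolded lt] b[of 2, unfolded lt] b[of 3, unfolded lt] n by (simp_all add: add.assoc)
    from barycentric_positive4[OF s' this]
    show "\<forall>k<n. y k > 0" using lt by (metis insertE lessThan_iff singletonD)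
  qed (use n in simp)
  then show ?thesis by simp
qed

lemma tuples_T: "T A # gs \<in> tuples SL (Suc m) \<longleftrightarrow> gs \<in> tuples SL m" "[] \<in> tuples SL 0"
  using T_closed by (auto simp: tuples_def)

lemma numeral_sums: "(\<Sum>m<2. f m) = f 0 + f (1::nat)"
  "(\<Sum>m<3. f m) = f 0 + f (1::nat) + f 2"
  "(\<Sum>m<6. f m) = f 0 + f (1::nat) + f 2 + f 3 + f 4 + f 5" for f :: "nat \<Rightarrow> 'a::comm_monoid_add"
  by (simp_all add: numeral_eq_Suc)

lemma d_pair:
  assumes "s \<in> orbit"
  shows "orb.d f [T A, T B] s = f [T B] s - f [T A * T B] s + f [T A] s"
  using assms by (simp add: orb.d_def act_inv_T SL_simps(2))

lemma d_triple:
  assumes "s \<in> orbit"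
  shows "orb.d f [T A, T B, T C] s = f [T B, T C] s - f [T A * T B, T C] s + f [T A, T B * T C] s - f [T A, T B] s"
  using assms by (simp add: orb.d_def act_inv_T SL_simps(2))

text \<open>The fundamental class of the torus in the bar complex is the signed sum over all
  orderings of the generators; \<open>sign3\<close> and \<open>sign4\<close> are the signs of these
  permutations.\<close>

definition cycle3 :: "nat \<Rightarrow> int mat list" where
  "cycle3 m = [[T {1}, T {2}], [T {2}, T {1}]] ! m"

definition sign3 :: "nat \<Rightarrow> real" where "sign3 m = [1, - 1] ! m"

definition cycle4 :: "nat \<Rightarrow> int mat list" where
  "cycle4 m = [[T {1}, T {2}, T {3}], [T {2}, T {3}, T {1}], [T {3}, T {1}, T {2}],
     [T {2}, T {1}, T {3}], [T {1}, T {3}, T {2}], [T {3}, T {2}, T {1}]] ! m"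

definition sign4 :: "nat \<Rightarrow> real" where "sign4 m = [1, 1, 1, - 1, - 1, - 1] ! m"

text \<open>The elements \<open>T A\<close> fix \<open>s\<close> and commute with each other, so the
  faces cancel in pairs.\<close>

lemma cycle3_boundary:
  fixes f :: "int mat list \<Rightarrow> int vec \<Rightarrow> 'k::real_normed_field"
  assumes "s \<in> orbit"
  shows "(\<Sum>m<2. of_real (sign3 m) * orb.d f (cycle3 m) s) = 0"
  using assms T_commute[of "{1}" "{2}"] by (simp add: numeral_sums cycle3_def sign3_def d_pair)

lemma cycle4_boundary:
  fixes f :: "int mat list \<Rightarrow> int vec \<Rightarrow> 'k::real_normed_field"
  assumes "s \<in> orbit"
  shows "(\<Sum>m<6. of_real (sign4 m) * orb.d f (cycle4 m) s) = 0"
  using assms T_commute[of "{1}" "{2}"] T_commute[of "{1}" "{3}"] T_commute[of "{2}" "{3}"]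
  by (simp add: numeral_sums cycle4_def sign4_def d_triple)

lemma F_base'_list: "n = 3 \<Longrightarrow> F [T A0, T A1, T A2] base' = 0"
  "n = 4 \<Longrightarrow> F [T A0, T A1, T A2, T A3] base' = 0"
  using F_base'[of "[A0, A1, A2]"] F_base'[of "[A0, A1, A2, A3]"] by simp_all

text \<open>Besides the simplex on the actual vertices, \<open>Delta\<close> produces simplices with
  repeated vertices. As the slots carry different forms, these do not vanish formally; at
  \<open>base\<close> they are discarded by \<open>F3_base_zero\<close>.\<close>

lemma cocycle_pair:
  assumes "A \<inter> B = {}"
  shows "cocycle [T A, T B] s = F [T {}, T A, T (A \<union> B)] s - F [T {}, T {}, T (A \<union> B)] s
    - F [T {}, T A, T A] s + F [T {}, T {}, T A] s"
  unfolding cocycle_def products_T2[OF assms] unfolding T_empty[symmetric] by simp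

lemma cocycle_triple:
  assumes "A \<inter> B = {}" "(A \<union> B) \<inter> C = {}"
  shows "cocycle [T A, T B, T C] s =
      F [T {}, T A, T (A \<union> B), T (A \<union> B \<union> C)] s - F [T {}, T {}, T (A \<union> B), T (A \<union> B \<union> C)] s
    - F [T {}, T A, T A, T (A \<union> B \<union> C)] s + F [T {}, T {}, T A, T (A \<union> B \<union> C)] s
    - F [T {}, T A, T (A \<union> B), T (A \<union> B)] s + F [T {}, T {}, T (A \<union> B), T (A \<union> B)] s
    + F [T {}, T A, T A, T (A \<union> B)] s - F [T {}, T {}, T A, T (A \<union> B)] s"
  unfolding cocycle_def products_T3[OF assms] unfolding T_empty[symmetric] by simp

lemma cycle3_pairing:
  assumes n: "n = 3"
  shows "(\<Sum>m<2. sign3 m * (cocycle (cycle3 m) base - cocycle (cycle3 m) base')) \<noteq> 0"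
proof -
  have "(\<Sum>m<2. sign3 m * (cocycle (cycle3 m) base - cocycle (cycle3 m) base')) = F [T {}, T {1}, T {1, 2}] base"
    by (simp add: numeral_sums cycle3_def sign3_def cocycle_pair F_base'_list(1)[OF n] F3_base_zero[OF n] insert_commute)
  then show ?thesis using F3_chain[OF n] by simp
qed

lemma cycle4_pairing:
  assumes n: "n = 4"
  shows "(\<Sum>m<6. sign4 m * (cocycle (cycle4 m) base - cocycle (cycle4 m) base')) \<noteq> 0"
proof -
  have "(\<Sum>m<6. sign4 m * (cocycle (cycle4 m) base - cocycle (cycle4 m) base'))
      = F [T {}, T {1}, T {1, 2}, T {1, 2, 3}] base"
    by (simp add: numeral_sums cycle4_def sign4_def cocycle_triple F_base'_list(2)[OF n] F4_base_zero[OF n] insert_commute)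
  then show ?thesis using F4_chain[OF n] by simp
qed

end

theorem theorem1p1:
  fixes N :: nat
  assumes "N \<in> {3, 4}"
  shows "(\<exists>(H :: (real, real vec) inner_space) \<pi>.
            orthogonal_representation (SL_int N) H \<pi> \<and>
            finite_dimensional H \<and>
            invariant_vectors (SL_int N) H \<pi> = {\<zero>\<^bsub>H\<^esub>} \<and>
            carrier (cohomology (SL_int N) H \<pi> (N - 1)) \<noteq> {\<one>\<^bsub>cohomology (SL_int N) H \<pi> (N - 1)\<^esub>} \<and>
            (\<forall>n. reduced_cohomology (SL_int N) H \<pi> n = cohomology (SL_int N) H \<pi> n)) \<and>
         \<not> property_T TYPE(nat \<Rightarrow> complex) (SL_int N) (N - 1)"
proof -
  interpret D: dimension N using assms by unfold_locales auto
  obtain ts where ts: "\<forall>j<N. 0 < ts j \<and> ts j < 1 / 100 \<and> D.avoids ts j"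
    using D.ex_generic_parameters[of "1 / 100" N] by auto
  interpret low_dimension N ts using assms ts by unfold_locales auto
  show ?thesis
    using n34
  proof
    assume n: "N = 3"
    have tup: "cycle3 m \<in> tuples (SL_int N) (Suc 1)" if "m \<in> {..<2}" for m
      using that by (auto simp: cycle3_def tuples_T less_2_cases_iff)
    have coc: "orb.d cocycle gs s = 0" if "gs \<in> tuples (SL_int N) (Suc (Suc 1))" "s \<in> orbit" for gs s
      using cocycle[of gs s] that n by (simp add: numeral_3_eq_3)
    have van: "(\<Sum>m<2. sign3 m * orb.d f (cycle3 m) s) = 0" if "s \<in> {base, base'}" for f s
      using cycle3_boundary[of s f] that base_orbit base'_orbit by auto
    have vanc: "(\<Sum>m<2. of_real (sign3 m) * orb.d f (cycle3 m) s) = 0" if "s \<in> {base, base'}"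
      for f :: "int mat list \<Rightarrow> int vec \<Rightarrow> complex" and s
      using cycle3_boundary[of s f] that base_orbit base'_orbit by auto
    have n1: "N - 1 = Suc 1" using n by simp
    show ?thesis
      unfolding n1
      using orb.cohomology_of_cocycle[OF coc finite_lessThan tup base_orbit base'_orbit cycle3_pairing[OF n] van vanc]
      by (rule conjI)
  next
    assume n: "N = 4"
    have tup: "cycle4 m \<in> tuples (SL_int N) (Suc 2)" if "m \<in> {..<6}" for m
    proof -
      have "m = 0 \<or> m = 1 \<or> m = 2 \<or> m = 3 \<or> m = 4 \<or> m = 5" using that by auto
      then show ?thesis by (auto simp: cycle4_def tuples_T numeral_2_eq_2)
    qed
    have coc: "orb.d cocycle gs s = 0" if "gs \<in> tuples (SL_int N) (Suc (Suc 2))" "s \<in> orbit" for gs s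
      using cocycle[of gs s] that n by simp
    have van: "(\<Sum>m<6. sign4 m * orb.d f (cycle4 m) s) = 0" if "s \<in> {base, base'}" for f s
      using cycle4_boundary[of s f] that base_orbit base'_orbit by auto
    have vanc: "(\<Sum>m<6. of_real (sign4 m) * orb.d f (cycle4 m) s) = 0" if "s \<in> {base, base'}"
      for f :: "int mat list \<Rightarrow> int vec \<Rightarrow> complex" and s
      using cycle4_boundary[of s f] that base_orbit base'_orbit by auto
    have n1: "N - 1 = Suc 2" using n by simp
    show ?thesis
      unfolding n1
      using orb.cohomology_of_cocycle[OF coc finite_lessThan tup base_orbit base'_orbit cycle4_pairing[OF n] van vanc]
      by (rule conjI)
  qed
qed

end
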